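(* There exist $\tilde p<1$ and $\kappa>0$ such that, for every $p$ with $\tilde p\le p<1$, every $c\ge 1$ and every box $\Lambda$ satisfying $|\Lambda|\ge \max\{(cd)^{cd^2},3^{6d}\}$, $$\mu_p\Big(\exists e\in\mathcal P\cup\mathcal I,\ d\big(e,\Lambda^c\cup(\mathcal P\setminus\{e\})\big)\ge \kappa c^2\ln^2|\Lambda|\Big)\le \frac1{|\Lambda|^c}.$$
   Context: Fix an integer $d\ge 2$. $\mathbb E^d$ is the set of pairs $\{x,y\}$ of points of $\mathbb Z^d$ at Euclidean distance $1$; an edge is identified with the corresponding closed unit segment. $\Lambda$ is a closed cubic box of positive side length in $\mathbb R^d$, centred at the origin, with sides parallel to the axes and corners in $\mathbb Z^d$; $|\Lambda|$ is the cardinality of $\Lambda\cap\mathbb Z^d$; $\Lambda^c=\mathbb R^d\setminus\Lambda$; $T$ and $B$ are the top and bottom sides (faces) of $\Lambda$. A configuration is a map $\omega$ from the set of edges included in $\Lambda$ to $\{0,1\}$; $e$ is open if $\omega(e)=1$, closed if $\omega(e)=0$. $T\overset{\omega}{\longleftrightarrow}B$ means that a path of open edges joins a vertex of $T$ to a vertex of $B$; $T\overset{\omega}{\not\longleftrightarrow}B$ (here $\not\longleftrightarrow$ is read "is not connected to") is its negation. $\omega^e$ is the configuration obtained from $\omega$ by opening $e$. Coupling. Let $0<p<1$. Let $(E_t)_{t\ge1}$ be i.i.d. uniform on the edges included in $\Lambda$ and $(B_t)_{t\ge1}$ i.i.d. Bernoulli($p$), all independent of each other and of $(X_0,Y_0)$.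 For $t\ge1$: $X_t(e)=X_{t-1}(e)$ and $Y_t(e)=Y_{t-1}(e)$ for $e\ne E_t$; $X_t(E_t)=B_t$; $Y_t(E_t)=1$ if $B_t=1$ and $T$ is not connected to $B$ in $Y_{t-1}^{E_t}$, and $Y_t(E_t)=0$ otherwise. This Markov chain, on the set of pairs $(\omega_1,\omega_2)$ with $\omega_1\ge\omega_2$ edgewise and $T$ not connected to $B$ in $\omega_2$, has a unique equilibrium distribution, denoted $\mu_p$; let $(X,Y)$ have law $\mu_p$. $\mathcal I=\{e\subset\Lambda: X(e)\ne Y(e)\}$ is the interface, and $\mathcal P=\{e\subset\Lambda: T\overset{Y^e}{\longleftrightarrow}B\}$ is the set of pivotal edges. $d(\cdot,\cdot)$ is Euclidean distance (between sets, the infimum), a set of edges being viewed as the union of its segments; $d$ alone is the dimension. The constants depend only on $d$. *)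

theory Defs
  imports "HOL-Probability.Probability"
begin

definition lattice :: "(real ^ 'd) set" where
  "lattice = {x. \<forall>i. x $ i \<in> \<int>}"

definition cubic_box :: "(real ^ 'd) set \<Rightarrow> bool" where
  "cubic_box \<Lambda> \<longleftrightarrow> (\<exists>r>0. \<Lambda> = cbox (\<chi> i. - r) (\<chi> i. r) \<and>
     {x :: real ^ 'd. \<forall>i. \<bar>x $ i\<bar> = r} \<subseteq> lattice)"

text \<open>The coordinate direction \<open>v\<close> plays the role of the vertical axis.\<close>

definition top_face :: "'d::finite \<Rightarrow> (real ^ 'd) set \<Rightarrow> (real ^ 'd) set" where
  "top_face v \<Lambda> = {x \<in> \<Lambda>. \<forall>y\<in>\<Lambda>. y $ v \<le> x $ v}"

definition bottom_face :: "'d::finite \<Rightarrow> (real ^ 'd) set \<Rightarrow> (real ^ 'd) set" where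
  "bottom_face v \<Lambda> = {x \<in> \<Lambda>. \<forall>y\<in>\<Lambda>. x $ v \<le> y $ v}"

text \<open>An edge is the pair of its endpoints; the corresponding closed segment is its convex hull.\<close>

type_synonym 'd edge = "(real ^ 'd) set"

definition lattice_edges :: "('d::finite) edge set" where
  "lattice_edges = {{x, y} | x y. x \<in> lattice \<and> y \<in> lattice \<and> dist x y = 1}"

abbreviation segment :: "('d::finite) edge \<Rightarrow> (real ^ 'd) set" where
  "segment e \<equiv> convex hull e"

definition edges_in :: "(real ^ 'd::finite) set \<Rightarrow> 'd edge set" where
  "edges_in \<Lambda> = {e \<in> lattice_edges. segment e \<subseteq> \<Lambda>}"

text \<open>\<open>True\<close> stands for 1 (open) and \<open>False\<close> for 0 (closed). A configuration is
  a function on \<open>edges_in \<Lambda>\<close>, extended by \<open>undefined\<close> outside.\<close>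

type_synonym 'd config = "'d edge \<Rightarrow> bool"

definition configs :: "(real ^ 'd::finite) set \<Rightarrow> 'd config set" where
  "configs \<Lambda> = edges_in \<Lambda> \<rightarrow>\<^sub>E UNIV"

definition open_step :: "(real ^ 'd::finite) set \<Rightarrow> 'd config \<Rightarrow> ((real ^ 'd) \<times> (real ^ 'd)) set" where
  "open_step \<Lambda> \<omega> = {(x, y). {x, y} \<in> edges_in \<Lambda> \<and> \<omega> {x, y}}"

definition top_bottom_connected :: "'d::finite \<Rightarrow> (real ^ 'd) set \<Rightarrow> 'd config \<Rightarrow> bool" where
  "top_bottom_connected v \<Lambda> \<omega> \<longleftrightarrow>
     (\<exists>x \<in> top_face v \<Lambda> \<inter> lattice. \<exists>y \<in> bottom_face v \<Lambda> \<inter> lattice. (x, y) \<in> (open_step \<Lambda> \<omega>)\<^sup>*)"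

definition coupled_states :: "'d::finite \<Rightarrow> (real ^ 'd) set \<Rightarrow> ('d config \<times> 'd config) set" where
  "coupled_states v \<Lambda> = {(\<omega>1, \<omega>2). \<omega>1 \<in> configs \<Lambda> \<and> \<omega>2 \<in> configs \<Lambda> \<and>
     (\<forall>e\<in>edges_in \<Lambda>. \<omega>2 e \<le> \<omega>1 e) \<and> \<not> top_bottom_connected v \<Lambda> \<omega>2}"

text \<open>The law of \<open>(X\<^sub>t, Y\<^sub>t)\<close> given \<open>(X\<^sub>t\<^sub>-\<^sub>1, Y\<^sub>t\<^sub>-\<^sub>1)\<close>.\<close>

definition coupling_step ::
  "'d::finite \<Rightarrow> (real ^ 'd) set \<Rightarrow> real \<Rightarrow> 'd config \<times> 'd config \<Rightarrow> ('d config \<times> 'd config) pmf" where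
  "coupling_step v \<Lambda> p = (\<lambda>(x, y).
     bind_pmf (pmf_of_set (edges_in \<Lambda>)) (\<lambda>e.
     bind_pmf (bernoulli_pmf p) (\<lambda>b.
     return_pmf (x(e := b), y(e := (b \<and> \<not> top_bottom_connected v \<Lambda> (y(e := True))))))))"

definition is_equilibrium ::
  "'d::finite \<Rightarrow> (real ^ 'd) set \<Rightarrow> real \<Rightarrow> ('d config \<times> 'd config) pmf \<Rightarrow> bool" where
  "is_equilibrium v \<Lambda> p \<mu> \<longleftrightarrow>
     set_pmf \<mu> \<subseteq> coupled_states v \<Lambda> \<and> bind_pmf \<mu> (coupling_step v \<Lambda> p) = \<mu>"

text \<open>Existence and uniqueness hold by \<open>ex1_equilibrium\<close> below.\<close>

definition equilibrium ::
  "'d::finite \<Rightarrow> (real ^ 'd) set \<Rightarrow> real \<Rightarrow> ('d config \<times> 'd config) pmf" where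
  "equilibrium v \<Lambda> p = (THE \<mu>. is_equilibrium v \<Lambda> p \<mu>)"

definition interface :: "(real ^ 'd::finite) set \<Rightarrow> 'd config \<Rightarrow> 'd config \<Rightarrow> 'd edge set" where
  "interface \<Lambda> X Y = {e \<in> edges_in \<Lambda>. X e \<noteq> Y e}"

definition pivotal :: "'d::finite \<Rightarrow> (real ^ 'd) set \<Rightarrow> 'd config \<Rightarrow> 'd edge set" where
  "pivotal v \<Lambda> Y = {e \<in> edges_in \<Lambda>. top_bottom_connected v \<Lambda> (Y(e := True))}"

text \<open>Existence and uniqueness of the equilibrium: every state reaches the pair of
  all-closed configurations in as many steps as there are edges.\<close>

lemma pmf_bind_finite:
  fixes \<mu> :: "'s pmf"
  assumes "finite S" "set_pmf \<mu> \<subseteq> S"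
  shows "pmf (bind_pmf \<mu> K) j = (\<Sum>s\<in>S. pmf \<mu> s * pmf (K s) j)"
  unfolding pmf_bind using integral_measure_pmf_real[OF assms(1), of \<mu> "\<lambda>x. pmf (K x) j"] assms(2)
  by (auto simp: mult.commute)

lemma doeblin_ex1:
  fixes K :: "'s \<Rightarrow> 's pmf"
  assumes fin: "finite S" and s0: "s0 \<in> S"
    and closed: "\<And>s. s \<in> S \<Longrightarrow> set_pmf (K s) \<subseteq> S"
    and hit: "\<And>s. s \<in> S \<Longrightarrow> s0 \<in> set_pmf (K s)"
  shows "\<exists>!\<mu>. set_pmf \<mu> \<subseteq> S \<and> bind_pmf \<mu> K = \<mu>"
proof -
  define D where "D = (\<lambda>\<mu> \<nu> :: 's pmf. \<Sum>j\<in>S. \<bar>pmf \<mu> j - pmf \<nu> j\<bar>)"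
  define G where "G = (\<lambda>\<mu>. bind_pmf \<mu> K)"
  define \<epsilon> where "\<epsilon> = Min ((\<lambda>s. pmf (K s) s0) ` S)"
  have eps_le: "\<epsilon> \<le> pmf (K s) s0" if "s \<in> S" for s
    unfolding \<epsilon>_def using fin that by simp
  have eps_pos: "\<epsilon> > 0"
    unfolding \<epsilon>_def using fin s0 hit by (subst Min_gr_iff) (auto simp: pmf_positive_iff)
  have eps_le1: "\<epsilon> \<le> 1" using eps_le[OF s0] pmf_le_1[of "K s0" s0] by linarith
  have G_in: "set_pmf (G \<mu>) \<subseteq> S" if "set_pmf \<mu> \<subseteq> S" for \<mu>
    using that closed unfolding G_def by (auto simp: set_bind_pmf)
  have contr: "D (G \<mu>) (G \<nu>) \<le> (1 - \<epsilon>) * D \<mu> \<nu>" if m: "set_pmf \<mu> \<subseteq> S" and n: "set_pmf \<nu> \<subseteq> S" for \<mu> \<nu>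
  proof -
    define \<alpha> where "\<alpha> = (\<lambda>s. pmf \<mu> s - pmf \<nu> s)"
    define R where "R = (\<lambda>s j. pmf (K s) j - (if j = s0 then \<epsilon> else 0))"
    have R0: "R s j \<ge> 0" if "s \<in> S" for s j using eps_le[OF that] by (simp add: R_def)
    have Rsum: "(\<Sum>j\<in>S. R s j) = 1 - \<epsilon>" if "s \<in> S" for s
      unfolding R_def using fin s0 closed[OF that] by (simp add: sum_subtractf sum_pmf_eq_1)
    have a0: "(\<Sum>s\<in>S. \<alpha> s) = 0"
      unfolding \<alpha>_def using fin m n by (simp add: sum_subtractf sum_pmf_eq_1)
    have eq: "pmf (G \<mu>) j - pmf (G \<nu>) j = (\<Sum>s\<in>S. \<alpha> s * R s j)" for j
    proof -
      have "(\<Sum>s\<in>S. \<alpha> s * R s j) = (\<Sum>s\<in>S. \<alpha> s * pmf (K s) j) - (\<Sum>s\<in>S. \<alpha> s) * (if j = s0 then \<epsilon> else 0)"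
        by (simp add: R_def right_diff_distrib sum_subtractf sum_distrib_right)
      also have "\<dots> = (\<Sum>s\<in>S. \<alpha> s * pmf (K s) j)" using a0 by simp
      also have "\<dots> = pmf (G \<mu>) j - pmf (G \<nu>) j"
        unfolding G_def pmf_bind_finite[OF fin m] pmf_bind_finite[OF fin n] \<alpha>_def
        by (simp add: left_diff_distrib sum_subtractf)
      finally show ?thesis by simp
    qed
    have "D (G \<mu>) (G \<nu>) = (\<Sum>j\<in>S. \<bar>\<Sum>s\<in>S. \<alpha> s * R s j\<bar>)" by (simp add: D_def eq)
    also have "\<dots> \<le> (\<Sum>j\<in>S. \<Sum>s\<in>S. \<bar>\<alpha> s\<bar> * R s j)"
    proof (rule sum_mono)
      fix j
      have "\<bar>\<Sum>s\<in>S. \<alpha> s * R s j\<bar> \<le> (\<Sum>s\<in>S. \<bar>\<alpha> s * R s j\<bar>)" by (rule sum_abs)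
      also have "\<dots> = (\<Sum>s\<in>S. \<bar>\<alpha> s\<bar> * R s j)" using R0 by (intro sum.cong) (auto simp: abs_mult)
      finally show "\<bar>\<Sum>s\<in>S. \<alpha> s * R s j\<bar> \<le> (\<Sum>s\<in>S. \<bar>\<alpha> s\<bar> * R s j)" .
    qed
    also have "\<dots> = (\<Sum>s\<in>S. \<bar>\<alpha> s\<bar> * (\<Sum>j\<in>S. R s j))"
      by (subst sum.swap) (simp add: sum_distrib_left)
    also have "\<dots> = (1 - \<epsilon>) * D \<mu> \<nu>"
      using Rsum by (simp add: D_def \<alpha>_def sum_distrib_left mult.commute)
    finally show ?thesis .
  qed
  have D0: "\<mu> = \<nu>" if m: "set_pmf \<mu> \<subseteq> S" and n: "set_pmf \<nu> \<subseteq> S" and d: "D \<mu> \<nu> \<le> 0" for \<mu> \<nu>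
  proof (rule pmf_eqI)
    fix j
    have "D \<mu> \<nu> = 0" using d by (simp add: D_def antisym sum_nonneg)
    then have z: "\<bar>pmf \<mu> j - pmf \<nu> j\<bar> = 0" if "j \<in> S"
      using that fin unfolding D_def by (subst (asm) sum_nonneg_eq_0_iff) auto
    show "pmf \<mu> j = pmf \<nu> j"
    proof (cases "j \<in> S")
      case False
      then have "j \<notin> set_pmf \<mu>" "j \<notin> set_pmf \<nu>" using m n by auto
      then show ?thesis by (simp add: pmf_eq_0_set_pmf[THEN iffD2])
    qed (use z in simp)
  qed
  have uniq: "\<mu> = \<nu>" if "set_pmf \<mu> \<subseteq> S" "set_pmf \<nu> \<subseteq> S" "G \<mu> = \<mu>" "G \<nu> = \<nu>" for \<mu> \<nu>
  proof (rule D0)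
    have "\<epsilon> * D \<mu> \<nu> \<le> 0" using contr[OF that(1,2)] that by (simp add: left_diff_distrib)
    then show "D \<mu> \<nu> \<le> 0" using eps_pos by (simp add: mult_le_0_iff)
  qed (use that in auto)
  define x where "x = (\<lambda>n. (G ^^ n) (return_pmf s0))"
  have xin: "set_pmf (x n) \<subseteq> S" for n
    by (induction n) (auto simp: x_def s0 dest: G_in[THEN subsetD, rotated])
  have step: "D (x (Suc n)) (x n) \<le> (1 - \<epsilon>) ^ n * D (x 1) (x 0)" for n
  proof (induction n)
    case (Suc n)
    have "D (x (Suc (Suc n))) (x (Suc n)) \<le> (1 - \<epsilon>) * D (x (Suc n)) (x n)"
      using contr[OF xin xin, of "Suc n" n] by (simp add: x_def)
    also have "\<dots> \<le> (1 - \<epsilon>) * ((1 - \<epsilon>) ^ n * D (x 1) (x 0))"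
      using Suc eps_le1 by (intro mult_left_mono) auto
    finally show ?case by (simp add: mult.assoc)
  qed simp
  have conv: "convergent (\<lambda>n. pmf (x n) j)" if "j \<in> S" for j
  proof -
    have "summable (\<lambda>n. pmf (x (Suc n)) j - pmf (x n) j)"
    proof (rule summable_comparison_test')
      show "summable (\<lambda>n. (1 - \<epsilon>) ^ n * D (x 1) (x 0))"
        using eps_pos eps_le1 by (intro summable_mult2 summable_geometric) auto
      fix n :: nat
      have "norm (pmf (x (Suc n)) j - pmf (x n) j) \<le> D (x (Suc n)) (x n)"
        unfolding D_def using fin that by (simp add: member_le_sum[where f = "\<lambda>j. \<bar>pmf (x (Suc n)) j - pmf (x n) j\<bar>"])
      with step[of n] show "norm (pmf (x (Suc n)) j - pmf (x n) j) \<le> (1 - \<epsilon>) ^ n * D (x 1) (x 0)"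
        by linarith
    qed
    then have "convergent (\<lambda>n. \<Sum>i<n. pmf (x (Suc i)) j - pmf (x i) j)"
      by (simp add: summable_iff_convergent)
    then have "convergent (\<lambda>n. pmf (x n) j - pmf (x 0) j)"
      unfolding sum_lessThan_telescope[of "\<lambda>n. pmf (x n) j" for j] .
    then have "convergent (\<lambda>n. (pmf (x n) j - pmf (x 0) j) + pmf (x 0) j)"
      by (intro convergent_add convergent_const)
    then show ?thesis by simp
  qed
  define L where "L = (\<lambda>j. if j \<in> S then lim (\<lambda>n. pmf (x n) j) else 0)"
  have lim: "(\<lambda>n. pmf (x n) j) \<longlonglongrightarrow> L j" if "j \<in> S" for j
    using conv[OF that] that by (simp add: L_def convergent_LIMSEQ_iff)
  have L0: "L j \<ge> 0" for j
  proof (cases "j \<in> S")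
    case True
    show ?thesis using lim[OF True] by (rule LIMSEQ_le_const) auto
  qed (simp add: L_def)
  have "(\<lambda>n. \<Sum>j\<in>S. pmf (x n) j) \<longlonglongrightarrow> (\<Sum>j\<in>S. L j)" by (intro tendsto_sum lim)
  then have Lsum: "(\<Sum>j\<in>S. L j) = 1"
    using xin fin by (simp add: sum_pmf_eq_1 LIMSEQ_const_iff)
  define \<mu> where "\<mu> = embed_pmf L"
  have nn: "(\<integral>\<^sup>+j. ennreal (L j) \<partial>count_space UNIV) = 1"
  proof -
    have "(\<integral>\<^sup>+j. ennreal (L j) \<partial>count_space UNIV) = (\<Sum>j\<in>S. ennreal (L j))"
      using fin by (intro nn_integral_count_space') (auto simp: L_def)
    also have "\<dots> = 1" using L0 Lsum by (simp add: sum_ennreal)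
    finally show ?thesis .
  qed
  have pm: "pmf \<mu> j = L j" for j unfolding \<mu>_def using L0 nn by (rule pmf_embed_pmf)
  have min: "set_pmf \<mu> \<subseteq> S" by (auto simp: set_pmf_eq pm L_def split: if_splits)
  have "G \<mu> = \<mu>"
  proof (rule D0[OF G_in[OF min] min])
    have "pmf (G \<mu>) j = pmf \<mu> j" if "j \<in> S" for j
    proof -
      have "(\<lambda>n. pmf (x (Suc n)) j) \<longlonglongrightarrow> L j" using lim[OF that] by (rule LIMSEQ_Suc)
      moreover have "(\<lambda>n. pmf (x (Suc n)) j) \<longlonglongrightarrow> pmf (G \<mu>) j"
      proof -
        have "pmf (x (Suc n)) j = (\<Sum>s\<in>S. pmf (x n) s * pmf (K s) j)" for n
          using pmf_bind_finite[OF fin xin[of n], of K j] by (simp add: x_def G_def)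
        moreover have "(\<lambda>n. \<Sum>s\<in>S. pmf (x n) s * pmf (K s) j) \<longlonglongrightarrow> (\<Sum>s\<in>S. L s * pmf (K s) j)"
          by (intro tendsto_sum tendsto_mult lim tendsto_const)
        ultimately show ?thesis
          using pmf_bind_finite[OF fin min, of K j] by (simp add: G_def pm)
      qed
      ultimately show ?thesis by (simp add: pm LIMSEQ_unique)
    qed
    then show "D (G \<mu>) \<mu> \<le> 0" by (simp add: D_def)
  qed
  then show ?thesis using min uniq unfolding G_def by blast
qed

lemma markov_ex1_stationary:
  fixes K :: "'s \<Rightarrow> 's pmf"
  assumes fin: "finite S" and s0: "s0 \<in> S"
    and closed: "\<And>s. s \<in> S \<Longrightarrow> set_pmf (K s) \<subseteq> S"
    and hit: "\<And>s. s \<in> S \<Longrightarrow> s0 \<in> set_pmf (((\<lambda>\<mu>. bind_pmf \<mu> K) ^^ N) (return_pmf s))"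
  shows "\<exists>!\<mu>. set_pmf \<mu> \<subseteq> S \<and> bind_pmf \<mu> K = \<mu>"
proof -
  define F where "F = (\<lambda>\<mu>. bind_pmf \<mu> K)"
  have Fin: "set_pmf (F \<mu>) \<subseteq> S" if "set_pmf \<mu> \<subseteq> S" for \<mu>
    using that closed unfolding F_def by (auto simp: set_bind_pmf)
  have Fnin: "set_pmf ((F ^^ n) \<mu>) \<subseteq> S" if "set_pmf \<mu> \<subseteq> S" for \<mu> n
    by (induction n) (use that Fin in simp_all)
  have Fn: "(F ^^ n) \<mu> = bind_pmf \<mu> (\<lambda>s. (F ^^ n) (return_pmf s))" for n \<mu>
    by (induction n) (simp_all add: F_def bind_assoc_pmf bind_return_pmf')
  let ?K = "\<lambda>s. (F ^^ N) (return_pmf s)"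
  have "\<exists>!\<mu>. set_pmf \<mu> \<subseteq> S \<and> bind_pmf \<mu> ?K = \<mu>"
    by (rule doeblin_ex1[OF fin s0]) (use Fnin hit in \<open>auto simp: F_def\<close>)
  then have ex: "\<exists>!\<mu>. set_pmf \<mu> \<subseteq> S \<and> (F ^^ N) \<mu> = \<mu>" by (simp flip: Fn)
  then obtain \<mu> where m: "set_pmf \<mu> \<subseteq> S" "(F ^^ N) \<mu> = \<mu>" by blast
  have "(F ^^ N) (F \<mu>) = F \<mu>" using m by (metis funpow_swap1)
  then have "F \<mu> = \<mu>" using ex m Fin[OF m(1)] by blast
  moreover have "(F ^^ n) \<nu> = \<nu>" if "F \<nu> = \<nu>" for \<nu> n
    by (induction n) (simp_all add: that)
  ultimately show ?thesis using ex m(1) unfolding F_def by blast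
qed

lemma finite_edges_in:
  assumes "cubic_box (\<Lambda> :: (real ^ 'd::finite) set)"
  shows "finite (edges_in \<Lambda>)"
proof -
  obtain r where r: "\<Lambda> = cbox (\<chi> i. - r) (\<chi> i. r)"
    using assms by (auto simp: cubic_box_def)
  define A where "A = (real_of_int ` {- \<lceil>r\<rceil>..\<lceil>r\<rceil>})"
  have "\<Lambda> \<inter> lattice \<subseteq> (\<lambda>f. \<chi> i. f i) ` (UNIV \<rightarrow>\<^sub>E A)"
  proof
    fix x assume x: "x \<in> \<Lambda> \<inter> lattice"
    have "x $ i \<in> A" for i
    proof -
      have "x $ i \<in> \<int>" using x by (simp add: lattice_def)
      then obtain k where k: "x $ i = real_of_int k" by (auto elim: Ints_cases)
      have "- r \<le> x $ i" "x $ i \<le> r" using x r by (auto simp: mem_box_cart)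
      with k have "- \<lceil>r\<rceil> \<le> k" "k \<le> \<lceil>r\<rceil>" by linarith+
      with k show ?thesis by (auto simp: A_def)
    qed
    then have "(\<lambda>i. x $ i) \<in> UNIV \<rightarrow>\<^sub>E A" by auto
    then show "x \<in> (\<lambda>f. \<chi> i. f i) ` (UNIV \<rightarrow>\<^sub>E A)"
      by (intro image_eqI[where x = "\<lambda>i. x $ i"]) (auto simp: vec_eq_iff)
  qed
  moreover have "finite (UNIV \<rightarrow>\<^sub>E A :: ('d \<Rightarrow> real) set)" by (intro finite_PiE) (auto simp: A_def)
  ultimately have "finite (\<Lambda> \<inter> lattice)" by (meson finite_imageI finite_subset)
  moreover have "edges_in \<Lambda> \<subseteq> Pow (\<Lambda> \<inter> lattice)"
    using hull_subset by (fastforce simp: edges_in_def lattice_edges_def)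
  ultimately show ?thesis by (meson finite_Pow_iff finite_subset)
qed

lemma edges_in_nonempty:
  assumes "cubic_box (\<Lambda> :: (real ^ 'd::finite) set)"
  shows "edges_in \<Lambda> \<noteq> {}"
proof -
  obtain r where r: "r > 0" "\<Lambda> = cbox (\<chi> i. - r) (\<chi> i. r)" "{x :: real ^ 'd. \<forall>i. \<bar>x $ i\<bar> = r} \<subseteq> lattice"
    using assms by (auto simp: cubic_box_def)
  have "(\<chi> i. r) \<in> (lattice :: (real ^ 'd) set)" using r by auto
  then have "r \<in> \<int>" by (simp add: lattice_def)
  then obtain k where "r = real_of_int k" by (auto elim: Ints_cases)
  then have r1: "r \<ge> 1" using r(1) by simp
  fix v :: 'd
  have "{0, axis v 1} \<in> lattice_edges"
    unfolding lattice_edges_def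
  proof (intro CollectI exI conjI)
    show "{0, axis v (1::real)} = {0, axis v 1}" ..
    show "0 \<in> lattice" "axis v 1 \<in> lattice" by (auto simp: lattice_def axis_def)
    show "dist 0 (axis v (1::real)) = 1" by simp
  qed
  moreover have "segment {0, axis v (1::real)} \<subseteq> \<Lambda>"
    unfolding r(2) using r r1
    by (intro hull_minimal convex_box) (auto simp: mem_box_cart axis_def)
  ultimately show ?thesis by (auto simp: edges_in_def)
qed

lemma top_bottom_connected_mono:
  assumes "\<And>e. e \<in> edges_in \<Lambda> \<Longrightarrow> \<omega> e \<Longrightarrow> \<omega>' e" and "top_bottom_connected v \<Lambda> \<omega>"
  shows "top_bottom_connected v \<Lambda> \<omega>'"
proof -
  have "open_step \<Lambda> \<omega> \<subseteq> open_step \<Lambda> \<omega>'" using assms(1) by (auto simp: open_step_def)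
  then show ?thesis using assms(2) rtrancl_mono unfolding top_bottom_connected_def by blast
qed

lemma not_connected_closed:
  assumes "cubic_box \<Lambda>" and "\<And>e. e \<in> edges_in \<Lambda> \<Longrightarrow> \<not> \<omega> e"
  shows "\<not> top_bottom_connected v \<Lambda> \<omega>"
proof
  assume "top_bottom_connected v \<Lambda> \<omega>"
  moreover have "open_step \<Lambda> \<omega> = {}" using assms(2) by (auto simp: open_step_def)
  ultimately obtain x where x: "x \<in> top_face v \<Lambda>" "x \<in> bottom_face v \<Lambda>"
    by (auto simp: top_bottom_connected_def)
  obtain r where r: "r > 0" "\<Lambda> = cbox (\<chi> i. - r) (\<chi> i. r)"
    using assms(1) by (auto simp: cubic_box_def)
  have "(\<chi> i. r) \<in> \<Lambda>" "(\<chi> i. - r) \<in> \<Lambda>" using r by (auto simp: mem_box_cart)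
  then have "(\<chi> i. r) $ v \<le> x $ v" "x $ v \<le> (\<chi> i. - r) $ v"
    using x unfolding top_face_def bottom_face_def by blast+
  then show False using r(1) by simp
qed

theorem ex1_equilibrium:
  assumes box: "cubic_box \<Lambda>" and p: "0 < p" "p < 1"
  shows "\<exists>!\<mu>. is_equilibrium v \<Lambda> p \<mu>"
proof -
  define E where "E = edges_in \<Lambda>"
  define S where "S = coupled_states v \<Lambda>"
  define K where "K = coupling_step v \<Lambda> p"
  define F where "F = (\<lambda>\<mu>. bind_pmf \<mu> K)"
  define c where "c = (\<lambda>e\<in>E. False)"
  have E: "finite E" "E \<noteq> {}" using box by (simp_all add: E_def finite_edges_in edges_in_nonempty)
  have setK: "set_pmf (K (x, y)) =
      (\<Union>e\<in>E. \<Union>b. {(x(e := b), y(e := (b \<and> \<not> top_bottom_connected v \<Lambda> (y(e := True)))))})" for x y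
    using E p by (simp add: K_def coupling_step_def set_bind_pmf E_def[symmetric] set_pmf_of_set set_pmf_bernoulli)
  have "finite (configs \<Lambda>)" using E by (auto simp: configs_def E_def intro!: finite_PiE)
  then have finS: "finite S"
    by (rule_tac finite_subset[of _ "configs \<Lambda> \<times> configs \<Lambda>"]) (auto simp: S_def coupled_states_def)
  have cS: "(c, c) \<in> S"
    using not_connected_closed[OF box, of c v]
    by (auto simp: S_def coupled_states_def configs_def c_def E_def)
  have closed: "(x(e := b), y(e := (b \<and> \<not> top_bottom_connected v \<Lambda> (y(e := True))))) \<in> S"
    if s: "(x, y) \<in> S" and e: "e \<in> E" for x y e b
  proof -
    have "\<not> top_bottom_connected v \<Lambda> (y(e := (b \<and> \<not> top_bottom_connected v \<Lambda> (y(e := True)))))"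
    proof (cases "b \<and> \<not> top_bottom_connected v \<Lambda> (y(e := True))")
      case True
      then show ?thesis by simp
    next
      case False
      have "\<not> top_bottom_connected v \<Lambda> (y(e := False))"
      proof
        assume "top_bottom_connected v \<Lambda> (y(e := False))"
        then have "top_bottom_connected v \<Lambda> y"
          by (rule top_bottom_connected_mono[rotated]) (simp split: if_splits)
        then show False using s by (simp add: S_def coupled_states_def)
      qed
      moreover have "(b \<and> \<not> top_bottom_connected v \<Lambda> (y(e := True))) = False"
        using False by blast
      ultimately show ?thesis by (simp only: not_False_eq_True)
    qed
    then show ?thesis using s e
      by (auto simp: S_def coupled_states_def configs_def E_def PiE_iff extensional_def)
  qed
  have Fn: "(F ^^ n) \<mu> = bind_pmf \<mu> (\<lambda>s. (F ^^ n) (return_pmf s))" for n \<mu>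
    by (induction n) (simp_all add: F_def bind_assoc_pmf bind_return_pmf')
  have hit: "(c, c) \<in> set_pmf ((F ^^ card A) (return_pmf (x, y)))"
    if "finite A" "A \<subseteq> E" "(x, y) \<in> S" "\<And>e. e \<in> E - A \<Longrightarrow> \<not> x e \<and> \<not> y e" for A x y
    using that
  proof (induction A arbitrary: x y rule: finite_induct)
    case empty
    then have "x = c" "y = c"
      by (auto simp: fun_eq_iff c_def S_def coupled_states_def configs_def E_def PiE_iff extensional_def)
    then show ?case by simp
  next
    case (insert a A)
    define s where "s = (x(a := False), y(a := False))"
    have sK: "s \<in> set_pmf (K (x, y))"
      unfolding setK s_def using insert.prems(1) by (intro UN_I[of a] UN_I[of False]) auto
    have sS: "s \<in> S" using closed[OF insert.prems(2), of a False] insert.prems(1) by (simp add: s_def)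
    have "(c, c) \<in> set_pmf ((F ^^ card A) (return_pmf s))"
      unfolding s_def
    proof (rule insert.IH)
      show "A \<subseteq> E" using insert.prems by simp
      show "(x(a := False), y(a := False)) \<in> S" using sS by (simp add: s_def)
      show "\<not> (x(a := False)) e \<and> \<not> (y(a := False)) e" if "e \<in> E - A" for e
        using insert.prems(3)[of e] that by (cases "e = a") auto
    qed
    moreover have "(F ^^ card (insert a A)) (return_pmf (x, y)) = bind_pmf (K (x, y)) (\<lambda>s. (F ^^ card A) (return_pmf s))"
    proof -
      have "(F ^^ card (insert a A)) (return_pmf (x, y)) = (F ^^ card A) (F (return_pmf (x, y)))"
        using insert.hyps by (simp add: funpow_swap1)
      then show ?thesis by (subst (asm) Fn) (simp add: F_def bind_return_pmf)
    qed
    ultimately show ?case using sK by (auto simp: set_bind_pmf)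
  qed
  show ?thesis
    unfolding is_equilibrium_def S_def[symmetric] K_def[symmetric]
  proof (rule markov_ex1_stationary[OF finS cS])
    fix s assume "s \<in> S"
    then show "set_pmf (K s) \<subseteq> S" using closed by (cases s) (auto simp: setK)
    show "(c, c) \<in> set_pmf (((\<lambda>\<mu>. bind_pmf \<mu> K) ^^ card E) (return_pmf s))"
      using hit[OF E(1) order_refl, of "fst s" "snd s"] \<open>s \<in> S\<close> by (simp add: F_def)
  qed
qed

corollary is_equilibrium_equilibrium:
  assumes "cubic_box \<Lambda>" "0 < p" "p < 1"
  shows "is_equilibrium v \<Lambda> p (equilibrium v \<Lambda> p)"
  unfolding equilibrium_def using ex1_equilibrium[OF assms] by (rule theI')

end

theory Submission
  imports Defs
begin

text \<open>
  Three observations carry the proof. Write \<open>\<Lambda>\<close> for the box, \<open>N\<close> for its number of edges, and call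
  two edges adjacent when they are close.

  First, topology. If \<open>f\<close> is pivotal, then the component of \<open>f\<close> in the edge boundary of the cluster of
  the top face, for adjacency, reaches the boundary of \<open>\<Lambda>\<close>
  (\<open>cut_component_reaches_boundary\<close>): a component of a cut is a cut, by the Poincare lemma modulo 2, and
  this one separates an edge whose ends are connected to the top and to the bottom. So a long chain of
  closed edges starts from every pivotal edge far from the boundary.

  Second, closed nonpivotal edges are costly under the stationary law of \<open>Y\<close>, which is Bernoulli
  percolation conditioned on disconnection. Given \<open>k\<close> of them, at least half avoid the boundary of the
  top cluster or at least half avoid that of the bottom cluster, and this half can be opened at once
  without connecting the top to the bottom (\<open>half_of_nonpivotal_can_open\<close>). Hence the probability is at
  most \<open>(2 * sqrt q) ^ k\<close> with \<open>q = (1 - p) / p\<close>. A chain of \<open>k\<close> closed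
  nonpivotal edges with \<open>k\<close> a large multiple of \<open>c * ln \<bar>\<Lambda>\<bar>\<close> is therefore very unlikely
  when \<open>p\<close> is close to 1; in particular, so is an isolated pivotal edge.

  Third, pivotal edges move slowly. Suppose that a ball is free of pivotal edges and that \<open>N\<close> steps later
  they have come deep inside. Tracing back the first times at which edges became pivotal gives a chain of
  edges, from the new pivotal edge to the outside of the ball, each found
  closed at a time before which it had never been pivotal (\<open>cheap_path_outwards\<close>). Each of them was closed and nonpivotal at the start, or received a
  closing input, and both have a small probability, also jointly over many edges. So during \<open>N\<close>
  steps the pivotal edges advance by at most a multiple of \<open>c * ln \<bar>\<Lambda>\<bar>\<close>.

  An interface edge was pivotal when it was last updated. This happened within about
  \<open>c * N * ln \<bar>\<Lambda>\<bar>\<close> steps, since in such a time every edge is very likely to be updated. The dynamics of \<open>Y\<close> is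
  reversible, so going back in time from the present, where there is no pivotal edge near \<open>e\<close>, to the
  time at which \<open>e\<close> was pivotal is an invasion of a free ball to its centre
  (\<open>prob_pivotal_then_free\<close>). A multiple of \<open>c * ln \<bar>\<Lambda>\<bar>\<close> windows of \<open>N\<close> steps, each with an
  advance of order \<open>c * ln \<bar>\<Lambda>\<bar>\<close>, leads to the distance \<open>\<kappa> * c\<^sup>2 * (ln \<bar>\<Lambda>\<bar>)\<^sup>2\<close>.
\<close>

section \<open>Edges of a lattice box\<close>

abbreviation ax :: "'d::finite \<Rightarrow> real ^ 'd" where
  "ax i \<equiv> axis i 1"

lemma lattice_add_axis [simp]: "x + ax i \<in> lattice \<longleftrightarrow> x \<in> lattice"
proof -
  have "(x + ax i) $ j \<in> \<int> \<longleftrightarrow> x $ j \<in> \<int>" for j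
    using Ints_add[of "x $ j" 1] Ints_diff[of "x $ j + 1" 1] by (auto simp: axis_def)
  then show ?thesis by (simp add: lattice_def)
qed

lemma lattice_diff_scaled_axis [simp]:
  "x - real k *\<^sub>R ax i \<in> lattice \<longleftrightarrow> x \<in> lattice"
proof (induction k)
  case (Suc k)
  have "x - real k *\<^sub>R ax i = (x - real (Suc k) *\<^sub>R ax i) + ax i"
    by (simp add: algebra_simps)
  then show ?case using Suc lattice_add_axis by metis
qed simp

lemma lattice_dist_1:
  fixes x y :: "real ^ 'd::finite"
  assumes "x \<in> lattice" "y \<in> lattice" "dist x y = 1"
  obtains i where "y = x + ax i \<or> x = y + ax i"
proof -
  define z where "z = y - x"
  have zi: "z $ i \<in> \<int>" for i using assms by (simp add: z_def lattice_def)
  have "norm z = 1" using assms(3) by (simp add: z_def dist_norm norm_minus_commute)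
  then have "z \<bullet> z = 1" by (simp add: dot_square_norm)
  then have s: "(\<Sum>i\<in>UNIV. (z $ i)\<^sup>2) = 1" by (simp add: inner_vec_def power2_eq_square)
  then obtain i where i: "z $ i \<noteq> 0" by (metis (no_types, lifting) power_zero_numeral sum.neutral zero_neq_one)
  have "\<bar>z $ i\<bar> \<ge> 1" using i zi[of i] Ints_nonzero_abs_ge1 by blast
  then have g1: "(z $ i)\<^sup>2 \<ge> 1" using power_mono[of 1 "\<bar>z $ i\<bar>" 2] by simp
  have s2: "(z $ i)\<^sup>2 + (\<Sum>j\<in>UNIV - {i}. (z $ j)\<^sup>2) = 1"
    using s by (simp add: sum.remove[of UNIV i])
  then have "(\<Sum>j\<in>UNIV - {i}. (z $ j)\<^sup>2) = 0"
    using g1 sum_nonneg[of "UNIV - {i}" "\<lambda>j. (z $ j)\<^sup>2"] by simp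
  then have zero: "z $ j = 0" if "j \<noteq> i" for j
    using that by (subst (asm) sum_nonneg_eq_0_iff) auto
  have "(z $ i)\<^sup>2 = 1" using s2 zero by simp
  then have "z $ i = 1 \<or> z $ i = -1" by (simp add: power2_eq_1_iff)
  then have "z = ax i \<or> z = - ax i"
    using zero by (auto simp: vec_eq_iff axis_def)
  then have "y = x + ax i \<or> x = y + ax i"
    unfolding z_def by (auto simp: algebra_simps)
  then show ?thesis by (rule that)
qed

lemma cubic_boxE:
  assumes "cubic_box (\<Lambda> :: (real ^ 'd::finite) set)"
  obtains r where "r \<ge> 1" "\<And>x. x \<in> \<Lambda> \<longleftrightarrow> (\<forall>i. \<bar>x $ i\<bar> \<le> r)" "r \<in> \<int>"
proof -
  obtain r where r: "r > 0" "\<Lambda> = cbox (\<chi> i. - r) (\<chi> i. r)" "{x :: real ^ 'd. \<forall>i. \<bar>x $ i\<bar> = r} \<subseteq> lattice"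
    using assms by (auto simp: cubic_box_def)
  have "(\<chi> i. r) \<in> (lattice :: (real ^ 'd) set)" using r by auto
  then have ri: "r \<in> \<int>" by (simp add: lattice_def)
  then have "r \<ge> 1" using r(1) Ints_nonzero_abs_ge1[of r] by auto
  moreover have "x \<in> \<Lambda> \<longleftrightarrow> (\<forall>i. \<bar>x $ i\<bar> \<le> r)" for x
    unfolding r(2) by (auto simp: mem_box_cart abs_le_iff) (smt (verit))+
  ultimately show ?thesis using that ri by blast
qed

lemma edges_in_iff:
  fixes \<Lambda> :: "(real ^ 'd::finite) set"
  assumes "cubic_box \<Lambda>"
  shows "e \<in> edges_in \<Lambda> \<longleftrightarrow>
    (\<exists>x i. e = {x, x + ax i} \<and> x \<in> \<Lambda> \<inter> lattice \<and> x + ax i \<in> \<Lambda> \<inter> lattice)"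
proof
  assume e: "e \<in> edges_in \<Lambda>"
  then obtain x y where xy: "e = {x, y}" "x \<in> lattice" "y \<in> lattice" "dist x y = 1"
    by (auto simp: edges_in_def lattice_edges_def)
  have "e \<subseteq> \<Lambda>" using e hull_subset[of e convex] by (auto simp: edges_in_def)
  moreover obtain i where "y = x + ax i \<or> x = y + ax i"
    using lattice_dist_1[OF xy(2-4)] .
  ultimately show "\<exists>x i. e = {x, x + ax i} \<and> x \<in> \<Lambda> \<inter> lattice \<and> x + ax i \<in> \<Lambda> \<inter> lattice"
    using xy by (metis Int_iff insert_commute insert_subset)
next
  assume "\<exists>x i. e = {x, x + ax i} \<and> x \<in> \<Lambda> \<inter> lattice \<and> x + ax i \<in> \<Lambda> \<inter> lattice"
  then obtain x i where xi: "e = {x, x + ax i}" "x \<in> \<Lambda> \<inter> lattice" "x + ax i \<in> \<Lambda> \<inter> lattice"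
    by blast
  have "convex \<Lambda>" using assms by (auto simp: cubic_box_def)
  then have "segment e \<subseteq> \<Lambda>" using xi by (intro hull_minimal) auto
  moreover have "e \<in> lattice_edges" using xi by (force simp: lattice_edges_def dist_norm)
  ultimately show "e \<in> edges_in \<Lambda>" by (simp add: edges_in_def)
qed

lemma edges_in_props:
  assumes "cubic_box \<Lambda>" "e \<in> edges_in \<Lambda>"
  shows "e \<noteq> {}" "e \<subseteq> \<Lambda> \<inter> lattice" "\<And>x y. x \<in> e \<Longrightarrow> y \<in> e \<Longrightarrow> dist x y \<le> 1"
  using assms(2) by (auto simp: edges_in_iff[OF assms(1)] dist_norm)

section \<open>Components of a cut\<close>

text \<open>This is the Poincare lemma for 1-cochains with values in the two-element field, on the
  cubical complex of the box: \<open>\<phi> x i\<close> is the value on the edge from \<open>x\<close> in direction \<open>i\<close>,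
  \<open>\<noteq>\<close> is addition, and the hypothesis says that \<open>\<phi>\<close> sums to zero around every unit
  square. The potential \<open>g\<close> is built one direction at a time: once \<open>\<phi>\<close> is corrected by a
  potential that handles the directions in \<open>I\<close>, the remainder \<open>\<psi>\<close> vanishes on these directions,
  hence is invariant under translation along them, and summing it along the lines of a new direction
  \<open>i\<close> gives a function \<open>h\<close> that handles \<open>i\<close> and does not disturb \<open>I\<close>.\<close>

lemma closed_cochain_exact:
  fixes \<phi> :: "real ^ 'd::finite \<Rightarrow> 'd \<Rightarrow> bool"
  assumes box: "cubic_box \<Lambda>"
    and closed: "\<And>x i j. i \<noteq> j \<Longrightarrow> {x, x + ax i, x + ax j, x + ax i + ax j} \<subseteq> \<Lambda> \<inter> lattice \<Longrightarrow>
      (\<phi> x i \<noteq> \<phi> (x + ax j) i) = (\<phi> x j \<noteq> \<phi> (x + ax i) j)"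
  shows "\<exists>g :: real ^ 'd \<Rightarrow> bool. \<forall>x i. x \<in> \<Lambda> \<inter> lattice \<longrightarrow> x + ax i \<in> \<Lambda> \<inter> lattice \<longrightarrow> \<phi> x i = (g x \<noteq> g (x + ax i))"
proof -
  define V where "V = \<Lambda> \<inter> lattice"
  obtain r where r: "\<And>x. x \<in> \<Lambda> \<longleftrightarrow> (\<forall>i. \<bar>x $ i\<bar> \<le> r)" using cubic_boxE[OF box] by metis
  have "\<exists>g :: real ^ 'd \<Rightarrow> bool. \<forall>x. \<forall>i\<in>I. x \<in> V \<longrightarrow> x + ax i \<in> V \<longrightarrow> \<phi> x i = (g x \<noteq> g (x + ax i))" for I :: "'d set"
    using finite[of I]
  proof (induction I rule: finite_induct)
    case empty
    then show ?case by simp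
  next
    case (insert i I)
    from insert.IH obtain g :: "real ^ 'd \<Rightarrow> bool"
      where g0: "\<forall>x. \<forall>i\<in>I. x \<in> V \<longrightarrow> x + ax i \<in> V \<longrightarrow> \<phi> x i = (g x \<noteq> g (x + ax i))" ..
    note g = g0[rule_format]
    define \<psi> where "\<psi> x j = (\<phi> x j \<noteq> (g x \<noteq> g (x + ax j)))" for x j
    have \<psi>0: "\<not> \<psi> x j" if "j \<in> I" "x \<in> V" "x + ax j \<in> V" for x j
      using g[OF that(1,2,3)] by (simp add: \<psi>_def)
    have \<psi>c: "(\<psi> x k \<noteq> \<psi> (x + ax j) k) = (\<psi> x j \<noteq> \<psi> (x + ax k) j)"
      if "k \<noteq> j" "{x, x + ax k, x + ax j, x + ax k + ax j} \<subseteq> V" for x k j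
      using closed[OF that(1), of x] that(2) unfolding V_def[symmetric] \<psi>_def
      by (auto simp: add.assoc add.commute[of "ax k"])
    \<comment> \<open>\<open>A x\<close> collects the positions, on the line through \<open>x\<close> in direction \<open>i\<close>, of the edges
      below \<open>x\<close> on which \<open>\<psi>\<close> is nonzero; \<open>h x\<close> is their sum modulo 2.\<close>
    define A where "A x = {k::nat. x - real (Suc k) *\<^sub>R ax i \<in> V \<and> \<psi> (x - real (Suc k) *\<^sub>R ax i) i}" for x
    define h where "h x = odd (card (A x))" for x
    have fin: "finite (A x)" for x
    proof (rule finite_subset)
      show "A x \<subseteq> {..nat \<lceil>x $ i + r\<rceil>}"
      proof
        fix k assume "k \<in> A x"
        then have "\<bar>(x - real (Suc k) *\<^sub>R ax i) $ i\<bar> \<le> r" by (simp only: A_def V_def r mem_Collect_eq Int_iff)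
        then have "real k \<le> x $ i + r" by (simp add: axis_def)
        then show "k \<in> {..nat \<lceil>x $ i + r\<rceil>}" by (simp, linarith)
      qed
    qed simp
    have hi: "\<psi> x i = (h x \<noteq> h (x + ax i))" if x: "x \<in> V" for x
    proof -
      have eq: "x + ax i - real (Suc (Suc k)) *\<^sub>R ax i = x - real (Suc k) *\<^sub>R ax i" for k
        by (simp add: vec_eq_iff algebra_simps)
      have z: "x + ax i - real (Suc 0) *\<^sub>R ax i = x" by simp
      have "k \<in> A (x + ax i) \<longleftrightarrow> k \<in> (if \<psi> x i then {0} else {}) \<union> Suc ` A x" for k
      proof (cases k)
        case 0 then show ?thesis using x by (simp add: A_def)
      next
        case (Suc m) then show ?thesis unfolding A_def Suc mem_Collect_eq eq by (auto simp: image_iff)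
      qed
      then have "A (x + ax i) = (if \<psi> x i then {0} else {}) \<union> Suc ` A x" by blast
      moreover have "card (Suc ` A x) = card (A x)" by (simp add: card_image)
      ultimately have "card (A (x + ax i)) = (if \<psi> x i then Suc (card (A x)) else card (A x))"
        using fin[of x] by (auto simp: card_insert_if)
      then show ?thesis by (simp add: h_def)
    qed
    have hj: "h (x + ax j) = h x" if j: "j \<in> I" and x: "x \<in> V" "x + ax j \<in> V" for x j
    proof -
      have ji: "j \<noteq> i" using j insert.hyps by blast
      have sh: "x - real k *\<^sub>R ax i + ax j \<in> V \<longleftrightarrow> x - real k *\<^sub>R ax i \<in> V" for k
      proof -
        have c: "(x - real k *\<^sub>R ax i + ax j) $ l = (if l = i then x $ i - real k else (x + ax j) $ l)"
          "(x - real k *\<^sub>R ax i) $ l = (if l = i then x $ i - real k else x $ l)" for l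
          using ji by (auto simp: axis_def)
        have b: "\<forall>l. \<bar>x $ l\<bar> \<le> r" "\<forall>l. \<bar>(x + ax j) $ l\<bar> \<le> r"
          using x unfolding V_def Int_iff r by blast+
        have if_all: "(\<forall>l. \<bar>if l = i then s else u l\<bar> \<le> r) \<longleftrightarrow> \<bar>s\<bar> \<le> r" if "\<forall>l. \<bar>u l\<bar> \<le> r" for s u
          using that by auto
        have "x - real k *\<^sub>R ax i + ax j \<in> \<Lambda> \<longleftrightarrow> \<bar>x $ i - real k\<bar> \<le> r"
          unfolding r c(1) by (rule if_all[OF b(2)])
        moreover have "x - real k *\<^sub>R ax i \<in> \<Lambda> \<longleftrightarrow> \<bar>x $ i - real k\<bar> \<le> r"
          unfolding r c(2) by (rule if_all[OF b(1)])
        ultimately show ?thesis using x by (simp add: V_def)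
      qed
      have "A (x + ax j) = A x"
      proof -
        have "k \<in> A (x + ax j) \<longleftrightarrow> k \<in> A x" for k
        proof -
          let ?y = "x - real (Suc k) *\<^sub>R ax i"
          have yj: "x + ax j - real (Suc k) *\<^sub>R ax i = ?y + ax j" by simp
          have "\<psi> ?y i = \<psi> (?y + ax j) i" if y: "?y \<in> V"
          proof -
            have e: "?y + ax i = x - real k *\<^sub>R ax i" by (simp add: algebra_simps)
            have "?y + ax i \<in> V"
            proof -
              have "\<bar>(x - real k *\<^sub>R ax i) $ l\<bar> \<le> r" for l
              proof (cases "l = i")
                case True
                have "\<bar>?y $ i\<bar> \<le> r" "\<bar>x $ i\<bar> \<le> r" using y x unfolding V_def Int_iff r by blast+
                then show ?thesis using True by (simp add: axis_def)
              next
                case False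
                have "\<bar>x $ l\<bar> \<le> r" using x unfolding V_def Int_iff r by blast
                then show ?thesis using False by (simp add: axis_def)
              qed
              then show ?thesis unfolding e using x by (simp add: V_def r del: vector_minus_component)
            qed
            moreover have "?y + ax j \<in> V" using sh[of "Suc k"] y by simp
            moreover have "?y + ax i + ax j \<in> V" using sh[of k] calculation(1) unfolding e by simp
            moreover have "\<not> \<psi> ?y j" "\<not> \<psi> (?y + ax i) j"
              using \<psi>0[OF j y] \<psi>0[OF j] calculation by auto
            ultimately show ?thesis using \<psi>c[of i j ?y] y ji by auto
          qed
          then show ?thesis unfolding A_def mem_Collect_eq yj sh by blast
        qed
        then show ?thesis by blast
      qed
      then show ?thesis by (simp add: h_def)
    qed
    show ?case
    proof (intro exI allI ballI impI)
      fix x j assume "j \<in> insert i I" "x \<in> V" "x + ax j \<in> V"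
      then show "\<phi> x j = ((g x \<noteq> h x) \<noteq> (g (x + ax j) \<noteq> h (x + ax j)))"
        using hi[of x] hj[of j x] g[of j x] by (cases "j = i") (auto simp: \<psi>_def)
    qed
  qed
  from this[of UNIV] show ?thesis by (simp add: V_def)
qed

definition edge_boundary :: "(real ^ 'd::finite) set \<Rightarrow> (real ^ 'd) set \<Rightarrow> 'd edge set" where
  "edge_boundary \<Lambda> C = {e \<in> edges_in \<Lambda>. e \<inter> C \<noteq> {} \<and> \<not> e \<subseteq> C}"

text \<open>A lax form of the relation of lying on a common unit square. Only two properties matter: edges of
  one unit square are adjacent, and an edge has boundedly many neighbours.\<close>

definition adj :: "('d::finite) edge \<Rightarrow> 'd edge \<Rightarrow> bool" where
  "adj e f \<longleftrightarrow> (\<forall>x\<in>e. \<forall>y\<in>f. dist x y \<le> 2)"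

text \<open>All four vertices are within distance 1 of the centre of the square.\<close>

lemma dist_square_vertices:
  fixes x :: "real ^ 'd::finite"
  assumes "u \<in> {x, x + ax i, x + ax j, x + ax i + ax j}" "w \<in> {x, x + ax i, x + ax j, x + ax i + ax j}"
  shows "dist u w \<le> 2"
proof -
  define c where "c = x + (1/2) *\<^sub>R ax i + (1/2) *\<^sub>R ax j"
  have *: "dist u c \<le> 1" if "u \<in> {x, x + ax i, x + ax j, x + ax i + ax j}" for u
  proof -
    from that obtain s t :: real where "\<bar>s\<bar> = 1/2" "\<bar>t\<bar> = 1/2" "u - c = s *\<^sub>R ax i + t *\<^sub>R ax j"
    proof (elim insertE emptyE)
      assume "u = x" then show ?thesis
        by (intro that[of "-1/2" "-1/2"]) (auto simp: c_def vec_eq_iff field_simps)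
    next
      assume "u = x + ax i" then show ?thesis
        by (intro that[of "1/2" "-1/2"]) (auto simp: c_def vec_eq_iff field_simps)
    next
      assume "u = x + ax j" then show ?thesis
        by (intro that[of "-1/2" "1/2"]) (auto simp: c_def vec_eq_iff field_simps)
    next
      assume "u = x + ax i + ax j" then show ?thesis
        by (intro that[of "1/2" "1/2"]) (auto simp: c_def vec_eq_iff field_simps)
    qed
    then show ?thesis
      using norm_triangle_ineq[of "s *\<^sub>R ax i" "t *\<^sub>R (ax j :: real ^ 'd)"] by (simp add: dist_norm)
  qed
  show ?thesis using *[OF assms(1)] *[OF assms(2)] dist_triangle2[of u w c] by linarith
qed

text \<open>In dimension at least 2 the edges lying on the boundary of the box connect the top face to the
  bottom face: move inside the top face to the corner with all coordinates \<open>r\<close>, go down along a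
  line on which some other coordinate stays equal to \<open>r\<close>, then move inside the bottom face. If
  \<open>g\<close> changes only across edges of \<open>F\<close>, and \<open>F\<close> keeps away from the boundary, then
  \<open>g\<close> agrees on the two faces.\<close>

lemma constant_on_faces:
  fixes g :: "real ^ 'd::finite \<Rightarrow> bool" and v :: 'd
  assumes box: "cubic_box \<Lambda>" and d2: "CARD('d) \<ge> 2"
    and g: "\<And>x i. x \<in> \<Lambda> \<inter> lattice \<Longrightarrow> x + ax i \<in> \<Lambda> \<inter> lattice \<Longrightarrow> g x \<noteq> g (x + ax i) \<Longrightarrow> {x, x + ax i} \<in> F"
    and F: "\<And>f y w. f \<in> F \<Longrightarrow> y \<in> f \<Longrightarrow> w \<notin> \<Lambda> \<Longrightarrow> dist y w > 1"
    and a: "a \<in> top_face v \<Lambda> \<inter> lattice" and b: "b \<in> bottom_face v \<Lambda> \<inter> lattice"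
  shows "g a = g b"
proof -
  obtain r where r1: "r \<ge> 1" and r: "\<And>x. x \<in> \<Lambda> \<longleftrightarrow> (\<forall>i. \<bar>x $ i\<bar> \<le> r)" and rI: "r \<in> \<int>"
    using cubic_boxE[OF box] by metis
  define upd :: "real ^ 'd \<Rightarrow> 'd set \<Rightarrow> real ^ 'd" where "upd x J = (\<chi> l. if l \<in> J then r else x $ l)" for x J
  have upd_in: "upd x J \<in> \<Lambda> \<inter> lattice" if "x \<in> \<Lambda> \<inter> lattice" for x J
    using that r1 rI by (auto simp: r lattice_def upd_def)
  have step: "g (x + ax j) = g x"
    if x: "x \<in> \<Lambda> \<inter> lattice" "x + ax j \<in> \<Lambda> \<inter> lattice" and i: "\<bar>x $ i\<bar> = r" for x i j
  proof (rule ccontr)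
    assume "g (x + ax j) \<noteq> g x"
    then have f: "{x, x + ax j} \<in> F" using g[OF x] by auto
    \<comment> \<open>leave the box through the face \<open>x $ i = \<plusminus> r\<close> that contains the edge\<close>
    define w where "w = x + sgn (x $ i) *\<^sub>R ax i"
    have "\<bar>w $ i\<bar> = r + 1" using i r1 by (auto simp: w_def axis_def sgn_if)
    then have "w \<notin> \<Lambda>" unfolding r by (metis add.commute less_add_one not_le)
    moreover have "dist x w \<le> 1" by (simp add: w_def dist_norm abs_sgn_eq)
    ultimately show False using F[OF f, of x w] by simp
  qed
  have ray: "g (upd x {j}) = g x"
    if "x \<in> \<Lambda> \<inter> lattice" "x $ j = r - real n" "\<bar>x $ i\<bar> = r" "i \<noteq> j" for x i j n
    using that
  proof (induction n arbitrary: x)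
    case 0
    then have "upd x {j} = x" by (auto simp: upd_def vec_eq_iff)
    then show ?case by simp
  next
    case (Suc n)
    have *: "x + ax j \<in> \<Lambda> \<inter> lattice"
    proof -
      have "\<bar>(x + ax j) $ l\<bar> \<le> r" for l
      proof (cases "l = j")
        case True
        have "\<bar>x $ j\<bar> \<le> r" using Suc.prems(1) unfolding Int_iff r by blast
        then show ?thesis using True Suc.prems(2) by (simp add: axis_def)
      next
        case False
        have "\<bar>x $ l\<bar> \<le> r" using Suc.prems(1) unfolding Int_iff r by blast
        then show ?thesis using False by (simp add: axis_def)
      qed
      then show ?thesis using Suc.prems(1) by (simp add: r del: vector_add_component)
    qed
    have "g (upd (x + ax j) {j}) = g (x + ax j)"
      using Suc.prems(2-4) by (intro Suc.IH *) (auto simp: axis_def)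
    moreover have "upd (x + ax j) {j} = upd x {j}" by (auto simp: upd_def vec_eq_iff axis_def)
    ultimately show ?case using step[OF Suc.prems(1) * Suc.prems(3)] by simp
  qed
  have move: "g (upd x {j}) = g x" if x: "x \<in> \<Lambda> \<inter> lattice" "\<bar>x $ i\<bar> = r" "i \<noteq> j" for x i j
  proof -
    have "r - x $ j \<in> \<int>" using x rI by (auto simp: lattice_def)
    moreover have "\<bar>x $ j\<bar> \<le> r" using x(1) unfolding Int_iff r by blast
    ultimately obtain n where "r - x $ j = real n"
      using Nats_altdef2[where 'a = real] by (fastforce elim: Nats_cases)
    then show ?thesis by (intro ray[of _ _ n i] x) simp
  qed
  have moves: "g (upd x J) = g x" if x: "x \<in> \<Lambda> \<inter> lattice" "\<bar>x $ i\<bar> = r" "i \<notin> J" for x i J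
    using finite[of J] x(3)
  proof (induction J rule: finite_induct)
    case empty
    then show ?case by (simp add: upd_def)
  next
    case (insert j J)
    have "g (upd (upd x J) {j}) = g (upd x J)"
      using insert x by (intro move[of _ i] upd_in) (auto simp: upd_def)
    moreover have "upd (upd x J) {j} = upd x (insert j J)" by (auto simp: upd_def vec_eq_iff)
    ultimately show ?case using insert by simp
  qed
  have corner: "(\<chi> l. r) \<in> \<Lambda>" "(\<chi> l. - r) \<in> \<Lambda>" using r1 by (auto simp: r)
  have abs_le: "\<bar>x $ v\<bar> \<le> r" if "x \<in> \<Lambda>" for x using that r by blast
  have av: "a $ v = r" using a corner(1) abs_le[of a] by (force simp: top_face_def)
  have bv: "b $ v = - r" using b corner(2) abs_le[of b] by (force simp: bottom_face_def)
  obtain i where i: "i \<noteq> v"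
  proof -
    have "UNIV \<noteq> {v}" using d2 by (metis card.empty card.insert empty_iff finite.emptyI numeral_2_eq_2 Suc_n_not_le_n)
    then show ?thesis using that by blast
  qed
  have "g a = g (upd a (UNIV - {v}))" using a av r1 by (intro moves[symmetric, of _ v]) (auto simp: top_face_def)
  also have "upd a (UNIV - {v}) = (\<chi> l. r)" using av by (auto simp: upd_def vec_eq_iff)
  also have "(\<chi> l. r) = upd (upd b (UNIV - {v})) {v}" by (auto simp: upd_def vec_eq_iff)
  also have "g \<dots> = g (upd b (UNIV - {v}))"
    using b i r1 by (intro move[of _ i] upd_in) (auto simp: bottom_face_def upd_def)
  also have "\<dots> = g b" using b bv r1 by (intro moves[of _ v]) (auto simp: bottom_face_def)
  finally show ?thesis .
qed

text \<open>The topological input. The boundary of \<open>C\<close> meets every unit square in an even number of edges,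
  and so does each of its components for \<open>adj\<close>, because the edges of one square are mutually
  adjacent. By \<open>closed_cochain_exact\<close> the component \<open>F\<close> of \<open>{x, y}\<close> is therefore itself
  the set of edges across which some \<open>g\<close> changes. If \<open>F\<close> stayed away from the boundary of the
  box, \<open>g\<close> would be constant on the path from \<open>x\<close> to the top, from the top to the bottom along
  the faces, and from there to \<open>y\<close>; but it changes across \<open>{x, y}\<close>.\<close>

lemma cut_component_reaches_boundary:
  fixes \<Lambda> :: "(real ^ 'd::finite) set" and v :: 'd
  assumes box: "cubic_box \<Lambda>" and d2: "CARD('d) \<ge> 2"
    and e: "{x, y} \<in> edge_boundary \<Lambda> C"
    and P: "\<And>u w. (u, w) \<in> P \<Longrightarrow> {u, w} \<in> edges_in \<Lambda> - edge_boundary \<Lambda> C"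
    and a: "a \<in> top_face v \<Lambda> \<inter> lattice" "(a, x) \<in> P\<^sup>*"
    and b: "b \<in> bottom_face v \<Lambda> \<inter> lattice" "(y, b) \<in> P\<^sup>*"
  shows "\<exists>g. ({x, y}, g) \<in> {(f, g). f \<in> edge_boundary \<Lambda> C \<and> g \<in> edge_boundary \<Lambda> C \<and> adj f g}\<^sup>* \<and>
    (\<exists>u\<in>g. \<exists>w. w \<notin> \<Lambda> \<and> dist u w \<le> 1)"
proof (rule ccontr)
  assume neg: "\<not> ?thesis"
  define A where "A = {(f, g). f \<in> edge_boundary \<Lambda> C \<and> g \<in> edge_boundary \<Lambda> C \<and> adj f g}"
  define F where "F = {g. ({x, y}, g) \<in> A\<^sup>*}"
  have F_eb: "F \<subseteq> edge_boundary \<Lambda> C"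
    using e by (auto simp: F_def A_def elim: rtranclE)
  have F_step: "f \<in> F \<longleftrightarrow> f \<in> edge_boundary \<Lambda> C" if "h \<in> F" "adj h f" for f h
    using that F_eb by (auto simp: F_def A_def intro: rtrancl_into_rtrancl)
  have eb: "{u, w} \<in> edge_boundary \<Lambda> C \<longleftrightarrow> (u \<in> C) \<noteq> (w \<in> C)" if "{u, w} \<in> edges_in \<Lambda>" for u w
    using that by (auto simp: edge_boundary_def)
  have "\<exists>g :: real ^ 'd \<Rightarrow> bool. \<forall>x i. x \<in> \<Lambda> \<inter> lattice \<longrightarrow> x + ax i \<in> \<Lambda> \<inter> lattice \<longrightarrow>
      ({x, x + ax i} \<in> F) = (g x \<noteq> g (x + ax i))"
  proof (rule closed_cochain_exact[OF box])
    fix x i j assume sq: "{x, x + ax i, x + ax j, x + ax i + ax j} \<subseteq> \<Lambda> \<inter> lattice" and "i \<noteq> j"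
    let ?Q = "{{x, x + ax i}, {x + ax j, x + ax j + ax i}, {x, x + ax j}, {x + ax i, x + ax i + ax j}}"
    have c: "x + ax j + ax i = x + ax i + ax j" by (simp add: algebra_simps)
    have Qe: "q \<in> edges_in \<Lambda>" if "q \<in> ?Q" for q
    proof -
      have E: "{z, z + ax k} \<in> edges_in \<Lambda>" if "z \<in> \<Lambda> \<inter> lattice" "z + ax k \<in> \<Lambda> \<inter> lattice" for z k
        using that edges_in_iff[OF box] by blast
      show ?thesis
        using that sq E[of x i] E[of "x + ax j" i] E[of x j] E[of "x + ax i" j] unfolding c by blast
    qed
    have adjQ: "adj q q'" if "q \<in> ?Q" "q' \<in> ?Q" for q q'
      unfolding adj_def
    proof (intro ballI)
      fix u w assume "u \<in> q" "w \<in> q'"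
      then have "u \<in> {x, x + ax i, x + ax j, x + ax i + ax j}" "w \<in> {x, x + ax i, x + ax j, x + ax i + ax j}"
        using that c by auto
      then show "dist u w \<le> 2" by (rule dist_square_vertices)
    qed
    show "(({x, x + ax i} \<in> F) \<noteq> ({x + ax j, x + ax j + ax i} \<in> F)) =
      (({x, x + ax j} \<in> F) \<noteq> ({x + ax i, x + ax i + ax j} \<in> F))"
    proof (cases "\<exists>h\<in>?Q. h \<in> F")
      case True
      then obtain h where h: "h \<in> ?Q" "h \<in> F" by blast
      have Feq: "q \<in> F \<longleftrightarrow> q \<in> edge_boundary \<Lambda> C" if "q \<in> ?Q" for q
        using F_step[OF h(2) adjQ[OF h(1) that]] .
      have "{x, x + ax i} \<in> F \<longleftrightarrow> (x \<in> C) \<noteq> (x + ax i \<in> C)"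
        "{x + ax j, x + ax j + ax i} \<in> F \<longleftrightarrow> (x + ax j \<in> C) \<noteq> (x + ax i + ax j \<in> C)"
        "{x, x + ax j} \<in> F \<longleftrightarrow> (x \<in> C) \<noteq> (x + ax j \<in> C)"
        "{x + ax i, x + ax i + ax j} \<in> F \<longleftrightarrow> (x + ax i \<in> C) \<noteq> (x + ax i + ax j \<in> C)"
        using Feq eb[OF Qe] unfolding c by simp_all
      then show ?thesis by argo
    next
      case False
      then show ?thesis by simp
    qed
  qed
  then obtain g :: "real ^ 'd \<Rightarrow> bool" where g: "\<And>x i. x \<in> \<Lambda> \<inter> lattice \<Longrightarrow> x + ax i \<in> \<Lambda> \<inter> lattice \<Longrightarrow>
      ({x, x + ax i} \<in> F) = (g x \<noteq> g (x + ax i))" by metis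
  have gE: "{u, w} \<in> F \<longleftrightarrow> g u \<noteq> g w" if "{u, w} \<in> edges_in \<Lambda>" for u w
  proof -
    from that[unfolded edges_in_iff[OF box]]
    obtain z i where z: "{u, w} = {z, z + ax i}" "z \<in> \<Lambda> \<inter> lattice" "z + ax i \<in> \<Lambda> \<inter> lattice"
      by blast
    have "u = z \<and> w = z + ax i \<or> u = z + ax i \<and> w = z" using z(1) by (simp only: doubleton_eq_iff)
    then show ?thesis using g[OF z(2,3)] unfolding z(1) by (elim disjE conjE) (simp_all, blast)
  qed
  have gP: "g u = g w" if "(u, w) \<in> P\<^sup>*" for u w
    using that
  proof (induction rule: rtrancl_induct)
    case (step y z)
    have "{y, z} \<in> edges_in \<Lambda>" "{y, z} \<notin> F" using P[OF step(2)] F_eb by auto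
    then show ?case using gE[of y z] step(3) by simp
  qed simp
  have "{x, y} \<in> F" by (simp add: F_def)
  moreover have "{x, y} \<in> edges_in \<Lambda>" using e by (simp add: edge_boundary_def)
  ultimately have "g x \<noteq> g y" using gE[of x y] by simp
  moreover have "g a = g b"
  proof (rule constant_on_faces[OF box d2 _ _ a(1) b(1)])
    show "{x, x + ax i} \<in> F"
      if "x \<in> \<Lambda> \<inter> lattice" "x + ax i \<in> \<Lambda> \<inter> lattice" "g x \<noteq> g (x + ax i)" for x i
      using g[OF that(1,2)] that(3) by simp
    show "1 < dist y w" if "f \<in> F" "y \<in> f" "w \<notin> \<Lambda>" for f y w
    proof (rule ccontr)
      assume "\<not> 1 < dist y w"
      then have "\<exists>u\<in>f. \<exists>w. w \<notin> \<Lambda> \<and> dist u w \<le> 1" using that(2,3) by (meson not_le)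
      then show False using neg that(1) unfolding A_def[symmetric] F_def by blast
    qed
  qed
  ultimately show False using gP[OF a(2)] gP[OF b(2)] by simp
qed

section \<open>Chains of adjacent edges\<close>

lemma rtrancl_distinct_path:
  assumes "(a, b) \<in> R\<^sup>*"
  shows "\<exists>xs. distinct (a # xs) \<and> last (a # xs) = b \<and> successively (\<lambda>x y. (x, y) \<in> R) (a # xs)"
  using assms
proof (induction rule: rtrancl_induct)
  case base
  show ?case by (intro exI[of _ "[]"]) simp
next
  case (step y z)
  then obtain xs where xs: "distinct (a # xs)" "last (a # xs) = y" "successively (\<lambda>x y. (x, y) \<in> R) (a # xs)"
    by blast
  show ?case
  proof (cases "z \<in> set (a # xs)")
    case False
    have "successively (\<lambda>x y. (x, y) \<in> R) ((a # xs) @ [z])"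
      using xs step(2) unfolding successively_append_iff by simp
    then show ?thesis using False xs by (intro exI[of _ "xs @ [z]"]) auto
  next
    case True
    then obtain us vs where us: "a # xs = us @ z # vs" by (meson split_list)
    then have eq: "a # xs = (us @ [z]) @ vs" by simp
    have s: "successively (\<lambda>x y. (x, y) \<in> R) (us @ [z])" and d: "distinct (us @ [z])"
      using xs(1,3) unfolding eq successively_append_iff distinct_append by blast+
    show ?thesis
    proof (cases us)
      case Nil
      then show ?thesis using us by (intro exI[of _ "[]"]) auto
    next
      case (Cons u us')
      then have "us @ [z] = a # us' @ [z]" using us by auto
      then show ?thesis using s d by (intro exI[of _ "us' @ [z]"]) auto
    qed
  qed
qed

lemma adj_chain_dist:
  assumes "successively adj (a # fs)" "x \<in> a" "f \<in> set fs" "y \<in> f" "{} \<notin> set fs"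
  shows "dist x y \<le> 2 * real (length fs)"
  using assms
proof (induction fs arbitrary: a x)
  case (Cons b fs)
  obtain z where z: "z \<in> b" using Cons.prems(5) by fastforce
  have ab: "adj a b" using Cons.prems(1) by simp
  show ?case
  proof (cases "f = b")
    case True
    then have "dist x y \<le> 2" using ab Cons.prems by (auto simp: adj_def)
    then show ?thesis by simp
  next
    case False
    have "dist z y \<le> 2 * real (length fs)"
      using Cons.prems False by (intro Cons.IH[of b z] z) auto
    moreover have "dist x z \<le> 2" using ab z Cons.prems(2) by (auto simp: adj_def)
    ultimately show ?thesis using dist_triangle[of x y z] by simp
  qed
qed simp

text \<open>A path of adjacent edges that ends far away contains a chain of \<open>k\<close> distinct edges, because
  each step covers a distance of at most 2.\<close>

lemma long_chain:
  assumes ab: "(a, b) \<in> R\<^sup>*" and R: "\<And>x y. (x, y) \<in> R \<Longrightarrow> adj x y \<and> y \<noteq> {} \<and> Q y"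
    and x: "x \<in> a" and y: "y \<in> b" and far: "dist x y > 2 * real k" "dist x y > 1"
    and a1: "\<And>y. y \<in> a \<Longrightarrow> dist x y \<le> 1"
  shows "\<exists>fs. length fs = k \<and> distinct (a # fs) \<and> successively adj (a # fs) \<and> (\<forall>f\<in>set fs. Q f \<and> f \<noteq> {})"
proof -
  obtain xs where xs: "distinct (a # xs)" "last (a # xs) = b" "successively (\<lambda>x y. (x, y) \<in> R) (a # xs)"
    using rtrancl_distinct_path[OF ab] by blast
  have adj: "successively adj (a # xs)"
    using xs(3) by (rule successively_mono) (use R in auto)
  have Q: "\<forall>f\<in>set xs. Q f \<and> f \<noteq> {}"
    using xs(3)
  proof (induction xs arbitrary: a)
    case (Cons b xs)
    then show ?case using R[of a b] by auto
  qed simp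
  have "xs \<noteq> []" using xs(2) y far(2) a1 by fastforce
  then have "b \<in> set xs" using xs(2) by (metis last_ConsR last_in_set)
  then have "dist x y \<le> 2 * real (length xs)"
    using adj_chain_dist[OF adj x _ y] Q by blast
  then have k: "k \<le> length xs" using far by linarith
  have t: "a # take k xs = take (Suc k) (a # xs)" by simp
  have "distinct (a # take k xs)" unfolding t using xs(1) by (rule distinct_take)
  moreover have "successively adj (a # take k xs)"
  proof -
    have "successively adj (take (Suc k) (a # xs) @ drop (Suc k) (a # xs))" using adj by simp
    then show ?thesis unfolding t successively_append_iff by blast
  qed
  moreover have "length (take k xs) = k" using k by simp
  moreover have "\<forall>f\<in>set (take k xs). Q f \<and> f \<noteq> {}" using Q in_set_takeD by fast
  ultimately show ?thesis by blast
qed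

section \<open>Clusters, cuts and pivotal edges\<close>

definition reach :: "(real ^ 'd::finite) set \<Rightarrow> 'd config \<Rightarrow> (real ^ 'd) set \<Rightarrow> (real ^ 'd) set" where
  "reach \<Lambda> Y S = (open_step \<Lambda> Y)\<^sup>* `` S"

abbreviation top_vertices :: "'d::finite \<Rightarrow> (real ^ 'd) set \<Rightarrow> (real ^ 'd) set" where
  "top_vertices v \<Lambda> \<equiv> top_face v \<Lambda> \<inter> lattice"

abbreviation bottom_vertices :: "'d::finite \<Rightarrow> (real ^ 'd) set \<Rightarrow> (real ^ 'd) set" where
  "bottom_vertices v \<Lambda> \<equiv> bottom_face v \<Lambda> \<inter> lattice"

lemma reach_sym: "(x, y) \<in> (open_step \<Lambda> Y)\<^sup>* \<longleftrightarrow> (y, x) \<in> (open_step \<Lambda> Y)\<^sup>*"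
proof -
  have "sym (open_step \<Lambda> Y)" by (auto simp: sym_def open_step_def insert_commute)
  then show ?thesis using sym_rtrancl symD by metis
qed

lemma connected_iff_reach_top:
  "top_bottom_connected v \<Lambda> Y \<longleftrightarrow> reach \<Lambda> Y (top_vertices v \<Lambda>) \<inter> bottom_vertices v \<Lambda> \<noteq> {}"
  by (auto simp: top_bottom_connected_def reach_def)

lemma connected_iff_reach_bottom:
  "top_bottom_connected v \<Lambda> Y \<longleftrightarrow> reach \<Lambda> Y (bottom_vertices v \<Lambda>) \<inter> top_vertices v \<Lambda> \<noteq> {}"
  unfolding top_bottom_connected_def reach_def using reach_sym by fast

lemma reach_disjoint:
  assumes "\<not> top_bottom_connected v \<Lambda> Y"
  shows "reach \<Lambda> Y (top_vertices v \<Lambda>) \<inter> reach \<Lambda> Y (bottom_vertices v \<Lambda>) = {}"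
proof (rule ccontr)
  assume "\<not> ?thesis"
  then obtain x t b where "t \<in> top_vertices v \<Lambda>" "(t, x) \<in> (open_step \<Lambda> Y)\<^sup>*"
    "b \<in> bottom_vertices v \<Lambda>" "(b, x) \<in> (open_step \<Lambda> Y)\<^sup>*"
    unfolding reach_def by blast
  then show False using assms reach_sym rtrancl_trans unfolding top_bottom_connected_def by metis
qed

lemma edge_boundary_reach_closed:
  assumes "e \<in> edge_boundary \<Lambda> (reach \<Lambda> Y S)"
  shows "\<not> Y e"
proof
  assume "Y e"
  have "e \<in> edges_in \<Lambda>" using assms by (simp add: edge_boundary_def)
  obtain x y where xy: "e = {x, y}" using \<open>e \<in> edges_in \<Lambda>\<close> by (auto simp: edges_in_def lattice_edges_def)
  have "(x, y) \<in> open_step \<Lambda> Y" "(y, x) \<in> open_step \<Lambda> Y"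
    using \<open>Y e\<close> \<open>e \<in> edges_in \<Lambda>\<close> by (auto simp: open_step_def xy insert_commute)
  then have "x \<in> reach \<Lambda> Y S \<longleftrightarrow> y \<in> reach \<Lambda> Y S"
    unfolding reach_def by (meson Image_iff rtrancl.rtrancl_into_rtrancl)
  then show False using assms by (auto simp: edge_boundary_def xy)
qed

text \<open>A path that leaves the old cluster has to cross its boundary, all of whose edges are still closed.\<close>

lemma reach_open_off_boundary:
  assumes "\<And>e. e \<in> edges_in \<Lambda> \<Longrightarrow> Y' e \<Longrightarrow> Y e \<or> e \<notin> edge_boundary \<Lambda> (reach \<Lambda> Y S)"
  shows "reach \<Lambda> Y' S \<subseteq> reach \<Lambda> Y S"
proof
  fix x assume "x \<in> reach \<Lambda> Y' S"
  then obtain s where s: "s \<in> S" "(s, x) \<in> (open_step \<Lambda> Y')\<^sup>*" by (auto simp: reach_def)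
  from s(2) show "x \<in> reach \<Lambda> Y S"
  proof (induction rule: rtrancl_induct)
    case base
    then show ?case using s(1) by (auto simp: reach_def)
  next
    case (step y z)
    have yz: "{y, z} \<in> edges_in \<Lambda>" "Y' {y, z}" using step(2) by (auto simp: open_step_def)
    from assms[OF yz] have "{y, z} \<notin> edge_boundary \<Lambda> (reach \<Lambda> Y S)"
      using edge_boundary_reach_closed by blast
    then show ?case using step(3) yz(1) by (auto simp: edge_boundary_def)
  qed
qed

lemma disconnected_open_off_top_cut:
  assumes "\<not> top_bottom_connected v \<Lambda> Y"
    and "\<And>e. e \<in> edges_in \<Lambda> \<Longrightarrow> Y' e \<Longrightarrow> Y e \<or> e \<notin> edge_boundary \<Lambda> (reach \<Lambda> Y (top_vertices v \<Lambda>))"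
  shows "\<not> top_bottom_connected v \<Lambda> Y'"
  using assms(1) reach_open_off_boundary[of \<Lambda> Y' Y, OF assms(2)] unfolding connected_iff_reach_top by blast

lemma disconnected_open_off_bottom_cut:
  assumes "\<not> top_bottom_connected v \<Lambda> Y"
    and "\<And>e. e \<in> edges_in \<Lambda> \<Longrightarrow> Y' e \<Longrightarrow> Y e \<or> e \<notin> edge_boundary \<Lambda> (reach \<Lambda> Y (bottom_vertices v \<Lambda>))"
  shows "\<not> top_bottom_connected v \<Lambda> Y'"
  using assms(1) reach_open_off_boundary[of \<Lambda> Y' Y, OF assms(2)] unfolding connected_iff_reach_bottom by blast

text \<open>Opening an edge off either cut leaves that cut closed. Conversely, as the two clusters are disjoint,
  an edge in both cuts joins the cluster of the top to the cluster of the bottom.\<close>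

lemma pivotal_iff_both_cuts:
  assumes dis: "\<not> top_bottom_connected v \<Lambda> Y"
  shows "e \<in> pivotal v \<Lambda> Y \<longleftrightarrow>
    e \<in> edge_boundary \<Lambda> (reach \<Lambda> Y (top_vertices v \<Lambda>)) \<inter> edge_boundary \<Lambda> (reach \<Lambda> Y (bottom_vertices v \<Lambda>))"
    (is "_ \<longleftrightarrow> e \<in> ?T \<inter> ?B")
proof
  assume e: "e \<in> pivotal v \<Lambda> Y"
  have "e \<in> ?T"
    using e disconnected_open_off_top_cut[OF dis, of "Y(e := True)"] by (fastforce simp: pivotal_def split: if_splits)
  moreover have "e \<in> ?B"
    using e disconnected_open_off_bottom_cut[OF dis, of "Y(e := True)"] by (fastforce simp: pivotal_def split: if_splits)
  ultimately show "e \<in> ?T \<inter> ?B" by blast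
next
  assume e: "e \<in> ?T \<inter> ?B"
  then have eE: "e \<in> edges_in \<Lambda>" by (simp add: edge_boundary_def)
  then obtain x y where "e = {x, y}" by (auto simp: edges_in_def lattice_edges_def)
  then obtain x y where xy: "e = {x, y}" "x \<in> reach \<Lambda> Y (top_vertices v \<Lambda>)" "y \<in> reach \<Lambda> Y (bottom_vertices v \<Lambda>)"
    using e reach_disjoint[OF dis] by (force simp: edge_boundary_def insert_commute)
  have mono: "(open_step \<Lambda> Y)\<^sup>* \<subseteq> (open_step \<Lambda> (Y(e := True)))\<^sup>*"
    by (rule rtrancl_mono) (auto simp: open_step_def)
  obtain t b where t: "t \<in> top_vertices v \<Lambda>" "(t, x) \<in> (open_step \<Lambda> Y)\<^sup>*"
    and b: "b \<in> bottom_vertices v \<Lambda>" "(y, b) \<in> (open_step \<Lambda> Y)\<^sup>*"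
    using xy(2,3) reach_sym unfolding reach_def by blast
  have "(x, y) \<in> open_step \<Lambda> (Y(e := True))" using eE xy(1) by (simp add: open_step_def)
  then have "(t, b) \<in> (open_step \<Lambda> (Y(e := True)))\<^sup>*"
    using t(2) b(2) mono by (meson rtrancl.rtrancl_into_rtrancl rtrancl_trans subsetD)
  then show "e \<in> pivotal v \<Lambda> Y"
    using t(1) b(1) eE by (auto simp: pivotal_def top_bottom_connected_def)
qed

lemma pivotal_closed: "\<not> top_bottom_connected v \<Lambda> Y \<Longrightarrow> e \<in> pivotal v \<Lambda> Y \<Longrightarrow> \<not> Y e"
  using pivotal_iff_both_cuts edge_boundary_reach_closed by blast

definition closed_adj :: "(real ^ 'd::finite) set \<Rightarrow> 'd config \<Rightarrow> ('d edge \<times> 'd edge) set" where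
  "closed_adj \<Lambda> Y = {(f, g). f \<in> edges_in \<Lambda> \<and> \<not> Y f \<and> g \<in> edges_in \<Lambda> \<and> \<not> Y g \<and> adj f g}"

text \<open>The boundary of the cluster of the top face consists of closed edges, contains every pivotal
  edge, and separates the two ends of a pivotal edge, one of which is connected to the top and the other
  to the bottom. So the component of the edge in this boundary extends to the boundary of the box.\<close>

lemma pivotal_chain_to_boundary:
  fixes \<Lambda> :: "(real ^ 'd::finite) set" and v :: 'd
  assumes box: "cubic_box \<Lambda>" and d2: "CARD('d) \<ge> 2"
    and dis: "\<not> top_bottom_connected v \<Lambda> Y" and e: "e \<in> pivotal v \<Lambda> Y"
  shows "\<exists>g. (e, g) \<in> (closed_adj \<Lambda> Y)\<^sup>* \<and> (\<exists>u\<in>g. \<exists>w. w \<notin> \<Lambda> \<and> dist u w \<le> 1)"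
proof -
  let ?C = "reach \<Lambda> Y (top_vertices v \<Lambda>)"
  have eC: "e \<in> edge_boundary \<Lambda> ?C" "e \<in> edge_boundary \<Lambda> (reach \<Lambda> Y (bottom_vertices v \<Lambda>))"
    using e pivotal_iff_both_cuts[OF dis] by blast+
  then have "e \<in> edges_in \<Lambda>" by (simp add: edge_boundary_def)
  then obtain x y where "e = {x, y}" by (auto simp: edges_in_def lattice_edges_def)
  then obtain x y where xy: "e = {x, y}" "x \<in> ?C" "y \<in> reach \<Lambda> Y (bottom_vertices v \<Lambda>)"
    using eC reach_disjoint[OF dis] by (force simp: edge_boundary_def insert_commute)
  obtain t b where t: "t \<in> top_vertices v \<Lambda>" "(t, x) \<in> (open_step \<Lambda> Y)\<^sup>*"
    and b: "b \<in> bottom_vertices v \<Lambda>" "(y, b) \<in> (open_step \<Lambda> Y)\<^sup>*"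
    using xy(2,3) reach_sym unfolding reach_def by blast
  have "\<exists>g. ({x, y}, g) \<in> {(f, g). f \<in> edge_boundary \<Lambda> ?C \<and> g \<in> edge_boundary \<Lambda> ?C \<and> adj f g}\<^sup>* \<and>
    (\<exists>u\<in>g. \<exists>w. w \<notin> \<Lambda> \<and> dist u w \<le> 1)"
  proof (rule cut_component_reaches_boundary[OF box d2 _ _ t b])
    show "{x, y} \<in> edge_boundary \<Lambda> ?C" using eC xy by simp
    show "{u, w} \<in> edges_in \<Lambda> - edge_boundary \<Lambda> ?C" if "(u, w) \<in> open_step \<Lambda> Y" for u w
      using that edge_boundary_reach_closed by (auto simp: open_step_def)
  qed
  moreover have "{(f, g). f \<in> edge_boundary \<Lambda> ?C \<and> g \<in> edge_boundary \<Lambda> ?C \<and> adj f g}\<^sup>* \<subseteq> (closed_adj \<Lambda> Y)\<^sup>*"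
  proof (rule rtrancl_mono)
    have "f \<in> edges_in \<Lambda> \<and> \<not> Y f" if "f \<in> edge_boundary \<Lambda> ?C" for f
      using that edge_boundary_reach_closed[OF that] by (simp add: edge_boundary_def)
    then show "{(f, g). f \<in> edge_boundary \<Lambda> ?C \<and> g \<in> edge_boundary \<Lambda> ?C \<and> adj f g} \<subseteq> closed_adj \<Lambda> Y"
      unfolding closed_adj_def by blast
  qed
  ultimately show ?thesis unfolding xy(1) by blast
qed

definition open_all :: "'d edge set \<Rightarrow> 'd config \<Rightarrow> ('d::finite) config" where
  "open_all G Y = (\<lambda>e. e \<in> G \<or> Y e)"

text \<open>The disconnection is already ensured by the boundary of the top cluster alone, and also by that
  of the bottom cluster alone. A nonpivotal edge avoids one of the two, so one of the two cuts is
  avoided by at least half of \<open>G\<close>, and this half can be opened all at once. This is what makes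
  closed nonpivotal edges costly under the conditioned law.\<close>

lemma half_of_nonpivotal_can_open:
  assumes dis: "\<not> top_bottom_connected v \<Lambda> Y" and fin: "finite G"
    and np: "\<And>g. g \<in> G \<Longrightarrow> g \<notin> pivotal v \<Lambda> Y"
  shows "\<exists>H\<subseteq>G. card G \<le> 2 * card H \<and> \<not> top_bottom_connected v \<Lambda> (open_all H Y)"
proof -
  \<comment> \<open>the edges of \<open>G\<close> that can be opened thanks to the top cut, or to the bottom cut\<close>
  define H1 where "H1 = G - edge_boundary \<Lambda> (reach \<Lambda> Y (top_vertices v \<Lambda>))"
  define H2 where "H2 = G - edge_boundary \<Lambda> (reach \<Lambda> Y (bottom_vertices v \<Lambda>))"
  have "G = H1 \<union> H2" using np pivotal_iff_both_cuts[OF dis] by (auto simp: H1_def H2_def)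
  then have "card G \<le> card H1 + card H2" by (metis card_Un_le)
  moreover have "\<not> top_bottom_connected v \<Lambda> (open_all H1 Y)"
    by (rule disconnected_open_off_top_cut[OF dis]) (auto simp: open_all_def H1_def)
  moreover have "\<not> top_bottom_connected v \<Lambda> (open_all H2 Y)"
    by (rule disconnected_open_off_bottom_cut[OF dis]) (auto simp: open_all_def H2_def)
  moreover have "card G \<le> 2 * card H1 \<or> card G \<le> 2 * card H2" using calculation(1) by linarith
  ultimately show ?thesis by (metis Diff_subset H1_def H2_def)
qed

section \<open>Histories of the constrained dynamics\<close>

definition update :: "'d::finite \<Rightarrow> (real ^ 'd) set \<Rightarrow> 'd config \<Rightarrow> 'd edge \<times> bool \<Rightarrow> 'd config" where
  "update v \<Lambda> Y = (\<lambda>(e, b). Y(e := (b \<and> \<not> top_bottom_connected v \<Lambda> (Y(e := True)))))"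

abbreviation run :: "'d::finite \<Rightarrow> (real ^ 'd) set \<Rightarrow> 'd config \<Rightarrow> ('d edge \<times> bool) list \<Rightarrow> 'd config" where
  "run v \<Lambda> \<equiv> foldl (update v \<Lambda>)"

definition disconnected_configs :: "'d::finite \<Rightarrow> (real ^ 'd) set \<Rightarrow> 'd config set" where
  "disconnected_configs v \<Lambda> = {Y \<in> configs \<Lambda>. \<not> top_bottom_connected v \<Lambda> Y}"

lemma update_disconnected:
  assumes "Y \<in> disconnected_configs v \<Lambda>" "fst x \<in> edges_in \<Lambda>"
  shows "update v \<Lambda> Y x \<in> disconnected_configs v \<Lambda>"
proof -
  obtain e b where x: "x = (e, b)" by (cases x)
  have "\<not> top_bottom_connected v \<Lambda> (update v \<Lambda> Y x)"
  proof (cases "b \<and> \<not> top_bottom_connected v \<Lambda> (Y(e := True))")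
    case True
    then show ?thesis by (simp add: update_def x)
  next
    case False
    then have "update v \<Lambda> Y x = Y(e := False)" by (auto simp: update_def x)
    moreover have "\<not> top_bottom_connected v \<Lambda> (Y(e := False))"
    proof
      assume "top_bottom_connected v \<Lambda> (Y(e := False))"
      then have "top_bottom_connected v \<Lambda> Y"
        by (rule top_bottom_connected_mono[rotated]) (simp split: if_splits)
      then show False using assms(1) by (simp add: disconnected_configs_def)
    qed
    ultimately show ?thesis by simp
  qed
  moreover have "update v \<Lambda> Y x \<in> configs \<Lambda>"
    using assms by (auto simp: disconnected_configs_def configs_def update_def x PiE_iff extensional_def)
  ultimately show ?thesis by (simp add: disconnected_configs_def)
qed

lemma run_disconnected:
  assumes "Y \<in> disconnected_configs v \<Lambda>" "fst ` set xs \<subseteq> edges_in \<Lambda>"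
  shows "run v \<Lambda> Y xs \<in> disconnected_configs v \<Lambda>"
  using assms by (induction xs arbitrary: Y) (auto intro!: update_disconnected)

lemma pivotal_update_same:
  "e \<in> pivotal v \<Lambda> (update v \<Lambda> Y (e, b)) \<longleftrightarrow> e \<in> pivotal v \<Lambda> Y"
  by (simp add: pivotal_def update_def)

lemma run_other: "e \<notin> fst ` set xs \<Longrightarrow> run v \<Lambda> Y xs e = Y e"
  by (induction xs arbitrary: Y) (auto simp: update_def split: prod.splits)

lemma split_at_last_occurrence:
  assumes "e \<in> fst ` set xs"
  obtains as b bs where "xs = as @ (e, b) # bs" "e \<notin> fst ` set bs"
proof -
  obtain b where "(e, b) \<in> set xs" using assms by auto
  then have "\<exists>x\<in>set xs. fst x = e" by force
  then obtain as x bs where "xs = as @ x # bs" "fst x = e" "\<forall>y\<in>set bs. fst y \<noteq> e"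
    using split_list_last_prop[of xs "\<lambda>x. fst x = e"] by auto
  then show ?thesis by (intro that[of as "snd x" bs]) auto
qed

text \<open>While an edge is not pivotal its updates are not affected by the conditioning; so if it ends up
  closed, it was closed from the start or some update asked for it to be closed.\<close>

lemma closed_never_pivotal:
  assumes e: "e \<in> edges_in \<Lambda>" and closed: "\<not> run v \<Lambda> Y xs e"
    and np: "\<And>s. s < length xs \<Longrightarrow> e \<notin> pivotal v \<Lambda> (run v \<Lambda> Y (take s xs))"
  shows "\<not> Y e \<or> (e, False) \<in> set xs"
proof (cases "e \<in> fst ` set xs")
  case False
  then show ?thesis using closed run_other by metis
next
  case True
  then obtain as b bs where xs: "xs = as @ (e, b) # bs" "e \<notin> fst ` set bs"
    by (rule split_at_last_occurrence)
  have "e \<notin> pivotal v \<Lambda> (run v \<Lambda> Y as)" using np[of "length as"] by (simp add: xs)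
  moreover have "run v \<Lambda> Y xs e = update v \<Lambda> (run v \<Lambda> Y as) (e, b) e"
    using run_other[OF xs(2)] by (simp add: xs(1))
  ultimately have "b = False" using closed e by (simp add: update_def pivotal_def)
  then show ?thesis by (simp add: xs)
qed

text \<open>The two ways for an edge to be found closed at a time before which it was never pivotal. Each of
  them has a probability that is small with \<open>1 - p\<close>, even jointly over many edges.\<close>

definition cheap :: "'d::finite \<Rightarrow> (real ^ 'd) set \<Rightarrow> 'd config \<Rightarrow> ('d edge \<times> bool) list \<Rightarrow> 'd edge \<Rightarrow> bool" where
  "cheap v \<Lambda> Y xs e \<longleftrightarrow> e \<in> edges_in \<Lambda> \<and> (\<not> Y e \<and> e \<notin> pivotal v \<Lambda> Y \<or> (e, False) \<in> set xs)"

definition pivotal_free :: "'d::finite \<Rightarrow> (real ^ 'd) set \<Rightarrow> real ^ 'd \<Rightarrow> real \<Rightarrow> 'd config \<Rightarrow> bool" where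
  "pivotal_free v \<Lambda> x \<rho> Y \<longleftrightarrow> (\<forall>f\<in>pivotal v \<Lambda> Y. \<forall>y\<in>f. \<rho> \<le> dist x y)"

text \<open>How pivotal edges invade a ball that was free of them. Let \<open>f\<close> become pivotal for the first
  time at time \<open>t\<close>. At that time a chain of closed edges leads from \<open>f\<close> to the boundary of
  the box. Follow it while the edges have never been pivotal before \<open>t\<close>: they are all cheap. Either
  the chain leaves the ball, or it meets an edge of the ball that was first pivotal at some earlier time,
  from which the construction continues by induction. Since there is no pivotal edge in the ball at
  time 0, the process ends outside the ball.\<close>

lemma cheap_path_outwards:
  fixes \<Lambda> :: "(real ^ 'd::finite) set" and v :: 'd
  assumes box: "cubic_box \<Lambda>" and d2: "CARD('d) \<ge> 2"
    and Y: "Y \<in> disconnected_configs v \<Lambda>" and xs: "fst ` set xs \<subseteq> edges_in \<Lambda>"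
    and free: "pivotal_free v \<Lambda> x \<rho> Y" and inside: "\<And>w. w \<notin> \<Lambda> \<Longrightarrow> \<rho> \<le> dist x w"
    and t: "t \<le> length xs" and f: "f \<in> pivotal v \<Lambda> (run v \<Lambda> Y (take t xs))"
    and first: "\<And>s. s < t \<Longrightarrow> f \<notin> pivotal v \<Lambda> (run v \<Lambda> Y (take s xs))"
    and near: "\<exists>y\<in>f. dist x y < \<rho>"
  shows "cheap v \<Lambda> Y xs f \<and>
    (\<exists>g. (f, g) \<in> {(a, b). adj a b \<and> cheap v \<Lambda> Y xs b}\<^sup>* \<and> (\<exists>y\<in>g. \<rho> - 3 \<le> dist x y))"
  using t f first near
proof (induction t arbitrary: f rule: less_induct)
  case (less t)
  define A where "A = {(a, b). adj a b \<and> cheap v \<Lambda> Y xs b}"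
  let ?Y = "\<lambda>s. run v \<Lambda> Y (take s xs)"
  have dis: "?Y s \<in> disconnected_configs v \<Lambda>" for s
    using xs by (intro run_disconnected Y) (auto dest: in_set_takeD)
  have t0: "t > 0"
  proof (rule ccontr)
    assume "\<not> t > 0"
    then show False using free less.prems(2,4) by (force simp: pivotal_free_def)
  qed
  have never_cheap: "cheap v \<Lambda> Y xs h"
    if h: "h \<in> edges_in \<Lambda>" "\<not> ?Y t h" "\<And>s. s < t \<Longrightarrow> h \<notin> pivotal v \<Lambda> (?Y s)" for h
  proof -
    have "\<not> Y h \<or> (h, False) \<in> set (take t xs)"
    proof (rule closed_never_pivotal[OF h(1,2)])
      fix s assume "s < length (take t xs)"
      then have "s < t" by simp
      then show "h \<notin> pivotal v \<Lambda> (run v \<Lambda> Y (take s (take t xs)))" using h(3)[of s] by (simp add: min_def)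
    qed
    moreover have "h \<notin> pivotal v \<Lambda> Y" using h(3)[OF t0] by simp
    ultimately show ?thesis using h(1) by (auto simp: cheap_def dest: in_set_takeD)
  qed
  have fE: "f \<in> edges_in \<Lambda>" using less.prems(2) by (simp add: pivotal_def)
  have fc: "\<not> ?Y t f" using dis[of t] less.prems(2) pivotal_closed by (auto simp: disconnected_configs_def)
  have cheap_f: "cheap v \<Lambda> Y xs f" using never_cheap[OF fE fc less.prems(3)] .
  obtain g where g: "(f, g) \<in> (closed_adj \<Lambda> (?Y t))\<^sup>*" "\<exists>u\<in>g. \<exists>w. w \<notin> \<Lambda> \<and> dist u w \<le> 1"
    using pivotal_chain_to_boundary[OF box d2 _ less.prems(2)] dis[of t] by (auto simp: disconnected_configs_def)
  obtain u where u: "u \<in> g" "\<rho> - 1 \<le> dist x u"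
  proof -
    from g(2) obtain u w where uw: "u \<in> g" "w \<notin> \<Lambda>" "dist u w \<le> 1" by blast
    have "\<rho> \<le> dist x w" by (rule inside[OF uw(2)])
    then show ?thesis using uw dist_triangle[of x w u] by (intro that[of u]) auto
  qed
  \<comment> \<open>Induction along the chain: either a cheap path has already left the ball (the loss of 3 covers a
    last step of length 2 and the distance 1 to the complement), or the chain so far has never been
    pivotal.\<close>
  have "(\<exists>g. (f, g) \<in> A\<^sup>* \<and> (\<exists>y\<in>g. \<rho> - 3 \<le> dist x y)) \<or> (f, h) \<in> A\<^sup>* \<and> (\<forall>s<t. h \<notin> pivotal v \<Lambda> (?Y s))"
    if "(f, h) \<in> (closed_adj \<Lambda> (?Y t))\<^sup>*" for h
    using that
  proof (induction rule: rtrancl_induct)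
    case base
    then show ?case using less.prems(3) by blast
  next
    case (step h k)
    show ?case
    proof (cases "(f, h) \<in> A\<^sup>* \<and> (\<forall>s<t. h \<notin> pivotal v \<Lambda> (?Y s))")
      case False
      then show ?thesis using step.IH by blast
    next
      case h: True
      have hk: "adj h k" "k \<in> edges_in \<Lambda>" "\<not> ?Y t k" "h \<in> edges_in \<Lambda>" using step(2) by (auto simp: closed_adj_def)
      show ?thesis
      proof (cases "\<forall>s<t. k \<notin> pivotal v \<Lambda> (?Y s)")
        case True
        then have "(h, k) \<in> A" using hk never_cheap by (auto simp: A_def)
        then show ?thesis using h True by (meson rtrancl.rtrancl_into_rtrancl)
      next
        case False
        define s where "s = (LEAST s. k \<in> pivotal v \<Lambda> (?Y s))"
        obtain s' where s': "s' < t" "k \<in> pivotal v \<Lambda> (?Y s')" using False by blast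
        have s: "k \<in> pivotal v \<Lambda> (?Y s)" "s \<le> s'"
          unfolding s_def using s'(2) by (rule LeastI, rule Least_le)
        have sf: "k \<notin> pivotal v \<Lambda> (?Y r)" if "r < s" for r
          using that unfolding s_def by (rule not_less_Least)
        show ?thesis
        proof (cases "\<exists>y\<in>k. dist x y < \<rho>")
          case True
          have "cheap v \<Lambda> Y xs k \<and> (\<exists>g. (k, g) \<in> A\<^sup>* \<and> (\<exists>y\<in>g. \<rho> - 3 \<le> dist x y))"
            unfolding A_def
            by (rule less.IH[of s]) (use s s' sf True less.prems(1) in auto)
          moreover from this have "(h, k) \<in> A" using hk by (simp add: A_def)
          ultimately show ?thesis using h by (meson converse_rtrancl_into_rtrancl rtrancl_trans)
        next
          case False
          obtain y z where "y \<in> k" "z \<in> h"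
            using edges_in_props(1)[OF box] hk by (metis all_not_in_conv)
          then have "dist z y \<le> 2" "\<rho> \<le> dist x y" using hk(1) False by (auto simp: adj_def)
          then have "\<rho> - 3 \<le> dist x z" using dist_triangle[of x y z] by linarith
          then show ?thesis using h \<open>z \<in> h\<close> by blast
        qed
      qed
    qed
  qed
  from this[OF g(1)] show ?case
  proof
    assume "(f, g) \<in> A\<^sup>* \<and> (\<forall>s<t. g \<notin> pivotal v \<Lambda> (?Y s))"
    then have "(f, g) \<in> A\<^sup>*" "\<exists>y\<in>g. \<rho> - 3 \<le> dist x y" using u by force+
    then show ?thesis using cheap_f unfolding A_def by blast
  qed (use cheap_f A_def in blast)
qed

section \<open>Elementary probability bounds\<close>

lemma measure_pair_pmf_Times:
  "measure_pmf.prob (pair_pmf M N) (A \<times> B) = measure_pmf.prob M A * measure_pmf.prob N B"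
proof -
  have "measure_pmf.prob (pair_pmf M N) (A \<times> B) =
      measure_pmf.prob (pair_pmf M N) ((A \<inter> set_pmf M) \<times> (B \<inter> set_pmf N))"
    by (rule measure_prob_cong_0) (auto simp: set_pmf_iff pmf_pair)
  also have "\<dots> = measure_pmf.prob M (A \<inter> set_pmf M) * measure_pmf.prob N (B \<inter> set_pmf N)"
    by (intro measure_pmf_prob_product countable_Int2 countable_set_pmf)
  finally show ?thesis by (simp add: measure_Int_set_pmf)
qed

lemma prob_mono_on_support:
  assumes "\<And>x. x \<in> set_pmf M \<Longrightarrow> x \<in> A \<Longrightarrow> x \<in> B"
  shows "measure_pmf.prob M A \<le> measure_pmf.prob M B"
proof -
  have "measure_pmf.prob M A = measure_pmf.prob M (A \<inter> set_pmf M)" by (simp add: measure_Int_set_pmf)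
  also have "\<dots> \<le> measure_pmf.prob M B" by (rule measure_pmf.finite_measure_mono) (use assms in auto)
  finally show ?thesis .
qed

lemma prob_UN_le:
  assumes "finite I" "\<And>i. i \<in> I \<Longrightarrow> measure_pmf.prob M (A i) \<le> b"
  shows "measure_pmf.prob M (\<Union>i\<in>I. A i) \<le> real (card I) * b"
proof -
  have "measure_pmf.prob M (\<Union>i\<in>I. A i) \<le> (\<Sum>i\<in>I. measure_pmf.prob M (A i))"
    using assms(1) by (intro measure_pmf.finite_measure_subadditive_finite) auto
  also have "\<dots> \<le> (\<Sum>i\<in>I. b)" by (intro sum_mono assms(2))
  finally show ?thesis by simp
qed

lemma replicate_pmf_Suc_pair:
  "replicate_pmf (Suc n) q = map_pmf (\<lambda>(x, xs). x # xs) (pair_pmf q (replicate_pmf n q))"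
  by (simp add: pair_pmf_def map_pmf_def bind_assoc_pmf bind_return_pmf)

text \<open>The first two terms of the binomial expansion.\<close>

lemma power_Suc_add_le:
  fixes a s :: real
  assumes "a \<ge> 0" "s \<ge> 0"
  shows "a ^ Suc j + real (Suc j) * (s * a ^ j) \<le> (a + s) ^ Suc j"
proof (induction j)
  case (Suc j)
  have "a ^ Suc (Suc j) + real (Suc (Suc j)) * (s * a ^ Suc j) \<le>
      (a + s) * (a ^ Suc j + real (Suc j) * (s * a ^ j))"
    using assms by (simp add: algebra_simps)
  also have "\<dots> \<le> (a + s) * (a + s) ^ Suc j" using Suc assms by (intro mult_left_mono) auto
  finally show ?case by simp
qed simp

text \<open>Induction on the number of draws: if the first draw is some \<open>g\<close> in \<open>G\<close>, then only
  \<open>G - {g}\<close> remains to be covered.\<close>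

lemma prob_replicate_covers:
  assumes "finite G" and s: "\<And>g. g \<in> G \<Longrightarrow> pmf q g \<le> s" and s0: "s \<ge> 0"
  shows "measure_pmf.prob (replicate_pmf n q) {xs. G \<subseteq> set xs} \<le> (real n * s) ^ card G"
  using assms(1) s
proof (induction n arbitrary: G)
  case 0
  then show ?case by (cases "G = {}") (auto simp: measure_return_pmf card_gt_0_iff)
next
  case (Suc n)
  show ?case
  proof (cases "G = {}")
    case False
    then obtain j where j: "card G = Suc j" using Suc.prems(1) by (metis card_gt_0_iff gr0_implies_Suc)
    let ?M = "pair_pmf q (replicate_pmf n q)"
    have "measure_pmf.prob (replicate_pmf (Suc n) q) {xs. G \<subseteq> set xs} =
        measure_pmf.prob ?M {(x, xs). G \<subseteq> insert x (set xs)}"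
      unfolding replicate_pmf_Suc_pair measure_map_pmf by (intro arg_cong2[where f = measure_pmf.prob]) auto
    also have "\<dots> \<le> measure_pmf.prob ?M (UNIV \<times> {xs. G \<subseteq> set xs} \<union> (\<Union>g\<in>G. {g} \<times> {xs. G - {g} \<subseteq> set xs}))"
      by (rule measure_pmf.finite_measure_mono) auto
    also have "\<dots> \<le> measure_pmf.prob ?M (UNIV \<times> {xs. G \<subseteq> set xs}) +
        measure_pmf.prob ?M (\<Union>g\<in>G. {g} \<times> {xs. G - {g} \<subseteq> set xs})"
      by (rule measure_Un_le) auto
    also have "measure_pmf.prob ?M (UNIV \<times> {xs. G \<subseteq> set xs}) \<le> (real n * s) ^ Suc j"
      using Suc.IH[of G] Suc.prems j by (simp add: measure_pair_pmf_Times)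
    also have "measure_pmf.prob ?M (\<Union>g\<in>G. {g} \<times> {xs. G - {g} \<subseteq> set xs}) \<le> real (card G) * (s * (real n * s) ^ j)"
    proof (rule prob_UN_le)
      fix g assume g: "g \<in> G"
      have "measure_pmf.prob (replicate_pmf n q) {xs. G - {g} \<subseteq> set xs} \<le> (real n * s) ^ card (G - {g})"
        using Suc.prems by (intro Suc.IH) auto
      moreover have "card (G - {g}) = j" using g j Suc.prems(1) by simp
      ultimately show "measure_pmf.prob ?M ({g} \<times> {xs. G - {g} \<subseteq> set xs}) \<le> s * (real n * s) ^ j"
        using Suc.prems(2)[OF g] s0
        by (simp add: measure_pair_pmf_Times measure_pmf_single) (intro mult_mono, auto)
    qed (use Suc.prems in auto)
    also have "(real n * s) ^ Suc j + real (card G) * (s * (real n * s) ^ j) \<le> (real n * s + s) ^ Suc j"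
      unfolding j using s0 by (intro power_Suc_add_le) auto
    finally show ?thesis by (simp add: j algebra_simps)
  qed simp
qed

lemma prob_replicate_all:
  "measure_pmf.prob (replicate_pmf n q) {xs. \<forall>x\<in>set xs. P x} = measure_pmf.prob q {x. P x} ^ n"
proof (induction n)
  case (Suc n)
  have "measure_pmf.prob (replicate_pmf (Suc n) q) {xs. \<forall>x\<in>set xs. P x} =
      measure_pmf.prob (pair_pmf q (replicate_pmf n q)) ({x. P x} \<times> {xs. \<forall>x\<in>set xs. P x})"
    unfolding replicate_pmf_Suc_pair measure_map_pmf by (intro arg_cong2[where f = measure_pmf.prob]) auto
  then show ?case by (simp add: measure_pair_pmf_Times Suc)
qed (simp add: measure_return_pmf)

text \<open>A stationary law is preserved by \<open>n\<close> steps driven by \<open>n\<close> independent inputs. Keeping the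
  inputs explicit lets events about the whole history be expressed.\<close>

lemma stationary_iterate:
  assumes "bind_pmf \<mu> (\<lambda>s. map_pmf (f s) q) = \<mu>"
  shows "map_pmf (\<lambda>(s, xs). foldl f s xs) (pair_pmf \<mu> (replicate_pmf n q)) = \<mu>"
proof (induction n)
  case 0
  show ?case by (simp add: pair_return_pmf2 map_pmf_comp)
next
  case (Suc n)
  have "map_pmf (\<lambda>(s, xs). foldl f s xs) (pair_pmf \<mu> (replicate_pmf (Suc n) q)) =
      bind_pmf (bind_pmf \<mu> (\<lambda>s. map_pmf (f s) q)) (\<lambda>s. map_pmf (foldl f s) (replicate_pmf n q))"
    by (simp add: pair_pmf_def map_pmf_def bind_assoc_pmf bind_return_pmf)
  also have "\<dots> = map_pmf (\<lambda>(s, xs). foldl f s xs) (pair_pmf \<mu> (replicate_pmf n q))"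
    unfolding assms by (simp add: pair_pmf_def map_pmf_def bind_assoc_pmf bind_return_pmf)
  finally show ?case using Suc by simp
qed

section \<open>Counting chains\<close>

lemma finite_lattice_bounded: "finite {x :: real ^ 'd::finite. x \<in> lattice \<and> (\<forall>i. \<bar>x $ i\<bar> \<le> r)}"
proof (rule finite_subset)
  let ?A = "real_of_int ` {- \<lceil>r\<rceil>..\<lceil>r\<rceil>}"
  show "finite ((\<lambda>f. \<chi> i. f i) ` (UNIV \<rightarrow>\<^sub>E ?A) :: (real ^ 'd) set)"
    by (intro finite_imageI finite_PiE) auto
  show "{x :: real ^ 'd. x \<in> lattice \<and> (\<forall>i. \<bar>x $ i\<bar> \<le> r)} \<subseteq> (\<lambda>f. \<chi> i. f i) ` (UNIV \<rightarrow>\<^sub>E ?A)"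
  proof
    fix x :: "real ^ 'd" assume x: "x \<in> {x. x \<in> lattice \<and> (\<forall>i. \<bar>x $ i\<bar> \<le> r)}"
    have "x $ i \<in> ?A" for i
    proof -
      have "x $ i \<in> \<int>" using x by (simp add: lattice_def)
      then obtain k where k: "x $ i = real_of_int k" by (auto elim: Ints_cases)
      have "\<bar>x $ i\<bar> \<le> r" using x by blast
      then have "k \<in> {- \<lceil>r\<rceil>..\<lceil>r\<rceil>}" unfolding k by (simp, linarith)
      then show ?thesis unfolding k by blast
    qed
    then show "x \<in> (\<lambda>f. \<chi> i. f i) ` (UNIV \<rightarrow>\<^sub>E ?A)"
      by (intro image_eqI[where x = "\<lambda>i. x $ i"]) (auto simp: vec_eq_iff)
  qed
qed

text \<open>A bound, depending on the dimension only, for the number of neighbours of an edge: both endpoints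
  of a neighbour are within distance 2 of any given endpoint of the edge.\<close>

definition adj_bound :: "'d::finite itself \<Rightarrow> nat" where
  "adj_bound _ = (card {x :: real ^ 'd. x \<in> lattice \<and> norm x \<le> 2})\<^sup>2"

lemma finite_lattice_ball: "finite {x :: real ^ 'd::finite. x \<in> lattice \<and> norm x \<le> 2}"
  by (rule finite_subset[OF _ finite_lattice_bounded[of 2]]) (auto intro: order_trans[OF component_le_norm_cart])

lemma adj_bound_pos: "adj_bound TYPE('d::finite) \<ge> 1"
proof -
  have "0 \<in> {x :: real ^ 'd. x \<in> lattice \<and> norm x \<le> 2}" by (simp add: lattice_def)
  then have "card {x :: real ^ 'd. x \<in> lattice \<and> norm x \<le> 2} > 0"
    using finite_lattice_ball[where 'd = 'd] by (auto simp only: card_gt_0_iff)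
  then show ?thesis by (simp add: adj_bound_def Suc_leI)
qed

lemma card_adj_le:
  fixes \<Lambda> :: "(real ^ 'd::finite) set"
  assumes box: "cubic_box \<Lambda>" and a: "a \<in> edges_in \<Lambda>"
  shows "card {b \<in> edges_in \<Lambda>. adj a b} \<le> adj_bound TYPE('d)"
proof -
  let ?Z = "{x :: real ^ 'd. x \<in> lattice \<and> norm x \<le> 2}"
  obtain x where x: "x \<in> a" using edges_in_props(1)[OF box a] by blast
  have xl: "x \<in> lattice" using edges_in_props(2)[OF box a] x by blast
  have "{b \<in> edges_in \<Lambda>. adj a b} \<subseteq> (\<lambda>(u, w). {x + u, x + w}) ` (?Z \<times> ?Z)"
  proof
    fix b assume b: "b \<in> {b \<in> edges_in \<Lambda>. adj a b}"
    then obtain y z where yz: "b = {y, z}" "y \<in> lattice" "z \<in> lattice"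
      by (auto simp: edges_in_def lattice_edges_def)
    have "norm (y - x) \<le> 2" "norm (z - x) \<le> 2" using b x yz by (auto simp: adj_def dist_norm norm_minus_commute)
    moreover have "y - x \<in> lattice" "z - x \<in> lattice" using yz xl by (auto simp: lattice_def)
    ultimately show "b \<in> (\<lambda>(u, w). {x + u, x + w}) ` (?Z \<times> ?Z)"
      unfolding yz(1) by (intro image_eqI[where x = "(y - x, z - x)"]) auto
  qed
  then have "card {b \<in> edges_in \<Lambda>. adj a b} \<le> card (?Z \<times> ?Z)"
    by (rule surj_card_le[rotated]) (simp add: finite_lattice_ball)
  then show ?thesis by (simp add: adj_bound_def card_cartesian_product power2_eq_square)
qed

lemma card_adj_chains_le:
  fixes \<Lambda> :: "(real ^ 'd::finite) set"
  assumes box: "cubic_box \<Lambda>" and "a \<in> edges_in \<Lambda>"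
  shows "finite {fs. length fs = k \<and> set fs \<subseteq> edges_in \<Lambda> \<and> successively adj (a # fs)} \<and>
    card {fs. length fs = k \<and> set fs \<subseteq> edges_in \<Lambda> \<and> successively adj (a # fs)} \<le> adj_bound TYPE('d) ^ k"
  using assms(2)
proof (induction k arbitrary: a)
  case 0
  have "{fs. length fs = 0 \<and> set fs \<subseteq> edges_in \<Lambda> \<and> successively adj (a # fs)} = {[]}" by auto
  then show ?case by simp
next
  case (Suc k)
  let ?S = "\<lambda>k a. {fs. length fs = k \<and> set fs \<subseteq> edges_in \<Lambda> \<and> successively adj (a # fs)}"
  let ?B = "{b \<in> edges_in \<Lambda>. adj a b}"
  have fB: "finite ?B" using finite_edges_in[OF box] by simp
  have eq: "?S (Suc k) a = (\<Union>b\<in>?B. Cons b ` ?S k b)"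
    by (auto simp: length_Suc_conv)
  have "finite (?S (Suc k) a)" unfolding eq using fB Suc.IH by auto
  moreover have "card (?S (Suc k) a) \<le> (\<Sum>b\<in>?B. card (Cons b ` ?S k b))"
    unfolding eq by (rule card_UN_le[OF fB])
  moreover have "\<dots> \<le> (\<Sum>b\<in>?B. adj_bound TYPE('d) ^ k)"
    by (rule sum_mono) (use Suc.IH in \<open>auto simp: card_image\<close>)
  moreover have "\<dots> \<le> adj_bound TYPE('d) ^ Suc k"
    using card_adj_le[OF box Suc.prems] by simp
  ultimately show ?case by linarith
qed

section \<open>Cost of closed nonpivotal edges\<close>

text \<open>The bound \<open>1 / 2 \<le> p\<close> makes the cost \<open>q\<close> of closing an edge at most 1.\<close>

locale box_percolation =
  fixes v :: "'d::finite" and \<Lambda> :: "(real ^ 'd) set" and p :: real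
  assumes box: "cubic_box \<Lambda>" and d2: "CARD('d) \<ge> 2" and p_half: "1 / 2 \<le> p" and p1: "p < 1"
begin

abbreviation "E \<equiv> edges_in \<Lambda>"
abbreviation "N \<equiv> card E"
abbreviation "D \<equiv> disconnected_configs v \<Lambda>"

definition q :: real where "q = (1 - p) / p"

lemma p0: "0 < p" using p_half by simp

lemma q_bounds: "0 < q" "q \<le> 1" "1 - p \<le> sqrt q"
proof -
  show q0: "0 < q" and q1: "q \<le> 1" using p_half p1 p0 by (auto simp: q_def)
  have "1 - p \<le> q" using p0 p1 by (simp add: q_def pos_le_divide_eq mult_left_le)
  also have "q \<le> sqrt q" using q0 q1 by (simp add: real_le_rsqrt power2_eq_square mult_left_le)
  finally show "1 - p \<le> sqrt q" .
qed

lemma finE: "finite E" and E_ne: "E \<noteq> {}" and N_pos: "N > 0"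
  using finite_edges_in[OF box] edges_in_nonempty[OF box] by (auto simp: card_gt_0_iff)

definition product_pmf :: "'d config pmf" where
  "product_pmf = Pi_pmf E undefined (\<lambda>_. bernoulli_pmf p)"

text \<open>The equilibrium law of the second coordinate: Bernoulli percolation conditioned on the
  disconnection of the top from the bottom.\<close>

definition conditioned :: "'d config pmf" where
  "conditioned = cond_pmf product_pmf D"

lemma set_product: "set_pmf product_pmf = configs \<Lambda>"
  using p0 p1 unfolding product_pmf_def set_Pi_pmf[OF finE]
  by (auto simp: PiE_dflt_def configs_def PiE_def extensional_def set_pmf_bernoulli)

lemma pmf_product: "Y \<in> configs \<Lambda> \<Longrightarrow> pmf product_pmf Y = (\<Prod>e\<in>E. pmf (bernoulli_pmf p) (Y e))"
  unfolding product_pmf_def by (rule pmf_Pi'[OF finE]) (auto simp: configs_def PiE_def extensional_def)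

lemma all_closed_disconnected: "(\<lambda>e\<in>E. False) \<in> D"
  using not_connected_closed[OF box, of "\<lambda>e\<in>E. False" v]
  by (auto simp: disconnected_configs_def configs_def)

lemma product_Int_D: "set_pmf product_pmf \<inter> D \<noteq> {}"
  using all_closed_disconnected unfolding set_product by (auto simp: disconnected_configs_def)

lemma set_conditioned: "set_pmf conditioned = D"
  unfolding conditioned_def set_cond_pmf[OF product_Int_D] set_product by (auto simp: disconnected_configs_def)

lemma finD: "finite D"
proof (rule finite_subset)
  show "D \<subseteq> configs \<Lambda>" by (auto simp: disconnected_configs_def)
  show "finite (configs \<Lambda>)" using finE by (auto simp: configs_def intro!: finite_PiE)
qed

lemma pmf_conditioned:
  "Y \<in> D \<Longrightarrow> pmf conditioned Y = (\<Prod>e\<in>E. pmf (bernoulli_pmf p) (Y e)) / measure_pmf.prob product_pmf D"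
  unfolding conditioned_def pmf_cond[OF product_Int_D] by (simp add: pmf_product disconnected_configs_def)

lemma pmf_conditioned_upd:
  assumes "Y \<in> D" "Y(e := b) \<in> D" "e \<in> E"
  shows "pmf conditioned (Y(e := b)) * pmf (bernoulli_pmf p) (Y e) = pmf conditioned Y * pmf (bernoulli_pmf p) b"
proof -
  have "(\<Prod>f\<in>E - {e}. pmf (bernoulli_pmf p) ((Y(e := b)) f)) = (\<Prod>f\<in>E - {e}. pmf (bernoulli_pmf p) (Y f))"
    by (rule prod.cong) auto
  then show ?thesis
    unfolding pmf_conditioned[OF assms(1)] pmf_conditioned[OF assms(2)] prod.remove[OF finE assms(3)] by simp
qed

lemma pmf_conditioned_open_all:
  assumes "Y \<in> D" "open_all H Y \<in> D" "H \<subseteq> E" "\<And>e. e \<in> H \<Longrightarrow> \<not> Y e"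
  shows "pmf conditioned Y = q ^ card H * pmf conditioned (open_all H Y)"
proof -
  have "(\<Prod>f\<in>E - H. pmf (bernoulli_pmf p) (open_all H Y f)) = (\<Prod>f\<in>E - H. pmf (bernoulli_pmf p) (Y f))"
    by (rule prod.cong) (auto simp: open_all_def)
  moreover have "(\<Prod>f\<in>H. pmf (bernoulli_pmf p) (open_all H Y f)) = p ^ card H"
    using p0 p1 by (simp add: open_all_def)
  moreover have "(\<Prod>f\<in>H. pmf (bernoulli_pmf p) (Y f)) = (1 - p) ^ card H"
    using p0 p1 assms(4) by simp
  moreover have "(1 - p) ^ card H = q ^ card H * p ^ card H"
    using p0 by (simp add: q_def flip: power_mult_distrib)
  ultimately show ?thesis
    unfolding pmf_conditioned[OF assms(1)] pmf_conditioned[OF assms(2)] prod.subset_diff[OF assms(3) finE] by simp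
qed

text \<open>Opening \<open>H\<close> is injective on configurations that are closed on \<open>H\<close>, stays in the set of
  disconnected configurations, and multiplies the weight by \<open>q\<close> to the power \<open>- card H\<close>.\<close>

lemma prob_conditioned_openable:
  assumes H: "H \<subseteq> E"
  shows "measure_pmf.prob conditioned {Y. (\<forall>e\<in>H. \<not> Y e) \<and> \<not> top_bottom_connected v \<Lambda> (open_all H Y)} \<le> q ^ card H"
proof -
  define A where "A = {Y \<in> D. (\<forall>e\<in>H. \<not> Y e) \<and> \<not> top_bottom_connected v \<Lambda> (open_all H Y)}"
  have fA: "finite A" using finD by (auto simp: A_def)
  have AD: "open_all H Y \<in> D" if "Y \<in> A" for Y
    using that H by (auto simp: A_def disconnected_configs_def configs_def open_all_def PiE_iff extensional_def)
  have inj: "inj_on (open_all H) A"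
  proof (rule inj_onI, rule ext)
    fix Y Z e assume "Y \<in> A" "Z \<in> A" and eq: "open_all H Y = open_all H Z"
    moreover have "e \<in> H \<or> Y e \<longleftrightarrow> e \<in> H \<or> Z e"
      using fun_cong[OF eq, of e] by (simp add: open_all_def)
    ultimately show "Y e = Z e" by (cases "e \<in> H") (simp_all add: A_def)
  qed
  have "measure_pmf.prob conditioned {Y. (\<forall>e\<in>H. \<not> Y e) \<and> \<not> top_bottom_connected v \<Lambda> (open_all H Y)} \<le> measure_pmf.prob conditioned A"
    by (rule prob_mono_on_support) (auto simp: A_def set_conditioned)
  also have "\<dots> = (\<Sum>Y\<in>A. pmf conditioned Y)" using fA by (simp add: measure_measure_pmf_finite)
  also have "\<dots> = (\<Sum>Y\<in>A. q ^ card H * pmf conditioned (open_all H Y))"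
    by (intro sum.cong refl pmf_conditioned_open_all AD H) (auto simp: A_def)
  also have "\<dots> = q ^ card H * (\<Sum>Z\<in>open_all H ` A. pmf conditioned Z)"
    by (simp add: sum_distrib_left sum.reindex[OF inj])
  also have "\<dots> = q ^ card H * measure_pmf.prob conditioned (open_all H ` A)"
    using fA by (simp add: measure_measure_pmf_finite)
  also have "\<dots> \<le> q ^ card H" using q_bounds by (intro mult_left_le) auto
  finally show ?thesis .
qed

text \<open>Sum over the at most \<open>2 ^ card G\<close> choices of the half of \<open>G\<close> that can be opened.\<close>

lemma prob_closed_nonpivotal:
  assumes G: "G \<subseteq> E"
  shows "measure_pmf.prob conditioned {Y. \<forall>g\<in>G. \<not> Y g \<and> g \<notin> pivotal v \<Lambda> Y} \<le> (2 * sqrt q) ^ card G"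
proof -
  have fG: "finite G" using G finE finite_subset by blast
  define I where "I = {H \<in> Pow G. card G \<le> 2 * card H}"
  have fI: "finite I" using fG by (simp add: I_def)
  have cI: "card I \<le> 2 ^ card G"
    using card_mono[of "Pow G" I] fG by (auto simp: I_def card_Pow)
  have "measure_pmf.prob conditioned {Y. \<forall>g\<in>G. \<not> Y g \<and> g \<notin> pivotal v \<Lambda> Y} \<le>
      measure_pmf.prob conditioned (\<Union>H\<in>I. {Y. (\<forall>e\<in>H. \<not> Y e) \<and> \<not> top_bottom_connected v \<Lambda> (open_all H Y)})"
  proof (rule prob_mono_on_support)
    fix Y assume Y: "Y \<in> set_pmf conditioned" "Y \<in> {Y. \<forall>g\<in>G. \<not> Y g \<and> g \<notin> pivotal v \<Lambda> Y}"
    then have "\<not> top_bottom_connected v \<Lambda> Y" by (simp add: set_conditioned disconnected_configs_def)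
    from half_of_nonpivotal_can_open[OF this fG] Y(2)
    obtain H where "H \<subseteq> G" "card G \<le> 2 * card H" "\<not> top_bottom_connected v \<Lambda> (open_all H Y)" by auto
    then show "Y \<in> (\<Union>H\<in>I. {Y. (\<forall>e\<in>H. \<not> Y e) \<and> \<not> top_bottom_connected v \<Lambda> (open_all H Y)})"
      using Y(2) by (auto simp: I_def)
  qed
  also have "\<dots> \<le> real (card I) * sqrt q ^ card G"
  proof (rule prob_UN_le[OF fI])
    fix H assume H: "H \<in> I"
    have "measure_pmf.prob conditioned {Y. (\<forall>e\<in>H. \<not> Y e) \<and> \<not> top_bottom_connected v \<Lambda> (open_all H Y)} \<le> q ^ card H"
      using H G by (intro prob_conditioned_openable) (auto simp: I_def)
    also have "\<dots> = sqrt q ^ (2 * card H)" using q_bounds by (simp add: power_mult)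
    also have "\<dots> \<le> sqrt q ^ card G" using q_bounds H by (intro power_decreasing) (auto simp: I_def)
    finally show "measure_pmf.prob conditioned {Y. (\<forall>e\<in>H. \<not> Y e) \<and> \<not> top_bottom_connected v \<Lambda> (open_all H Y)} \<le> sqrt q ^ card G" .
  qed
  also have "\<dots> \<le> 2 ^ card G * sqrt q ^ card G"
    using cI q_bounds by (intro mult_right_mono) (auto simp flip: of_nat_power)
  finally show ?thesis by (simp add: power_mult_distrib)
qed

section \<open>Cost of chains of cheap edges\<close>

definition noise :: "('d edge \<times> bool) pmf" where
  "noise = pair_pmf (pmf_of_set E) (bernoulli_pmf p)"

text \<open>The stationary law of the starting configuration together with the next \<open>n\<close> inputs. The
  trajectory is a deterministic function of the two.\<close>

definition path_pmf :: "nat \<Rightarrow> ('d config \<times> ('d edge \<times> bool) list) pmf" where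
  "path_pmf n = pair_pmf conditioned (replicate_pmf n noise)"

lemma set_noise: "set_pmf noise = E \<times> UNIV"
  using p0 p1 by (simp add: noise_def set_pmf_of_set[OF E_ne finE] set_pmf_bernoulli)

lemma set_path: "(Y, xs) \<in> set_pmf (path_pmf n) \<Longrightarrow> Y \<in> D \<and> fst ` set xs \<subseteq> E \<and> length xs = n"
  by (auto simp: path_pmf_def set_conditioned set_replicate_pmf set_noise)

text \<open>Each input closes a given edge with probability \<open>(1 - p) / N\<close>, so over at most \<open>N\<close> steps
  the expected number of closing inputs for this edge is at most \<open>1 - p\<close>.\<close>

lemma prob_noise_all_closing:
  assumes G: "G \<subseteq> E" and n: "n \<le> N"
  shows "measure_pmf.prob (replicate_pmf n noise) {xs. \<forall>g\<in>G. (g, False) \<in> set xs} \<le> (1 - p) ^ card G"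
proof -
  have fG: "finite G" using G finE finite_subset by blast
  let ?G = "(\<lambda>g. (g, False)) ` G"
  have "measure_pmf.prob (replicate_pmf n noise) {xs. ?G \<subseteq> set xs} \<le> (real n * ((1 - p) / N)) ^ card ?G"
  proof (rule prob_replicate_covers)
    fix x assume "x \<in> ?G"
    then obtain g where g: "x = (g, False)" "g \<in> G" by blast
    then show "pmf noise x \<le> (1 - p) / N"
      using G p0 p1 by (simp add: noise_def pmf_pair pmf_of_set[OF E_ne finE] indicator_def)
  qed (use fG p1 in auto)
  also have "card ?G = card G" by (rule card_image) (auto simp: inj_on_def)
  also have "(real n * ((1 - p) / N)) ^ card G \<le> (1 - p) ^ card G"
  proof (rule power_mono)
    have "real n * (1 - p) \<le> N * (1 - p)" using n p1 by (intro mult_right_mono) auto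
    then show "real n * ((1 - p) / N) \<le> 1 - p" using N_pos by (simp add: field_simps)
  qed (use p1 in auto)
  finally show ?thesis by (simp add: image_subset_iff)
qed

lemma prob_all_cheap:
  assumes G: "G \<subseteq> E" and n: "n \<le> N"
  shows "measure_pmf.prob (path_pmf n) {(Y, xs). \<forall>g\<in>G. cheap v \<Lambda> Y xs g} \<le> (4 * sqrt q) ^ card G"
proof -
  have fG: "finite G" using G finE finite_subset by blast
  let ?S = "\<lambda>H. {Y. \<forall>g\<in>H. \<not> Y g \<and> g \<notin> pivotal v \<Lambda> Y} \<times> {xs. \<forall>g\<in>G - H. (g, False) \<in> set xs}"
  have "measure_pmf.prob (path_pmf n) {(Y, xs). \<forall>g\<in>G. cheap v \<Lambda> Y xs g} \<le> measure_pmf.prob (path_pmf n) (\<Union>H\<in>Pow G. ?S H)"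
  proof (rule measure_pmf.finite_measure_mono)
    show "{(Y, xs). \<forall>g\<in>G. cheap v \<Lambda> Y xs g} \<subseteq> (\<Union>H\<in>Pow G. ?S H)"
    proof clarify
      fix Y xs assume "\<forall>g\<in>G. cheap v \<Lambda> Y xs g"
      then show "(Y, xs) \<in> (\<Union>H\<in>Pow G. ?S H)"
        by (intro UN_I[of "{g \<in> G. \<not> Y g \<and> g \<notin> pivotal v \<Lambda> Y}"]) (auto simp: cheap_def)
    qed
  qed simp
  also have "\<dots> \<le> real (card (Pow G)) * (2 * sqrt q) ^ card G"
  proof (rule prob_UN_le)
    fix H assume "H \<in> Pow G"
    then have H: "H \<subseteq> G" by simp
    \<comment> \<open>The starting configuration pays for the edges of \<open>H\<close>, the independent inputs for the others.\<close>
    have "measure_pmf.prob (path_pmf n) (?S H) \<le> (2 * sqrt q) ^ card H * (1 - p) ^ card (G - H)"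
      unfolding path_pmf_def measure_pair_pmf_Times using H G q_bounds
      by (intro mult_mono prob_closed_nonpivotal prob_noise_all_closing n) auto
    also have "\<dots> \<le> (2 * sqrt q) ^ card H * (2 * sqrt q) ^ card (G - H)"
      using q_bounds p1 by (intro mult_left_mono power_mono) auto
    also have "\<dots> = (2 * sqrt q) ^ card G"
    proof -
      have "card H + card (G - H) = card G"
        using H fG by (simp add: card_Diff_subset finite_subset card_mono)
      then show ?thesis by (metis power_add)
    qed
    finally show "measure_pmf.prob (path_pmf n) (?S H) \<le> (2 * sqrt q) ^ card G" .
  qed (use fG in simp)
  also have "\<dots> = (2 * (2 * sqrt q)) ^ card G"
    using fG by (simp only: power_mult_distrib card_Pow) simp
  finally show ?thesis by simp
qed

text \<open>The cost per edge of a chain of cheap edges: \<open>sqrt q\<close> comes from opening half of the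
  edges, and \<open>4 * adj_bound\<close> counts the continuations of the chain, the subset of edges that are
  closed at the start, and the half that can be opened.\<close>

definition \<alpha> :: real where "\<alpha> = 4 * real (adj_bound TYPE('d)) * sqrt q"

lemma \<alpha>_nonneg: "0 \<le> \<alpha>" using q_bounds by (simp add: \<alpha>_def)

lemma prob_cheap_chain:
  assumes n: "n \<le> N"
  shows "measure_pmf.prob (path_pmf n) {(Y, xs). \<exists>a\<in>E. \<exists>fs. length fs = k \<and> distinct fs \<and>
      successively adj (a # fs) \<and> (\<forall>f\<in>set fs. cheap v \<Lambda> Y xs f)} \<le> N * \<alpha> ^ k"
proof -
  let ?C = "\<lambda>a. {fs. length fs = k \<and> set fs \<subseteq> E \<and> successively adj (a # fs)}"
  let ?S = "\<lambda>fs. {(Y, xs). distinct fs \<and> (\<forall>g\<in>set fs. cheap v \<Lambda> Y xs g)}"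
  have "measure_pmf.prob (path_pmf n) {(Y, xs). \<exists>a\<in>E. \<exists>fs. length fs = k \<and> distinct fs \<and>
      successively adj (a # fs) \<and> (\<forall>f\<in>set fs. cheap v \<Lambda> Y xs f)} \<le>
      measure_pmf.prob (path_pmf n) (\<Union>a\<in>E. \<Union>fs\<in>?C a. ?S fs)"
  proof (rule prob_mono_on_support)
    fix z assume "z \<in> {(Y, xs). \<exists>a\<in>E. \<exists>fs. length fs = k \<and> distinct fs \<and>
      successively adj (a # fs) \<and> (\<forall>f\<in>set fs. cheap v \<Lambda> Y xs f)}"
    then obtain Y xs a fs where "z = (Y, xs)" "a \<in> E" "length fs = k" "distinct fs"
      "successively adj (a # fs)" "\<forall>f\<in>set fs. cheap v \<Lambda> Y xs f" by blast
    then show "z \<in> (\<Union>a\<in>E. \<Union>fs\<in>?C a. ?S fs)"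
      by (intro UN_I[of a] UN_I[of fs]) (auto simp: cheap_def)
  qed
  also have "\<dots> \<le> N * \<alpha> ^ k"
  proof (rule prob_UN_le[OF finE])
    fix a assume a: "a \<in> E"
    have "measure_pmf.prob (path_pmf n) (\<Union>fs\<in>?C a. ?S fs) \<le> real (card (?C a)) * (4 * sqrt q) ^ k"
    proof (rule prob_UN_le)
      fix fs assume fs: "fs \<in> ?C a"
      show "measure_pmf.prob (path_pmf n) (?S fs) \<le> (4 * sqrt q) ^ k"
      proof (cases "distinct fs")
        case True
        then have "card (set fs) = k" using fs by (simp add: distinct_card)
        then show ?thesis using prob_all_cheap[OF _ n, of "set fs"] fs True by simp
      qed (use q_bounds in simp)
    qed (use card_adj_chains_le[OF box a] in blast)
    also have "\<dots> \<le> real (adj_bound TYPE('d) ^ k) * (4 * sqrt q) ^ k"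
      using card_adj_chains_le[OF box a, of k] q_bounds by (intro mult_right_mono) (auto simp del: of_nat_power)
    also have "\<dots> = \<alpha> ^ k" by (simp add: \<alpha>_def power_mult_distrib)
    finally show "measure_pmf.prob (path_pmf n) (\<Union>fs\<in>?C a. ?S fs) \<le> \<alpha> ^ k" .
  qed
  finally show ?thesis .
qed

section \<open>Reversibility\<close>

abbreviation step_pmf :: "'d config \<Rightarrow> 'd config pmf" where
  "step_pmf Y \<equiv> map_pmf (update v \<Lambda> Y) noise"

definition kern :: "nat \<Rightarrow> 'd config \<Rightarrow> 'd config pmf" where
  "kern n Y = map_pmf (run v \<Lambda> Y) (replicate_pmf n noise)"

lemma kern_0: "kern 0 = return_pmf"
  by (simp add: kern_def fun_eq_iff)

lemma kern_Suc: "kern (Suc n) Y = bind_pmf (step_pmf Y) (kern n)"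
  by (simp add: kern_def map_pmf_def bind_assoc_pmf bind_return_pmf)

lemma kern_Suc_right: "kern (Suc n) Y = bind_pmf (kern n Y) step_pmf"
proof (induction n arbitrary: Y)
  case 0
  then show ?case by (simp add: kern_Suc kern_0 bind_return_pmf bind_return_pmf')
next
  case (Suc n)
  have "kern (Suc (Suc n)) Y = bind_pmf (step_pmf Y) (\<lambda>Z. bind_pmf (kern n Z) step_pmf)"
    unfolding kern_Suc[of "Suc n"] Suc.IH[abs_def] ..
  then show ?case by (simp add: kern_Suc bind_assoc_pmf)
qed

lemma set_step: "Y \<in> D \<Longrightarrow> set_pmf (step_pmf Y) \<subseteq> D"
  using update_disconnected by (auto simp: set_noise)

lemma set_kern: "Y \<in> D \<Longrightarrow> set_pmf (kern n Y) \<subseteq> D"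
  by (auto simp: kern_def set_replicate_pmf set_noise intro!: run_disconnected)

lemma update_eq: "e \<in> E \<Longrightarrow> update v \<Lambda> Y (e, b) = Y(e := (b \<and> e \<notin> pivotal v \<Lambda> Y))"
  by (simp add: update_def pivotal_def)

text \<open>Updating one edge is a heat bath step: a pivotal edge stays closed, and any other edge is
  resampled from its conditional law.\<close>

lemma balance_edge:
  assumes Y: "Y \<in> D" and Z: "Z \<in> D" and e: "e \<in> E"
  shows "pmf conditioned Y * pmf (map_pmf (\<lambda>b. update v \<Lambda> Y (e, b)) (bernoulli_pmf p)) Z =
    pmf conditioned Z * pmf (map_pmf (\<lambda>b. update v \<Lambda> Z (e, b)) (bernoulli_pmf p)) Y"
proof (cases "Z = Y(e := Z e)")
  case False
  have "Z \<noteq> Y(e := b)" "Y \<noteq> Z(e := b)" for b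
    using False by (metis fun_upd_same, metis fun_upd_triv fun_upd_upd)
  then have "Z \<notin> set_pmf (map_pmf (\<lambda>b. update v \<Lambda> Y (e, b)) (bernoulli_pmf p))"
    "Y \<notin> set_pmf (map_pmf (\<lambda>b. update v \<Lambda> Z (e, b)) (bernoulli_pmf p))"
    using e by (auto simp: update_eq)
  then have "pmf (map_pmf (\<lambda>b. update v \<Lambda> Y (e, b)) (bernoulli_pmf p)) Z = 0"
    "pmf (map_pmf (\<lambda>b. update v \<Lambda> Z (e, b)) (bernoulli_pmf p)) Y = 0"
    unfolding pmf_eq_0_set_pmf .
  then show ?thesis by simp
next
  case ZY: True
  then have YZ: "Y = Z(e := Y e)" by (metis fun_upd_triv fun_upd_upd)
  have piv: "e \<in> pivotal v \<Lambda> Z \<longleftrightarrow> e \<in> pivotal v \<Lambda> Y"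
    unfolding pivotal_def using ZY by (metis (no_types, lifting) fun_upd_upd mem_Collect_eq)
  show ?thesis
  proof (cases "e \<in> pivotal v \<Lambda> Y")
    case True
    then have "\<not> Y e" "\<not> Z e" using Y Z piv pivotal_closed by (auto simp: disconnected_configs_def)
    then have "Y(e := Z e) = Y" by (auto simp: fun_eq_iff)
    then have "Z = Y" by (rule ZY[THEN trans])
    then show ?thesis by simp
  next
    case False
    have inj: "inj (\<lambda>b. W(e := b))" for W :: "'d config"
    proof (rule injI)
      fix a b assume "W(e := a) = W(e := b)"
      from fun_cong[OF this, of e] show "a = b" by simp
    qed
    have eq: "update v \<Lambda> Y (e, b) = Y(e := b)" "update v \<Lambda> Z (e, b) = Z(e := b)" for b
      using False piv by (simp_all add: update_eq[OF e])
    have "pmf (map_pmf (\<lambda>b. update v \<Lambda> Y (e, b)) (bernoulli_pmf p)) Z = pmf (bernoulli_pmf p) (Z e)"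
      "pmf (map_pmf (\<lambda>b. update v \<Lambda> Z (e, b)) (bernoulli_pmf p)) Y = pmf (bernoulli_pmf p) (Y e)"
      unfolding eq
      using pmf_map_inj'[OF inj, of Y "bernoulli_pmf p" "Z e"] pmf_map_inj'[OF inj, of Z "bernoulli_pmf p" "Y e"]
      unfolding ZY[symmetric] YZ[symmetric] .
    then show ?thesis
      using pmf_conditioned_upd[OF Y _ e, of "Z e"] Z unfolding ZY[symmetric] by simp
  qed
qed

lemma balance_step:
  assumes Y: "Y \<in> D" and Z: "Z \<in> D"
  shows "pmf conditioned Y * pmf (step_pmf Y) Z = pmf conditioned Z * pmf (step_pmf Z) Y"
proof -
  have eq: "step_pmf Y = bind_pmf (pmf_of_set E) (\<lambda>e. map_pmf (\<lambda>b. update v \<Lambda> Y (e, b)) (bernoulli_pmf p))" for Y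
    by (simp add: noise_def pair_pmf_def map_pmf_def bind_assoc_pmf bind_return_pmf)
  show ?thesis
    unfolding eq pmf_bind_pmf_of_set[OF E_ne finE] using balance_edge[OF Y Z]
    by (simp add: sum_distrib_left)
qed

lemma balance_kern:
  assumes "Y \<in> D" "Z \<in> D"
  shows "pmf conditioned Y * pmf (kern n Y) Z = pmf conditioned Z * pmf (kern n Z) Y"
  using assms
proof (induction n arbitrary: Y Z)
  case 0
  then show ?case by (auto simp: kern_0 indicator_def)
next
  case (Suc n)
  have "pmf conditioned Y * pmf (kern (Suc n) Y) Z =
      (\<Sum>W\<in>D. (pmf conditioned Y * pmf (step_pmf Y) W) * pmf (kern n W) Z)"
    unfolding kern_Suc pmf_bind_finite[OF finD set_step[OF Suc.prems(1)]]
    by (simp add: sum_distrib_left mult.assoc)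
  also have "\<dots> = (\<Sum>W\<in>D. pmf (step_pmf W) Y * (pmf conditioned W * pmf (kern n W) Z))"
    using Suc.prems by (intro sum.cong) (auto simp: balance_step)
  also have "\<dots> = (\<Sum>W\<in>D. pmf conditioned Z * (pmf (kern n Z) W * pmf (step_pmf W) Y))"
    using Suc by (intro sum.cong) auto
  also have "\<dots> = pmf conditioned Z * pmf (kern (Suc n) Z) Y"
    unfolding kern_Suc_right pmf_bind_finite[OF finD set_kern[OF Suc.prems(2)]]
    by (simp add: sum_distrib_left)
  finally show ?case .
qed

lemma kern_outside: "Y \<in> D \<Longrightarrow> Z \<notin> D \<Longrightarrow> pmf (kern n Y) Z = 0"
  using set_kern[of Y n] by (meson pmf_eq_0_set_pmf subsetD)

lemma conditioned_outside: "Y \<notin> D \<Longrightarrow> pmf conditioned Y = 0"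
  using set_conditioned by (simp add: pmf_eq_0_set_pmf)

lemma conditioned_kern: "bind_pmf conditioned (kern n) = conditioned"
proof (rule pmf_eqI)
  fix Z
  have eq: "pmf (bind_pmf conditioned (kern n)) Z = (\<Sum>Y\<in>D. pmf conditioned Y * pmf (kern n Y) Z)"
    by (rule pmf_bind_finite[OF finD]) (simp add: set_conditioned)
  show "pmf (bind_pmf conditioned (kern n)) Z = pmf conditioned Z"
  proof (cases "Z \<in> D")
    case True
    have "(\<Sum>Y\<in>D. pmf conditioned Y * pmf (kern n Y) Z) = pmf conditioned Z * (\<Sum>Y\<in>D. pmf (kern n Z) Y)"
      unfolding sum_distrib_left using True by (intro sum.cong balance_kern) auto
    also have "(\<Sum>Y\<in>D. pmf (kern n Z) Y) = 1" by (rule sum_pmf_eq_1[OF finD set_kern[OF True]])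
    finally show ?thesis by (simp add: eq)
  next
    case False
    then show ?thesis by (simp add: eq kern_outside conditioned_outside)
  qed
qed

lemma conditioned_step: "bind_pmf conditioned step_pmf = conditioned"
proof -
  have "step_pmf Y = kern 1 Y" for Y by (simp add: kern_Suc kern_0 bind_return_pmf')
  then show ?thesis using conditioned_kern[of 1] by simp
qed

text \<open>Detailed balance for one step extends to \<open>n\<close> steps: the joint law of the configurations at times \<open>0\<close> and \<open>n\<close> is symmetric.\<close>

lemma prob_path_reverse:
  "measure_pmf.prob (path_pmf n) {(Y, xs). Y \<in> A \<and> run v \<Lambda> Y xs \<in> B} =
   measure_pmf.prob (path_pmf n) {(Y, xs). Y \<in> B \<and> run v \<Lambda> Y xs \<in> A}"
proof -
  define J where "J = map_pmf (\<lambda>(Y, xs). (Y, run v \<Lambda> Y xs)) (path_pmf n)"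
  have J: "J = bind_pmf conditioned (\<lambda>Y. map_pmf (Pair Y) (kern n Y))"
    by (simp add: J_def path_pmf_def kern_def pair_pmf_def map_pmf_def bind_assoc_pmf bind_return_pmf)
  have pmf_J: "pmf J (Y, Z) = pmf conditioned Y * pmf (kern n Y) Z" for Y Z
  proof -
    have one: "pmf (map_pmf (Pair W) (kern n W)) (Y, Z) = (if W = Y then pmf (kern n Y) Z else 0)" for W
    proof (cases "W = Y")
      case True
      then show ?thesis using pmf_map_inj'[of "Pair Y" "kern n Y" Z] by (simp add: inj_on_def)
    next
      case False
      then have "(Y, Z) \<notin> set_pmf (map_pmf (Pair W) (kern n W))" by auto
      then show ?thesis using False by (simp add: pmf_eq_0_set_pmf)
    qed
    have "pmf J (Y, Z) = (\<Sum>W\<in>D. pmf conditioned W * pmf (map_pmf (Pair W) (kern n W)) (Y, Z))"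
      unfolding J by (rule pmf_bind_finite[OF finD]) (simp add: set_conditioned)
    also have "\<dots> = (\<Sum>W\<in>D. if W = Y then pmf conditioned Y * pmf (kern n Y) Z else 0)"
      unfolding one by (intro sum.cong) auto
    also have "\<dots> = pmf conditioned Y * pmf (kern n Y) Z"
      using finD by (simp add: conditioned_outside)
    finally show ?thesis .
  qed
  have sym: "map_pmf prod.swap J = J"
  proof (rule pmf_eqI)
    fix z :: "'d config \<times> 'd config"
    obtain Y Z where z: "z = (Y, Z)" by (cases z)
    have "pmf (map_pmf prod.swap J) (prod.swap (Z, Y)) = pmf J (Z, Y)"
      by (rule pmf_map_inj') simp
    also have "\<dots> = pmf J (Y, Z)"
      unfolding pmf_J using balance_kern[of Y Z n] kern_outside conditioned_outside
      by (cases "Y \<in> D"; cases "Z \<in> D") simp_all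
    finally show "pmf (map_pmf prod.swap J) z = pmf J z" by (simp add: z)
  qed
  have *: "measure_pmf.prob (path_pmf n) {(Y, xs). Y \<in> A \<and> run v \<Lambda> Y xs \<in> B} = measure_pmf.prob J (A \<times> B)" for A B
    unfolding J_def measure_map_pmf by (intro arg_cong2[where f = measure_pmf.prob]) auto
  have "measure_pmf.prob J (A \<times> B) = measure_pmf.prob (map_pmf prod.swap J) (A \<times> B)" by (simp add: sym)
  also have "\<dots> = measure_pmf.prob J (B \<times> A)"
    unfolding measure_map_pmf by (intro arg_cong2[where f = measure_pmf.prob]) auto
  finally show ?thesis by (simp add: *)
qed

lemma replicate_pmf_add_map:
  "map_pmf (\<lambda>xs. f (take m xs) (drop m xs)) (replicate_pmf (m + n) q') =
   map_pmf (\<lambda>(xs, ys). f xs ys) (pair_pmf (replicate_pmf m q') (replicate_pmf n q'))"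
  unfolding replicate_pmf_distrib pair_pmf_def map_pmf_def bind_assoc_pmf bind_return_pmf
  by (intro bind_pmf_cong refl) (simp add: set_replicate_pmf)

lemma path_take: "map_pmf (\<lambda>(Y, xs). (Y, take m xs)) (path_pmf (m + n)) = path_pmf m"
proof -
  have "map_pmf (take m) (replicate_pmf (m + n) noise) = replicate_pmf m noise"
  proof -
    have "(\<lambda>(xs, ys). xs) = (fst :: ('d edge \<times> bool) list \<times> ('d edge \<times> bool) list \<Rightarrow> ('d edge \<times> bool) list)" by auto
    then show ?thesis
      using replicate_pmf_add_map[of "\<lambda>xs ys. xs" m n noise] map_fst_pair_pmf by simp
  qed
  then show ?thesis
    unfolding path_pmf_def using pair_map_pmf2[of conditioned "take m" "replicate_pmf (m + n) noise"]
    by (simp add: apsnd_def map_prod_def id_def split_beta)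
qed

lemma path_drop: "map_pmf (\<lambda>(Y, xs). (run v \<Lambda> Y (take m xs), drop m xs)) (path_pmf (m + n)) = path_pmf n"
proof -
  have "map_pmf (\<lambda>(Y, xs). (run v \<Lambda> Y (take m xs), drop m xs)) (path_pmf (m + n)) =
      bind_pmf conditioned (\<lambda>Y. map_pmf (\<lambda>xs. (run v \<Lambda> Y (take m xs), drop m xs)) (replicate_pmf (m + n) noise))"
    by (simp add: path_pmf_def pair_pmf_def map_pmf_def bind_assoc_pmf bind_return_pmf)
  also have "\<dots> = bind_pmf conditioned (\<lambda>Y. map_pmf (\<lambda>(xs, ys). (run v \<Lambda> Y xs, ys))
      (pair_pmf (replicate_pmf m noise) (replicate_pmf n noise)))"
    using replicate_pmf_add_map[where f = "\<lambda>xs ys. (run v \<Lambda> Y xs, ys)" for Y] by simp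
  also have "\<dots> = pair_pmf (bind_pmf conditioned (kern m)) (replicate_pmf n noise)"
    by (simp add: kern_def pair_pmf_def map_pmf_def bind_assoc_pmf bind_return_pmf)
  finally show ?thesis by (simp add: conditioned_kern path_pmf_def)
qed

lemma prob_path_take:
  "measure_pmf.prob (path_pmf (m + n)) {(Y, xs). P Y (take m xs)} = measure_pmf.prob (path_pmf m) {(Y, xs). P Y xs}"
  unfolding path_take[of m n, symmetric] measure_map_pmf
  by (intro arg_cong2[where f = measure_pmf.prob]) auto

lemma prob_path_drop:
  "measure_pmf.prob (path_pmf (m + n)) {(Y, xs). P (run v \<Lambda> Y (take m xs)) (drop m xs)} =
   measure_pmf.prob (path_pmf n) {(Y, xs). P Y xs}"
  unfolding path_drop[of m n, symmetric] measure_map_pmf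
  by (intro arg_cong2[where f = measure_pmf.prob]) auto

section \<open>Speed of the pivotal edges\<close>

text \<open>A pivotal edge at depth \<open>\<delta>\<close> is the end of a cheap path of diameter about \<open>\<delta>\<close>, and each
  step of this path has length at most 2, so it contains a chain of \<open>k\<close> cheap edges.\<close>

lemma prob_invasion_one_window:
  assumes inside: "\<And>w. w \<notin> \<Lambda> \<Longrightarrow> \<rho> \<le> dist x w" and \<delta>: "\<delta> \<ge> 2 * real k + 5" and n: "n \<le> N"
  shows "measure_pmf.prob (path_pmf n)
    {(Y, xs). pivotal_free v \<Lambda> x \<rho> Y \<and> \<not> pivotal_free v \<Lambda> x (\<rho> - \<delta>) (run v \<Lambda> Y xs)} \<le> N * \<alpha> ^ k"
proof -
  let ?Ch = "{(Y, xs). \<exists>a\<in>E. \<exists>fs. length fs = k \<and> distinct fs \<and>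
      successively adj (a # fs) \<and> (\<forall>f\<in>set fs. cheap v \<Lambda> Y xs f)}"
  have "measure_pmf.prob (path_pmf n)
    {(Y, xs). pivotal_free v \<Lambda> x \<rho> Y \<and> \<not> pivotal_free v \<Lambda> x (\<rho> - \<delta>) (run v \<Lambda> Y xs)} \<le> measure_pmf.prob (path_pmf n) ?Ch"
  proof (rule prob_mono_on_support, clarify)
    fix Y xs
    assume "(Y, xs) \<in> set_pmf (path_pmf n)" and free: "pivotal_free v \<Lambda> x \<rho> Y"
      and nfree: "\<not> pivotal_free v \<Lambda> x (\<rho> - \<delta>) (run v \<Lambda> Y xs)"
    then have Y: "Y \<in> D" and xs: "fst ` set xs \<subseteq> E" using set_path by auto
    let ?P = "\<lambda>t f. f \<in> pivotal v \<Lambda> (run v \<Lambda> Y (take t xs))"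
    obtain f u where f: "?P (length xs) f" and u: "u \<in> f" "dist x u < \<rho> - \<delta>"
      using nfree by (auto simp: pivotal_free_def not_le)
    define t where "t = (LEAST t. ?P t f)"
    have t: "?P t f" "t \<le> length xs" unfolding t_def using f by (rule LeastI, rule Least_le)
    have first: "\<not> ?P s f" if "s < t" for s using that unfolding t_def by (rule not_less_Least)
    have fE: "f \<in> E" using f by (simp add: pivotal_def)
    have "\<exists>y\<in>f. dist x y < \<rho>" using u \<delta> by force
    from cheap_path_outwards[OF box d2 Y xs free inside t(2,1) first this]
    obtain g y where g: "(f, g) \<in> {(a, b). adj a b \<and> cheap v \<Lambda> Y xs b}\<^sup>*" "y \<in> g" "\<rho> - 3 \<le> dist x y"
      by blast
    have far: "dist u y > 2 * real k" "dist u y > 1"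
      using g(3) u(2) \<delta> dist_triangle[of x y u] by linarith+
    have "\<exists>fs. length fs = k \<and> distinct (f # fs) \<and> successively adj (f # fs) \<and>
        (\<forall>h\<in>set fs. cheap v \<Lambda> Y xs h \<and> h \<noteq> {})"
    proof (rule long_chain[OF g(1) _ u(1) g(2) far])
      show "adj a b \<and> b \<noteq> {} \<and> cheap v \<Lambda> Y xs b" if "(a, b) \<in> {(a, b). adj a b \<and> cheap v \<Lambda> Y xs b}" for a b
        using that edges_in_props(1)[OF box, of b] by (auto simp: cheap_def)
      show "dist u z \<le> 1" if "z \<in> f" for z
        using edges_in_props(3)[OF box fE u(1) that] .
    qed
    then show "\<exists>a\<in>E. \<exists>fs. length fs = k \<and> distinct fs \<and> successively adj (a # fs) \<and> (\<forall>f\<in>set fs. cheap v \<Lambda> Y xs f)"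
      using fE by (intro bexI[of _ f]) auto
  qed
  also have "\<dots> \<le> N * \<alpha> ^ k" by (rule prob_cheap_chain[OF n])
  finally show ?thesis .
qed

text \<open>Stationarity allows the one-window bound to be applied afresh at the start of each window, to the
  ball that is still free then.\<close>

lemma prob_invasion:
  assumes inside: "\<And>w. w \<notin> \<Lambda> \<Longrightarrow> R \<le> dist x w" and \<delta>: "\<delta> \<ge> 2 * real k + 5" and j: "j \<le> i * N"
  shows "measure_pmf.prob (path_pmf j)
    {(Y, xs). pivotal_free v \<Lambda> x R Y \<and> \<not> pivotal_free v \<Lambda> x (R - real i * \<delta>) (run v \<Lambda> Y xs)} \<le> real i * (N * \<alpha> ^ k)"
  using j
proof (induction i arbitrary: j)
  case 0
  have "measure_pmf.prob (path_pmf 0) {(Y, xs). pivotal_free v \<Lambda> x R Y \<and> \<not> pivotal_free v \<Lambda> x R (run v \<Lambda> Y xs)} \<le>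
      measure_pmf.prob (path_pmf 0) {}"
    by (rule prob_mono_on_support) (auto dest: set_path)
  then show ?case using 0 by simp
next
  case (Suc i)
  \<comment> \<open>Cut off the last window. The truncated subtraction covers \<open>j < N\<close>, where \<open>m = 0\<close>.\<close>
  define m where "m = j - N"
  define n where "n = j - m"
  have jmn: "j = m + n" "m \<le> i * N" "n \<le> N" using Suc.prems by (auto simp: m_def n_def)
  let ?F = "\<lambda>i. pivotal_free v \<Lambda> x (R - real i * \<delta>)"
  let ?A = "{(Y, xs). ?F 0 Y \<and> \<not> ?F i (run v \<Lambda> Y (take m xs))}"
  let ?B = "{(Y, xs). ?F i (run v \<Lambda> Y (take m xs)) \<and>
    \<not> pivotal_free v \<Lambda> x (R - real i * \<delta> - \<delta>) (run v \<Lambda> (run v \<Lambda> Y (take m xs)) (drop m xs))}"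
  have "measure_pmf.prob (path_pmf j) {(Y, xs). pivotal_free v \<Lambda> x R Y \<and> \<not> ?F (Suc i) (run v \<Lambda> Y xs)} \<le>
      measure_pmf.prob (path_pmf j) (?A \<union> ?B)"
  proof (rule measure_pmf.finite_measure_mono)
    have "run v \<Lambda> (run v \<Lambda> Y (take m xs)) (drop m xs) = run v \<Lambda> Y xs" for Y xs
      unfolding foldl_append[symmetric] append_take_drop_id ..
    then show "{(Y, xs). pivotal_free v \<Lambda> x R Y \<and> \<not> ?F (Suc i) (run v \<Lambda> Y xs)} \<subseteq> ?A \<union> ?B"
      by (auto simp: algebra_simps)
  qed simp
  also have "\<dots> \<le> measure_pmf.prob (path_pmf j) ?A + measure_pmf.prob (path_pmf j) ?B"
    by (rule measure_Un_le) auto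
  also have "measure_pmf.prob (path_pmf j) ?A = measure_pmf.prob (path_pmf m) {(Y, xs). ?F 0 Y \<and> \<not> ?F i (run v \<Lambda> Y xs)}"
    unfolding jmn(1) by (rule prob_path_take)
  also have "measure_pmf.prob (path_pmf j) ?B = measure_pmf.prob (path_pmf n)
      {(Y, xs). ?F i Y \<and> \<not> pivotal_free v \<Lambda> x (R - real i * \<delta> - \<delta>) (run v \<Lambda> Y xs)}"
    unfolding jmn(1) by (rule prob_path_drop)
  finally have "measure_pmf.prob (path_pmf j) {(Y, xs). pivotal_free v \<Lambda> x R Y \<and> \<not> ?F (Suc i) (run v \<Lambda> Y xs)} \<le>
      measure_pmf.prob (path_pmf m) {(Y, xs). ?F 0 Y \<and> \<not> ?F i (run v \<Lambda> Y xs)} +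
      measure_pmf.prob (path_pmf n) {(Y, xs). ?F i Y \<and> \<not> pivotal_free v \<Lambda> x (R - real i * \<delta> - \<delta>) (run v \<Lambda> Y xs)}" .
  moreover have "measure_pmf.prob (path_pmf m) {(Y, xs). ?F 0 Y \<and> \<not> ?F i (run v \<Lambda> Y xs)} \<le> real i * (N * \<alpha> ^ k)"
    using Suc.IH[OF jmn(2)] by simp
  moreover have "measure_pmf.prob (path_pmf n)
      {(Y, xs). ?F i Y \<and> \<not> pivotal_free v \<Lambda> x (R - real i * \<delta> - \<delta>) (run v \<Lambda> Y xs)} \<le> N * \<alpha> ^ k"
  proof (rule prob_invasion_one_window[OF _ \<delta> jmn(3)])
    show "R - real i * \<delta> \<le> dist x w" if "w \<notin> \<Lambda>" for w
    proof -
      have "0 \<le> real i * \<delta>" using \<delta> by simp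
      then show ?thesis using inside[OF that] by linarith
    qed
  qed
  ultimately show ?case by (simp add: algebra_simps)
qed

text \<open>By reversibility, having the pivotal edge \<open>e\<close> at time \<open>u\<close> and a ball free of pivotal edges
  around it at the final time is as unlikely as starting with a free ball and seeing \<open>e\<close> become
  pivotal, which is an invasion to the centre.\<close>

lemma prob_pivotal_then_free:
  assumes inside: "\<And>w. w \<notin> \<Lambda> \<Longrightarrow> R \<le> dist x w" and \<delta>: "\<delta> \<ge> 2 * real k + 5"
    and x: "x \<in> e" and R: "real m * \<delta> < R"
  shows "measure_pmf.prob (path_pmf (m * N))
    {(Y, xs). (\<exists>u\<le>m * N. e \<in> pivotal v \<Lambda> (run v \<Lambda> Y (take u xs))) \<and> pivotal_free v \<Lambda> x R (run v \<Lambda> Y xs)}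
    \<le> real (m * N + 1) * (real m * (N * \<alpha> ^ k))"
proof -
  let ?M = "m * N"
  let ?S = "\<lambda>u. {(Y, xs). e \<in> pivotal v \<Lambda> (run v \<Lambda> Y (take u xs)) \<and> pivotal_free v \<Lambda> x R (run v \<Lambda> Y xs)}"
  have "measure_pmf.prob (path_pmf ?M)
    {(Y, xs). (\<exists>u\<le>?M. e \<in> pivotal v \<Lambda> (run v \<Lambda> Y (take u xs))) \<and> pivotal_free v \<Lambda> x R (run v \<Lambda> Y xs)}
    \<le> measure_pmf.prob (path_pmf ?M) (\<Union>u\<in>{..?M}. ?S u)"
    by (rule measure_pmf.finite_measure_mono) auto
  also have "\<dots> \<le> real (card {..?M}) * (real m * (N * \<alpha> ^ k))"
  proof (rule prob_UN_le)
    fix u assume "u \<in> {..?M}"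
    then have u: "?M = u + (?M - u)" "?M - u \<le> ?M" by auto
    have "measure_pmf.prob (path_pmf ?M) (?S u) = measure_pmf.prob (path_pmf (u + (?M - u)))
      {(Y, xs). e \<in> pivotal v \<Lambda> (run v \<Lambda> Y (take u xs)) \<and>
        pivotal_free v \<Lambda> x R (run v \<Lambda> (run v \<Lambda> Y (take u xs)) (drop u xs))}"
      unfolding foldl_append[symmetric] append_take_drop_id u(1)[symmetric] ..
    also have "\<dots> = measure_pmf.prob (path_pmf (?M - u))
      {(Y, xs). Y \<in> {Y. e \<in> pivotal v \<Lambda> Y} \<and> run v \<Lambda> Y xs \<in> {Y. pivotal_free v \<Lambda> x R Y}}"
      unfolding mem_Collect_eq by (rule prob_path_drop)
    also have "\<dots> = measure_pmf.prob (path_pmf (?M - u))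
      {(Y, xs). Y \<in> {Y. pivotal_free v \<Lambda> x R Y} \<and> run v \<Lambda> Y xs \<in> {Y. e \<in> pivotal v \<Lambda> Y}}"
      by (rule prob_path_reverse)
    also have "\<dots> \<le> measure_pmf.prob (path_pmf (?M - u))
      {(Y, xs). pivotal_free v \<Lambda> x R Y \<and> \<not> pivotal_free v \<Lambda> x (R - real m * \<delta>) (run v \<Lambda> Y xs)}"
    proof (rule measure_pmf.finite_measure_mono, clarify)
      fix Y xs assume "e \<in> pivotal v \<Lambda> (run v \<Lambda> Y xs)" "pivotal_free v \<Lambda> x (R - real m * \<delta>) (run v \<Lambda> Y xs)"
      then have "R - real m * \<delta> \<le> dist x x" using x unfolding pivotal_free_def by blast
      then show False using R by simp
    qed simp
    also have "\<dots> \<le> real m * (N * \<alpha> ^ k)" by (rule prob_invasion[OF inside \<delta> u(2)])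
    finally show "measure_pmf.prob (path_pmf ?M) (?S u) \<le> real m * (N * \<alpha> ^ k)" .
  qed simp
  finally show ?thesis by simp
qed

definition isolated :: "real \<Rightarrow> 'd config \<Rightarrow> 'd edge \<Rightarrow> bool" where
  "isolated R Y e \<longleftrightarrow> R \<le> setdist (segment e) (- \<Lambda> \<union> (\<Union>f\<in>pivotal v \<Lambda> Y - {e}. segment f))"

lemma isolatedD:
  assumes "isolated R Y e" "x \<in> e"
  shows "w \<notin> \<Lambda> \<Longrightarrow> R \<le> dist x w"
    and "f \<in> pivotal v \<Lambda> Y \<Longrightarrow> f \<noteq> e \<Longrightarrow> y \<in> f \<Longrightarrow> R \<le> dist x y"
proof -
  have x: "x \<in> segment e" using assms(2) by (rule hull_inc)
  have le: "R \<le> dist x z" if "z \<in> - \<Lambda> \<union> (\<Union>f\<in>pivotal v \<Lambda> Y - {e}. segment f)" for z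
    using assms(1) setdist_le_dist[OF x that] unfolding isolated_def by linarith
  show "R \<le> dist x w" if "w \<notin> \<Lambda>" using that by (intro le) simp
  show "R \<le> dist x y" if "f \<in> pivotal v \<Lambda> Y" "f \<noteq> e" "y \<in> f"
  proof (rule le)
    have "y \<in> segment f" using that(3) by (rule hull_inc)
    then show "y \<in> - \<Lambda> \<union> (\<Union>f\<in>pivotal v \<Lambda> Y - {e}. segment f)" using that by blast
  qed
qed

text \<open>From an isolated pivotal edge a long chain of closed edges starts, and none of the next
  \<open>k\<close> edges of the chain is pivotal. With no inputs at all, cheap means closed and nonpivotal.\<close>

lemma prob_isolated_pivotal:
  assumes R: "R > 2 * real k + 2"
  shows "measure_pmf.prob conditioned {Y. \<exists>e\<in>pivotal v \<Lambda> Y. isolated R Y e} \<le> N * \<alpha> ^ k"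
proof -
  let ?Ch = "{(Y, xs). \<exists>a\<in>E. \<exists>fs. length fs = k \<and> distinct fs \<and>
      successively adj (a # fs) \<and> (\<forall>f\<in>set fs. cheap v \<Lambda> Y xs f)}"
  have "measure_pmf.prob conditioned {Y. \<exists>e\<in>pivotal v \<Lambda> Y. isolated R Y e} \<le>
      measure_pmf.prob conditioned ((\<lambda>Y. (Y, [])) -` ?Ch)"
  proof (rule prob_mono_on_support)
    fix Y assume "Y \<in> set_pmf conditioned" "Y \<in> {Y. \<exists>e\<in>pivotal v \<Lambda> Y. isolated R Y e}"
    then obtain e where dis: "\<not> top_bottom_connected v \<Lambda> Y" and e: "e \<in> pivotal v \<Lambda> Y" "isolated R Y e"
      by (auto simp: set_conditioned disconnected_configs_def)
    have eE: "e \<in> E" using e by (simp add: pivotal_def)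
    obtain x where x: "x \<in> e" using edges_in_props(1)[OF box eE] by blast
    obtain g u w where g: "(e, g) \<in> (closed_adj \<Lambda> Y)\<^sup>*" "u \<in> g" "w \<notin> \<Lambda>" "dist u w \<le> 1"
      using pivotal_chain_to_boundary[OF box d2 dis e(1)] by blast
    have "R \<le> dist x w" using isolatedD(1)[OF e(2) x g(3)] .
    then have far: "dist x u > 2 * real k" "dist x u > 1"
      using g(4) R dist_triangle[of x w u] by linarith+
    have "\<exists>fs. length fs = k \<and> distinct (e # fs) \<and> successively adj (e # fs) \<and>
        (\<forall>f\<in>set fs. (f \<in> E \<and> \<not> Y f) \<and> f \<noteq> {})"
    proof (rule long_chain[OF g(1) _ x g(2) far])
      show "adj a b \<and> b \<noteq> {} \<and> (b \<in> E \<and> \<not> Y b)" if "(a, b) \<in> closed_adj \<Lambda> Y" for a b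
        using that edges_in_props(1)[OF box, of b] by (auto simp: closed_adj_def)
      show "dist x z \<le> 1" if "z \<in> e" for z
        using edges_in_props(3)[OF box eE x that] .
    qed
    then obtain fs where fs: "length fs = k" "distinct (e # fs)" "successively adj (e # fs)"
      "\<forall>f\<in>set fs. (f \<in> E \<and> \<not> Y f) \<and> f \<noteq> {}" by blast
    have "cheap v \<Lambda> Y [] f" if f: "f \<in> set fs" for f
    proof -
      obtain y where y: "y \<in> f" using fs(4) f by blast
      have "dist x y \<le> 2 * real k"
        using adj_chain_dist[OF fs(3) x f y] fs(1,4) by auto
      then have "f \<notin> pivotal v \<Lambda> Y"
        using isolatedD(2)[OF e(2) x _ _ y] fs(2) f R by fastforce
      then show ?thesis using fs(4) f by (simp add: cheap_def)
    qed
    then show "Y \<in> (\<lambda>Y. (Y, [])) -` ?Ch" using fs eE by auto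
  qed
  also have "\<dots> = measure_pmf.prob (path_pmf 0) ?Ch"
  proof -
    have "path_pmf 0 = map_pmf (\<lambda>Y. (Y, [])) conditioned"
      by (simp add: path_pmf_def pair_return_pmf2)
    then show ?thesis by (simp only: measure_map_pmf)
  qed
  also have "\<dots> \<le> N * \<alpha> ^ k" by (rule prob_cheap_chain) simp
  finally show ?thesis .
qed

section \<open>Isolated edges at equilibrium\<close>

definition joint_update :: "'d config \<times> 'd config \<Rightarrow> 'd edge \<times> bool \<Rightarrow> 'd config \<times> 'd config" where
  "joint_update s x = ((fst s)(fst x := snd x), update v \<Lambda> (snd s) x)"

lemma coupling_step_eq: "coupling_step v \<Lambda> p s = map_pmf (joint_update s) noise"
  by (cases s) (simp add: coupling_step_def noise_def pair_pmf_def map_pmf_def bind_assoc_pmf bind_return_pmf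
      joint_update_def update_def)

lemma snd_joint_run: "snd (foldl joint_update s xs) = run v \<Lambda> (snd s) xs"
  by (induction xs arbitrary: s) (simp_all add: joint_update_def)

lemma fst_joint_run: "e \<notin> fst ` set xs \<Longrightarrow> fst (foldl joint_update s xs) e = fst s e"
  by (induction xs arbitrary: s) (auto simp: joint_update_def)

lemma run_close_edges:
  "run v \<Lambda> Y (map (\<lambda>e. (e, False)) es) = (\<lambda>e. if e \<in> set es then False else Y e)"
  by (induction es arbitrary: Y) (auto simp: update_def fun_eq_iff)

lemma funpow_step: "((\<lambda>\<mu>. bind_pmf \<mu> step_pmf) ^^ n) (return_pmf Y) = kern n Y"
  by (induction n) (simp_all add: kern_0 kern_Suc_right)

text \<open>The second coordinate is itself a Markov chain. It has only one stationary law, because the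
  sequence of inputs that closes the edges one after the other leads to the same configuration from
  everywhere.\<close>

lemma marginal_equilibrium:
  assumes "is_equilibrium v \<Lambda> p \<mu>"
  shows "map_pmf snd \<mu> = conditioned"
proof -
  have "\<exists>!\<nu>. set_pmf \<nu> \<subseteq> D \<and> bind_pmf \<nu> step_pmf = \<nu>"
  proof (rule markov_ex1_stationary[OF finD all_closed_disconnected])
    show "set_pmf (step_pmf Y) \<subseteq> D" if "Y \<in> D" for Y by (rule set_step[OF that])
    fix Y assume Y: "Y \<in> D"
    obtain es where es: "set es = E" "distinct es" using finite_distinct_list[OF finE] by blast
    have len: "length es = N" using distinct_card[OF es(2)] es(1) by simp
    let ?xs = "map (\<lambda>e. (e, False)) es"
    have xs: "?xs \<in> set_pmf (replicate_pmf N noise)"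
      unfolding set_replicate_pmf set_noise in_lists_conv_set mem_Collect_eq
    proof (intro conjI ballI)
      show "x \<in> E \<times> UNIV" if "x \<in> set ?xs" for x
        using that unfolding set_map es(1) by (elim imageE) simp
      show "length ?xs = N" by (simp only: length_map len)
    qed
    have "(\<lambda>e\<in>E. False) = run v \<Lambda> Y ?xs"
    proof (rule ext)
      fix e
      have "Y e = undefined" if "e \<notin> E"
        using Y that by (simp add: disconnected_configs_def configs_def PiE_def extensional_def)
      then show "(\<lambda>e\<in>E. False) e = run v \<Lambda> Y ?xs e" by (simp add: run_close_edges es(1))
    qed
    then show "(\<lambda>e\<in>E. False) \<in> set_pmf (((\<lambda>\<mu>. bind_pmf \<mu> step_pmf) ^^ N) (return_pmf Y))"
      unfolding funpow_step kern_def set_map_pmf using xs by (rule image_eqI)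
  qed
  then obtain \<nu> where unique: "\<And>\<nu>'. set_pmf \<nu>' \<subseteq> D \<Longrightarrow> bind_pmf \<nu>' step_pmf = \<nu>' \<Longrightarrow> \<nu>' = \<nu>"
    by (elim ex1E) blast
  have "set_pmf (map_pmf snd \<mu>) \<subseteq> D"
    using assms by (auto simp: is_equilibrium_def coupled_states_def disconnected_configs_def)
  moreover have "bind_pmf (map_pmf snd \<mu>) step_pmf = map_pmf snd \<mu>"
  proof -
    have "map_pmf snd (coupling_step v \<Lambda> p s) = step_pmf (snd s)" for s
      by (simp add: coupling_step_eq map_pmf_comp joint_update_def)
    then have "bind_pmf (map_pmf snd \<mu>) step_pmf = map_pmf snd (bind_pmf \<mu> (coupling_step v \<Lambda> p))"
      by (simp add: bind_map_pmf map_bind_pmf)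
    then show ?thesis using assms by (simp add: is_equilibrium_def)
  qed
  ultimately have "map_pmf snd \<mu> = \<nu>" by (rule unique)
  moreover have "conditioned = \<nu>" using set_conditioned conditioned_step by (intro unique) auto
  ultimately show ?thesis by simp
qed

text \<open>At the last update of an interface edge the input was to open it and only the first coordinate
  followed, so it was pivotal for the second one.\<close>

lemma interface_was_pivotal:
  assumes e: "e \<in> fst ` set xs" and I: "e \<in> interface \<Lambda> (fst (foldl joint_update s xs)) (snd (foldl joint_update s xs))"
  shows "\<exists>u\<le>length xs. e \<in> pivotal v \<Lambda> (run v \<Lambda> (snd s) (take u xs))"
proof -
  obtain as b bs where xs: "xs = as @ (e, b) # bs" "e \<notin> fst ` set bs"
    using e by (rule split_at_last_occurrence)
  have eE: "e \<in> E" using I by (simp add: interface_def)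
  have "fst (foldl joint_update s xs) e = b"
    using fst_joint_run[OF xs(2)] by (simp add: xs(1) joint_update_def)
  moreover have "snd (foldl joint_update s xs) e = (b \<and> e \<notin> pivotal v \<Lambda> (run v \<Lambda> (snd s) as))"
    unfolding snd_joint_run using run_other[OF xs(2)] eE by (simp add: xs(1) update_eq)
  ultimately have "e \<in> pivotal v \<Lambda> (run v \<Lambda> (snd s) as)" using I by (auto simp: interface_def)
  then show ?thesis by (intro exI[of _ "length as"]) (simp add: xs(1))
qed

lemma prob_edge_not_updated:
  assumes e: "e \<in> E"
  shows "measure_pmf.prob (replicate_pmf n noise) {xs. \<forall>x\<in>set xs. fst x \<noteq> e} = (1 - 1 / N) ^ n"
proof -
  have "measure_pmf.prob noise {x. fst x \<noteq> e} = measure_pmf.prob (map_pmf fst noise) {e'. e' \<noteq> e}"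
    unfolding measure_map_pmf by (intro arg_cong2[where f = measure_pmf.prob]) auto
  also have "map_pmf fst noise = pmf_of_set E" by (simp add: noise_def map_fst_pair_pmf)
  also have "measure_pmf.prob (pmf_of_set E) {e'. e' \<noteq> e} = real (card (E \<inter> {e'. e' \<noteq> e})) / N"
    by (rule measure_pmf_of_set[OF E_ne finE])
  also have "E \<inter> {e'. e' \<noteq> e} = E - {e}" by auto
  also have "real (card (E - {e})) / N = 1 - 1 / N"
    using e finE N_pos by (simp add: card_Diff_singleton of_nat_diff Suc_leI diff_divide_distrib E_ne)
  finally show ?thesis by (simp add: prob_replicate_all)
qed

text \<open>Look at the equilibrium as the state at time \<open>m * N\<close> of a stationary evolution. An isolated
  edge of the interface or of the set of pivotal edges is pivotal now; or it has not been updated at all;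
  or it was pivotal at its last update and now has a ball free of pivotal edges around it. The three
  terms bound these cases.\<close>

lemma prob_equilibrium_isolated:
  assumes \<delta>: "\<delta> \<ge> 2 * real k + 5" and R: "real m * \<delta> < R" "R > 2 * real k + 2"
  shows "measure_pmf.prob (equilibrium v \<Lambda> p) {(X, Y). \<exists>e\<in>pivotal v \<Lambda> Y \<union> interface \<Lambda> X Y. isolated R Y e}
    \<le> N * \<alpha> ^ k + N * (1 - 1 / N) ^ (m * N) + N * (real (m * N + 1) * (real m * (N * \<alpha> ^ k)))"
proof -
  define \<mu> where "\<mu> = equilibrium v \<Lambda> p"
  define M where "M = m * N"
  have eq: "is_equilibrium v \<Lambda> p \<mu>" unfolding \<mu>_def by (rule is_equilibrium_equilibrium[OF box p0 p1])
  have marg: "map_pmf snd \<mu> = conditioned" by (rule marginal_equilibrium[OF eq])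
  define \<Omega> where "\<Omega> = pair_pmf \<mu> (replicate_pmf M noise)"
  have "bind_pmf \<mu> (\<lambda>s. map_pmf (joint_update s) noise) = \<mu>"
    using eq by (simp add: is_equilibrium_def flip: coupling_step_eq)
  then have \<mu>\<Omega>: "\<mu> = map_pmf (\<lambda>(s, xs). foldl joint_update s xs) \<Omega>"
    unfolding \<Omega>_def by (rule stationary_iterate[symmetric])
  have \<Omega>_path: "map_pmf (\<lambda>(s, xs). (snd s, xs)) \<Omega> = path_pmf M"
    unfolding \<Omega>_def path_pmf_def marg[symmetric] pair_map_pmf1 by (intro map_pmf_cong refl) auto
  let ?P1 = "{(X, Y). \<exists>e\<in>pivotal v \<Lambda> Y. isolated R Y e}"
  let ?P2 = "{(X, Y). \<exists>e\<in>interface \<Lambda> X Y - pivotal v \<Lambda> Y. isolated R Y e}"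
  have "measure_pmf.prob \<mu> {(X, Y). \<exists>e\<in>pivotal v \<Lambda> Y \<union> interface \<Lambda> X Y. isolated R Y e} \<le>
      measure_pmf.prob \<mu> (?P1 \<union> ?P2)"
    by (rule measure_pmf.finite_measure_mono) auto
  also have "\<dots> \<le> measure_pmf.prob \<mu> ?P1 + measure_pmf.prob \<mu> ?P2"
    by (rule measure_Un_le) auto
  finally have split: "measure_pmf.prob \<mu> {(X, Y). \<exists>e\<in>pivotal v \<Lambda> Y \<union> interface \<Lambda> X Y. isolated R Y e} \<le>
      measure_pmf.prob \<mu> ?P1 + measure_pmf.prob \<mu> ?P2" .
  have P1: "measure_pmf.prob \<mu> ?P1 \<le> N * \<alpha> ^ k"
  proof -
    have "measure_pmf.prob \<mu> ?P1 = measure_pmf.prob (map_pmf snd \<mu>) {Y. \<exists>e\<in>pivotal v \<Lambda> Y. isolated R Y e}"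
      unfolding measure_map_pmf by (intro arg_cong2[where f = measure_pmf.prob]) auto
    then show ?thesis using prob_isolated_pivotal[OF R(2)] by (simp add: marg)
  qed
  define pt where "pt e = (SOME x. x \<in> e)" for e :: "'d edge"
  have pt: "pt e \<in> e" if "e \<in> E" for e
    unfolding pt_def using edges_in_props(1)[OF box that] by (simp add: some_in_eq)
  define E' where "E' = {e \<in> E. \<forall>w. w \<notin> \<Lambda> \<longrightarrow> R \<le> dist (pt e) w}"
  let ?Q1 = "\<Union>e\<in>E. UNIV \<times> {xs. \<forall>x\<in>set xs. fst x \<noteq> e}"
  let ?Q2 = "\<Union>e\<in>E'. {(s, xs). (\<exists>u\<le>M. e \<in> pivotal v \<Lambda> (run v \<Lambda> (snd s) (take u xs))) \<and>
      pivotal_free v \<Lambda> (pt e) R (run v \<Lambda> (snd s) xs)}"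
  have P2: "measure_pmf.prob \<mu> ?P2 \<le> measure_pmf.prob \<Omega> ?Q1 + measure_pmf.prob \<Omega> ?Q2"
  proof -
    have "measure_pmf.prob \<mu> ?P2 = measure_pmf.prob \<Omega> ((\<lambda>(s, xs). foldl joint_update s xs) -` ?P2)"
      by (subst \<mu>\<Omega>) (rule measure_map_pmf)
    also have "\<dots> \<le> measure_pmf.prob \<Omega> (?Q1 \<union> ?Q2)"
    proof (rule prob_mono_on_support)
      fix z assume z: "z \<in> set_pmf \<Omega>" "z \<in> (\<lambda>(s, xs). foldl joint_update s xs) -` ?P2"
      obtain s xs where sxs: "z = (s, xs)" by (cases z)
      have len: "length xs = M" using z(1) by (auto simp: sxs \<Omega>_def set_replicate_pmf)
      let ?X = "fst (foldl joint_update s xs)" and ?Y = "snd (foldl joint_update s xs)"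
      have "(?X, ?Y) \<in> ?P2" using z(2) by (simp add: sxs)
      then obtain e where e: "e \<in> interface \<Lambda> ?X ?Y" "e \<notin> pivotal v \<Lambda> ?Y" "isolated R ?Y e"
        by auto
      have eE: "e \<in> E" using e(1) by (simp add: interface_def)
      show "z \<in> ?Q1 \<union> ?Q2"
      proof (cases "e \<in> fst ` set xs")
        case False
        then have "z \<in> ?Q1" using eE by (force simp: sxs)
        then show ?thesis by blast
      next
        case True
        obtain u where u: "u \<le> M" "e \<in> pivotal v \<Lambda> (run v \<Lambda> (snd s) (take u xs))"
          using interface_was_pivotal[OF True e(1)] len by blast
        have "e \<in> E'" using isolatedD(1)[OF e(3) pt[OF eE]] eE by (simp add: E'_def)
        moreover have "pivotal_free v \<Lambda> (pt e) R ?Y"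
          unfolding pivotal_free_def using isolatedD(2)[OF e(3) pt[OF eE]] e(2) by blast
        ultimately have "z \<in> ?Q2"
          using u unfolding snd_joint_run by (intro UN_I[of e]) (auto simp: sxs)
        then show ?thesis by blast
      qed
    qed
    also have "\<dots> \<le> measure_pmf.prob \<Omega> ?Q1 + measure_pmf.prob \<Omega> ?Q2"
      by (rule measure_Un_le) auto
    finally show ?thesis .
  qed
  have Q1: "measure_pmf.prob \<Omega> ?Q1 \<le> N * (1 - 1 / N) ^ M"
    by (rule prob_UN_le[OF finE]) (simp add: \<Omega>_def measure_pair_pmf_Times prob_edge_not_updated)
  have fE': "finite E'" "card E' \<le> N" using finE by (auto simp: E'_def intro!: card_mono)
  have bnn: "0 \<le> real (M + 1) * (real m * (N * \<alpha> ^ k))" using \<alpha>_nonneg by simp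
  have "measure_pmf.prob \<Omega> ?Q2 \<le> real (card E') * (real (M + 1) * (real m * (N * \<alpha> ^ k)))"
  proof (rule prob_UN_le[OF fE'(1)])
    fix e assume e: "e \<in> E'"
    have "measure_pmf.prob \<Omega> {(s, xs). (\<exists>u\<le>M. e \<in> pivotal v \<Lambda> (run v \<Lambda> (snd s) (take u xs))) \<and>
        pivotal_free v \<Lambda> (pt e) R (run v \<Lambda> (snd s) xs)} =
      measure_pmf.prob (path_pmf M) {(Y, xs). (\<exists>u\<le>M. e \<in> pivotal v \<Lambda> (run v \<Lambda> Y (take u xs))) \<and>
        pivotal_free v \<Lambda> (pt e) R (run v \<Lambda> Y xs)}"
      unfolding \<Omega>_path[symmetric] measure_map_pmf by (intro arg_cong2[where f = measure_pmf.prob]) auto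
    also have "\<dots> \<le> real (M + 1) * (real m * (N * \<alpha> ^ k))"
      unfolding M_def using e by (intro prob_pivotal_then_free[OF _ \<delta> pt R(1)]) (auto simp: E'_def)
    finally show "measure_pmf.prob \<Omega> {(s, xs). (\<exists>u\<le>M. e \<in> pivotal v \<Lambda> (run v \<Lambda> (snd s) (take u xs))) \<and>
        pivotal_free v \<Lambda> (pt e) R (run v \<Lambda> (snd s) xs)} \<le> real (M + 1) * (real m * (N * \<alpha> ^ k))" .
  qed
  also have "\<dots> \<le> N * (real (M + 1) * (real m * (N * \<alpha> ^ k)))"
    using fE'(2) bnn by (intro mult_right_mono) auto
  finally show ?thesis using split P1 P2 Q1 unfolding \<mu>_def[symmetric] M_def by linarith
qed

end

section \<open>Choice of the constants\<close>

lemma card_edges_in_le: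
  fixes \<Lambda> :: "(real ^ 'd::finite) set"
  assumes box: "cubic_box \<Lambda>"
  shows "card (edges_in \<Lambda>) \<le> (card (\<Lambda> \<inter> lattice))\<^sup>2"
proof -
  obtain r where r: "\<And>x. x \<in> \<Lambda> \<longleftrightarrow> (\<forall>i. \<bar>x $ i\<bar> \<le> r)" using cubic_boxE[OF box] by metis
  have fin: "finite (\<Lambda> \<inter> lattice)"
    by (rule finite_subset[OF _ finite_lattice_bounded[of r]]) (auto simp: r)
  have "edges_in \<Lambda> \<subseteq> (\<lambda>(x, y). {x, y}) ` ((\<Lambda> \<inter> lattice) \<times> (\<Lambda> \<inter> lattice))"
    unfolding edges_in_iff[OF box, THEN eq_reflection] by (force simp: edges_in_iff[OF box])
  then have "card (edges_in \<Lambda>) \<le> card ((\<Lambda> \<inter> lattice) \<times> (\<Lambda> \<inter> lattice))"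
    by (rule surj_card_le[rotated]) (use fin in simp)
  then show ?thesis by (simp add: card_cartesian_product power2_eq_square)
qed

text \<open>With \<open>t = c * ln n\<close>, the three terms are at most \<open>exp (-18 * t)\<close>, \<open>exp (-2 * t)\<close>
  and \<open>50 * exp (-12 * t)\<close>, and \<open>1 / n powr c\<close> is \<open>exp (- t)\<close>. The factor 20 in \<open>k\<close>
  beats the union bounds over edges, times and windows; the factor 4 in \<open>m\<close> beats the union bound over
  the edges that are never updated.\<close>

lemma error_terms_le:
  fixes n c L t \<beta> :: real and N m k :: nat
  assumes t_def: "t = c * L" and c: "c \<ge> 1" and n: "n \<ge> 52" and L: "L = ln n" "L \<ge> 1" and N: "N \<ge> 1" "real N \<le> n\<^sup>2"
    and m: "4 * t \<le> m" "m \<le> 5 * t" and k: "20 * t \<le> k" and \<beta>: "0 \<le> \<beta>" "\<beta> \<le> exp (-1)"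
  shows "N * \<beta> ^ k + N * (1 - 1 / N) ^ (m * N) + N * (real (m * N + 1) * (real m * (N * \<beta> ^ k))) \<le> 1 / n powr c"
proof -
  have Lt: "L \<le> t" using c L(2) by (simp add: t_def)
  have nL: "n = exp L" using n L(1) by simp
  have N2: "real N \<le> exp (2 * t)"
  proof -
    have "real N \<le> exp (2 * L)" using N(2) by (simp add: nL exp_double)
    also have "\<dots> \<le> exp (2 * t)" using Lt by simp
    finally show ?thesis .
  qed
  have "\<beta> ^ k \<le> exp (-1) ^ k" using \<beta> by (intro power_mono) auto
  also have "\<dots> = exp (- real k)" by (simp flip: exp_of_nat_mult)
  also have "\<dots> \<le> exp (- (20 * t))" using k by simp
  finally have \<beta>k: "\<beta> ^ k \<le> exp (- (20 * t))" .
  have "(1 - 1 / N) ^ (m * N) \<le> exp (- (1 / N)) ^ (m * N)"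
    using N(1) exp_ge_add_one_self[of "- (1 / N)"] by (intro power_mono) (auto simp: field_simps)
  also have "\<dots> = exp (- real m)" using N(1) by (simp flip: exp_of_nat_mult)
  also have "\<dots> \<le> exp (- (4 * t))" using m(1) by simp
  finally have e2: "(1 - 1 / N) ^ (m * N) \<le> exp (- (4 * t))" .
  have m1: "real m \<ge> 1" using m(1) Lt L(2) by linarith
  have mt: "real m \<le> 5 * exp t" using m(2) exp_ge_add_one_self[of t] by linarith
  have T1: "N * \<beta> ^ k \<le> exp (2 * t) * exp (- (20 * t))"
    using N2 \<beta>k \<beta>(1) by (intro mult_mono) auto
  have T2: "N * (1 - 1 / N) ^ (m * N) \<le> exp (2 * t) * exp (- (4 * t))"
    using N2 e2 N(1) by (intro mult_mono) (auto simp: field_simps)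
  have T3: "N * (real (m * N + 1) * (real m * (N * \<beta> ^ k))) \<le>
      exp (2 * t) * ((2 * (5 * exp t) * exp (2 * t)) * ((5 * exp t) * (exp (2 * t) * exp (- (20 * t)))))"
  proof -
    have "1 \<le> real m * real N" using m1 N(1) by (metis mult_mono' mult_1 of_nat_1 of_nat_le_iff zero_le_one)
    then have "real (m * N + 1) \<le> 2 * real m * real N" by (simp add: mult.commute)
    also have "\<dots> \<le> 2 * (5 * exp t) * exp (2 * t)" using mt N2 by (intro mult_mono) auto
    finally have "real (m * N + 1) \<le> 2 * (5 * exp t) * exp (2 * t)" .
    then show ?thesis using N2 mt \<beta>k \<beta>(1) by (intro mult_mono) auto
  qed
  have "exp (2 * t) * exp (- (20 * t)) \<le> exp (- (2 * t))" "exp (2 * t) * exp (- (4 * t)) \<le> exp (- (2 * t))"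
    using Lt L(2) by (simp_all flip: exp_add)
  moreover have "exp (2 * t) * ((2 * (5 * exp t) * exp (2 * t)) * ((5 * exp t) * (exp (2 * t) * exp (- (20 * t))))) \<le> 50 * exp (- (2 * t))"
  proof -
    have "exp (2 * t) * ((2 * (5 * exp t) * exp (2 * t)) * ((5 * exp t) * (exp (2 * t) * exp (- (20 * t))))) =
      50 * (exp (2 * t) * exp t * exp (2 * t) * exp t * exp (2 * t) * exp (- (20 * t)))" by simp
    also have "\<dots> = 50 * exp (- (12 * t))" by (simp flip: exp_add)
    also have "\<dots> \<le> 50 * exp (- (2 * t))" using Lt L(2) by simp
    finally show ?thesis .
  qed
  ultimately have "N * \<beta> ^ k + N * (1 - 1 / N) ^ (m * N) + N * (real (m * N + 1) * (real m * (N * \<beta> ^ k))) \<le> 52 * exp (- (2 * t))"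
    using T1 T2 T3 by linarith
  also have "\<dots> \<le> exp t * exp (- (2 * t))"
  proof (rule mult_right_mono)
    have "52 \<le> exp L" using n nL by simp
    also have "\<dots> \<le> exp t" using Lt by simp
    finally show "52 \<le> exp t" .
  qed simp
  also have "\<dots> = exp (- t)" by (simp flip: exp_add)
  also have "\<dots> = 1 / n powr c" using n by (simp add: powr_def t_def L(1) exp_minus inverse_eq_divide)
  finally show ?thesis .
qed

theorem theorem1p1:
  assumes "CARD('d::finite) \<ge> 2"
  shows "\<exists>p'::real. \<exists>\<kappa>::real. p' < 1 \<and> \<kappa> > 0 \<and>
    (\<forall>(v::'d) (p::real) (c::real) (\<Lambda>::(real ^ 'd) set).
       0 < p \<and> p' \<le> p \<and> p < 1 \<and> c \<ge> 1 \<and> cubic_box \<Lambda> \<and>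
       real (card (\<Lambda> \<inter> lattice))
         \<ge> max ((c * real CARD('d)) powr (c * real CARD('d) ^ 2)) (3 ^ (6 * CARD('d)))
       \<longrightarrow>
       measure_pmf.prob (equilibrium v \<Lambda> p)
         {(X, Y). \<exists>e \<in> pivotal v \<Lambda> Y \<union> interface \<Lambda> X Y.
            setdist (segment e) (- \<Lambda> \<union> (\<Union>f \<in> pivotal v \<Lambda> Y - {e}. segment f))
              \<ge> \<kappa> * c ^ 2 * (ln (real (card (\<Lambda> \<inter> lattice)))) ^ 2}
       \<le> 1 / real (card (\<Lambda> \<inter> lattice)) powr c)"
proof -
  define A where "A = real (adj_bound TYPE('d))"
  have A1: "A \<ge> 1" using adj_bound_pos[where 'd = 'd] by (simp add: A_def)
  \<comment> \<open>This makes \<open>q \<le> (1 / (12 * A))\<^sup>2\<close>, hence \<open>\<alpha> \<le> 1 / 3 \<le> exp (-1)\<close>.\<close>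
  define p' where "p' = 1 - 1 / (288 * A\<^sup>2)"
  show ?thesis
  proof (rule exI[of _ p'], rule exI[of _ "300 :: real"], intro conjI allI impI)
    show "p' < 1" using A1 by (simp add: p'_def)
    show "(0::real) < 300" by simp
    fix v :: 'd and p c :: real and \<Lambda> :: "(real ^ 'd) set"
    assume asm: "0 < p \<and> p' \<le> p \<and> p < 1 \<and> c \<ge> 1 \<and> cubic_box \<Lambda> \<and>
       real (card (\<Lambda> \<inter> lattice))
         \<ge> max ((c * real CARD('d)) powr (c * real CARD('d) ^ 2)) (3 ^ (6 * CARD('d)))"
    define n where "n = real (card (\<Lambda> \<inter> lattice))"
    have pp: "1 - p \<le> 1 / (288 * A\<^sup>2)" using asm by (simp add: p'_def)
    have "1 / (288 * A\<^sup>2) \<le> 1 / 2"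
    proof -
      have "A\<^sup>2 \<ge> 1" using A1 by simp
      then show ?thesis by (intro divide_left_mono) auto
    qed
    then have half: "1 / 2 \<le> p" using pp by linarith
    interpret box_percolation v \<Lambda> p
      by unfold_locales (use asm assms half in auto)
    have \<alpha>: "\<alpha> \<le> exp (-1)"
    proof -
      have "q \<le> (1 - p) / (1 / 2)" unfolding q_def using half p1 by (intro divide_left_mono) auto
      also have "\<dots> \<le> (1 / (12 * A))\<^sup>2" using pp by (simp add: power_divide power_mult_distrib)
      finally have "sqrt q \<le> 1 / (12 * A)" using A1 by (intro real_le_lsqrt) auto
      then have "\<alpha> \<le> 4 * A * (1 / (12 * A))"
        unfolding \<alpha>_def A_def[symmetric] using A1 by (intro mult_left_mono) auto
      also have "\<dots> = 1 / 3" using A1 by simp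
      also have "\<dots> \<le> exp (-1)" using exp_le by (simp add: exp_minus field_simps)
      finally show ?thesis .
    qed
    have n3: "n \<ge> 3 ^ 12"
    proof -
      have "(3::real) ^ 12 \<le> 3 ^ (6 * CARD('d))" using assms by (intro power_increasing) auto
      also have "\<dots> \<le> n" using asm by (simp add: n_def)
      finally show ?thesis .
    qed
    define L where "L = ln n"
    define t where "t = c * L"
    have L1: "L \<ge> 1"
    proof -
      have "exp 1 \<le> n" using n3 exp_le by simp
      then show ?thesis unfolding L_def using n3 by (simp add: ln_ge_iff)
    qed
    have t1: "t \<ge> 1" using L1 asm mult_mono[of 1 c 1 L] by (simp add: t_def)
    \<comment> \<open>\<open>m\<close> windows, each letting the pivotal edges advance by \<open>2 * k + 5\<close>: in total
      at most \<open>5 * t * (47 * t) < 300 * t\<^sup>2\<close>.\<close>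
    define k where "k = nat \<lceil>20 * t\<rceil>"
    define m where "m = nat \<lceil>4 * t\<rceil>"
    have k: "20 * t \<le> k" "k \<le> 20 * t + 1" using t1 unfolding k_def by linarith+
    have m: "4 * t \<le> m" "m \<le> 5 * t" using t1 unfolding m_def by linarith+
    have tt: "t \<le> t\<^sup>2" using t1 by (simp add: power2_eq_square)
    have R: "300 * c ^ 2 * L ^ 2 = 300 * t\<^sup>2" by (simp add: t_def power_mult_distrib)
    have "measure_pmf.prob (equilibrium v \<Lambda> p) {(X, Y). \<exists>e\<in>pivotal v \<Lambda> Y \<union> interface \<Lambda> X Y. isolated (300 * c ^ 2 * L ^ 2) Y e}
      \<le> N * \<alpha> ^ k + N * (1 - 1 / N) ^ (m * N) + N * (real (m * N + 1) * (real m * (N * \<alpha> ^ k)))"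
    proof (rule prob_equilibrium_isolated[OF order_refl])
      have "real m * (2 * real k + 5) \<le> (5 * t) * (47 * t)"
        using m k t1 by (intro mult_mono) auto
      also have "\<dots> < 300 * t\<^sup>2" using t1 by (simp add: power2_eq_square)
      finally show "real m * (2 * real k + 5) < 300 * c ^ 2 * L ^ 2" unfolding R .
      show "2 * real k + 2 < 300 * c ^ 2 * L ^ 2" unfolding R using k tt t1 by linarith
    qed
    also have "\<dots> \<le> 1 / n powr c"
    proof (rule error_terms_le[where L = L])
      show "real N \<le> n\<^sup>2"
        using card_edges_in_le[OF box] by (simp add: n_def flip: of_nat_power)
    qed (use asm n3 L1 N_pos m k \<alpha> \<alpha>_nonneg in \<open>auto simp: L_def[symmetric] t_def[symmetric]\<close>)
    finally show "measure_pmf.prob (equilibrium v \<Lambda> p)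
         {(X, Y). \<exists>e \<in> pivotal v \<Lambda> Y \<union> interface \<Lambda> X Y.
            setdist (segment e) (- \<Lambda> \<union> (\<Union>f \<in> pivotal v \<Lambda> Y - {e}. segment f))
              \<ge> 300 * c ^ 2 * (ln (real (card (\<Lambda> \<inter> lattice)))) ^ 2}
       \<le> 1 / real (card (\<Lambda> \<inter> lattice)) powr c"
      unfolding isolated_def L_def n_def .
  qed
qed

end
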